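(* Let $n\ge 2$ be an integer and let $f,g\in C_0^\infty(\mathbb{R}^n)$ satisfy $f(x)\ge 0$, $g(x)\ge 0$ for all $x$, $f(x)=g(x)=0$ for $|x|>1$, and $g\not\equiv 0$. Let $p,q$ be real numbers satisfying $$\max\left(1,\frac{2}{n-1}\right)<p\le\frac{2n}{n-1},\qquad 1<q<\min\left(\frac{4}{(n-1)p-2}+1,\ \frac{2n}{n-2}\right),$$ and let $r=\max(2,p)$. For $\varepsilon>0$ consider the Cauchy problem $$ \begin{cases} \Box u(t,x)=|u_t(t,x)|^p+|u(t,x)|^q, & x\in\mathbb{R}^n,\ t>0,\\ u(0,x)=\varepsilon f(x),\quad u_t(0,x)=\varepsilon g(x), & x\in\mathbb{R}^n . \end{cases} $$ Then there exist constants $\varepsilon_0>0$ and $A>0$, independent of $\varepsilon$, such that for every $0<\varepsilon\le\varepsilon_0$ the following holds. If $T\in(0,\infty]$ and the problem has a solution $u$ on $[0,T)\times\mathbb{R}^n$ with $(u,u_t)\in C([0,T),\,H^1(\mathbb{R}^n)\times L^r(\mathbb{R}^n))$ and $$\operatorname{supp}(u,u_t)\subset\{(x,t):\ |x|\le t+1\},$$ then $T<\infty$, that is, the solution blows up in finite time. Moreover, the lifespan $T(\varepsilon)$ of solutions of the problem satisfies $$T(\varepsilon)\le A\,\varepsilon^{-\frac{2p(q-1)}{2q+2-(n-1)p(q-1)}}.$$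
   Context: $\Box=\partial_t^2-\sum_{i=1}^n\partial_{x_i}^2$ is the wave operator on $\mathbb{R}\times\mathbb{R}^n$, and all functions are real-valued. For $n=2$ the quantity $\frac{2n}{n-2}$ is interpreted as $+\infty$. "Solution" means that the equation holds in the sense of distributions on $(0,T)\times\mathbb{R}^n$ and that the initial data are attained at $t=0$ by the continuous curve $(u,u_t)$. The lifespan $T(\varepsilon)$ is the supremum of all $T>0$ for which a solution with the stated regularity and support property exists on $[0,T)$. *)

theory Defs
  imports "HOL-Analysis.Analysis"
begin

section \<open>Smooth functions and weak derivatives\<close>

definition partial_deriv :: "'a::euclidean_space \<Rightarrow> ('a \<Rightarrow> real) \<Rightarrow> 'a \<Rightarrow> real" where
  "partial_deriv b f x = frechet_derivative f (at x) b"

primrec iterated_partial :: "'a::euclidean_space list \<Rightarrow> ('a \<Rightarrow> real) \<Rightarrow> 'a \<Rightarrow> real" where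
  "iterated_partial [] f = f"
| "iterated_partial (b # bs) f = partial_deriv b (iterated_partial bs f)"

text \<open>Differentiability of the partial derivatives of every order includes their continuity,
  so this is the class of infinitely often continuously differentiable functions.\<close>

definition smooth_fun :: "('a::euclidean_space \<Rightarrow> real) \<Rightarrow> bool" where
  "smooth_fun f \<longleftrightarrow> (\<forall>bs\<in>lists Basis. iterated_partial bs f differentiable_on UNIV)"

definition test_functions :: "'a::euclidean_space set \<Rightarrow> ('a \<Rightarrow> real) set" where
  "test_functions \<Omega> =
    {\<phi>. smooth_fun \<phi> \<and> compact (closure {x. \<phi> x \<noteq> 0}) \<and> closure {x. \<phi> x \<noteq> 0} \<subseteq> \<Omega>}"

definition locally_integrable_on :: "'a::euclidean_space set \<Rightarrow> ('a \<Rightarrow> real) \<Rightarrow> bool" where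
  "locally_integrable_on \<Omega> f \<longleftrightarrow>
    (\<forall>K. compact K \<and> K \<subseteq> \<Omega> \<longrightarrow> set_integrable lborel K f)"

definition weak_partial_on ::
    "'a::euclidean_space set \<Rightarrow> 'a \<Rightarrow> ('a \<Rightarrow> real) \<Rightarrow> ('a \<Rightarrow> real) \<Rightarrow> bool" where
  "weak_partial_on \<Omega> b f h \<longleftrightarrow>
    locally_integrable_on \<Omega> f \<and> locally_integrable_on \<Omega> h \<and>
    (\<forall>\<phi>\<in>test_functions \<Omega>.
      (\<integral>x. f x * partial_deriv b \<phi> x \<partial>lborel) = - (\<integral>x. h x * \<phi> x \<partial>lborel))"

section \<open>Lebesgue and Sobolev spaces\<close>

text \<open>Elements of these spaces are given by Borel representatives; the norms do not
  distinguish functions that agree almost everywhere.\<close>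

definition Lp_space :: "real \<Rightarrow> ('a::euclidean_space \<Rightarrow> real) set" where
  "Lp_space r = {f \<in> borel_measurable lborel. integrable lborel (\<lambda>x. \<bar>f x\<bar> powr r)}"

definition Lp_norm :: "real \<Rightarrow> ('a::euclidean_space \<Rightarrow> real) \<Rightarrow> real" where
  "Lp_norm r f = (\<integral>x. \<bar>f x\<bar> powr r \<partial>lborel) powr (1 / r)"

definition H1_space :: "('a::euclidean_space \<Rightarrow> real) set" where
  "H1_space = {f \<in> Lp_space 2. \<forall>b\<in>Basis. \<exists>h\<in>Lp_space 2. weak_partial_on UNIV b f h}"

text \<open>A weak partial derivative is unique up to a null set, so the choice does not affect
  the norm on \<open>H1_space\<close>.\<close>

definition weak_partial :: "'a::euclidean_space \<Rightarrow> ('a \<Rightarrow> real) \<Rightarrow> 'a \<Rightarrow> real" where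
  "weak_partial b f = (SOME h. h \<in> Lp_space 2 \<and> weak_partial_on UNIV b f h)"

definition H1_norm :: "('a::euclidean_space \<Rightarrow> real) \<Rightarrow> real" where
  "H1_norm f = sqrt ((Lp_norm 2 f)\<^sup>2 + (\<Sum>b\<in>Basis. (Lp_norm 2 (weak_partial b f))\<^sup>2))"

definition continuous_curve ::
    "('a \<Rightarrow> real) set \<Rightarrow> (('a \<Rightarrow> real) \<Rightarrow> real) \<Rightarrow> real set \<Rightarrow> (real \<Rightarrow> 'a \<Rightarrow> real) \<Rightarrow> bool" where
  "continuous_curve X N I w \<longleftrightarrow>
    (\<forall>t\<in>I. w t \<in> X) \<and>
    (\<forall>t\<in>I. ((\<lambda>s. N (\<lambda>x. w s x - w t x)) \<longlongrightarrow> 0) (at t within I))"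

section \<open>The Cauchy problem\<close>

definition wave_op :: "(real \<times> 'a::euclidean_space \<Rightarrow> real) \<Rightarrow> real \<times> 'a \<Rightarrow> real" where
  "wave_op \<phi> z = partial_deriv (1, 0) (partial_deriv (1, 0) \<phi>) z
     - (\<Sum>b\<in>Basis. partial_deriv (0, b) (partial_deriv (0, b) \<phi>) z)"

definition time_interval :: "ereal \<Rightarrow> real set" where
  "time_interval T = {t. 0 \<le> t \<and> ereal t < T}"

definition open_strip :: "ereal \<Rightarrow> (real \<times> 'a::euclidean_space) set" where
  "open_strip T = {(t, x). 0 < t \<and> ereal t < T}"

text \<open>\<open>wave_op\<close> is formally self-adjoint. The integrability conditions say that
  \<open>u\<close> and \<open>F\<close> are distributions on the strip.\<close>

definition distributional_wave_eq ::
    "ereal \<Rightarrow> (real \<times> 'a::euclidean_space \<Rightarrow> real) \<Rightarrow> (real \<times> 'a \<Rightarrow> real) \<Rightarrow> bool" where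
  "distributional_wave_eq T u F \<longleftrightarrow>
    locally_integrable_on (open_strip T) u \<and> locally_integrable_on (open_strip T) F \<and>
    (\<forall>\<phi>\<in>test_functions (open_strip T).
      (\<integral>z. u z * wave_op \<phi> z \<partial>lborel) = (\<integral>z. F z * \<phi> z \<partial>lborel))"

text \<open>The solution is a pair of curves; the first clause makes \<open>v\<close> the distributional
  time derivative of \<open>u\<close>.\<close>

definition cauchy_solution ::
    "real \<Rightarrow> real \<Rightarrow> ('a::euclidean_space \<Rightarrow> real) \<Rightarrow> ('a \<Rightarrow> real) \<Rightarrow> ereal \<Rightarrow>
     (real \<Rightarrow> 'a \<Rightarrow> real) \<Rightarrow> (real \<Rightarrow> 'a \<Rightarrow> real) \<Rightarrow> bool" where
  "cauchy_solution p q u0 u1 T u v \<longleftrightarrow>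
    weak_partial_on (open_strip T) (1, 0) (\<lambda>(t, x). u t x) (\<lambda>(t, x). v t x) \<and>
    distributional_wave_eq T (\<lambda>(t, x). u t x) (\<lambda>(t, x). \<bar>v t x\<bar> powr p + \<bar>u t x\<bar> powr q) \<and>
    (AE x in lborel. u 0 x = u0 x) \<and> (AE x in lborel. v 0 x = u1 x)"

definition energy_regular ::
    "real \<Rightarrow> ereal \<Rightarrow> (real \<Rightarrow> 'a::euclidean_space \<Rightarrow> real) \<Rightarrow> (real \<Rightarrow> 'a \<Rightarrow> real) \<Rightarrow> bool" where
  "energy_regular r T u v \<longleftrightarrow>
    continuous_curve H1_space H1_norm (time_interval T) u \<and>
    continuous_curve (Lp_space r) (Lp_norm r) (time_interval T) v"

text \<open>The set where \<open>norm x > t + 1\<close> is open, so containment of the support in the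
  complementary cone means vanishing almost everywhere on that set.\<close>

definition supported_in_cone ::
    "ereal \<Rightarrow> (real \<Rightarrow> 'a::euclidean_space \<Rightarrow> real) \<Rightarrow> (real \<Rightarrow> 'a \<Rightarrow> real) \<Rightarrow> bool" where
  "supported_in_cone T u v \<longleftrightarrow>
    (\<forall>t\<in>time_interval T. AE x in lborel. norm x > t + 1 \<longrightarrow> u t x = 0 \<and> v t x = 0)"

definition lifespan ::
    "real \<Rightarrow> real \<Rightarrow> real \<Rightarrow> ('a::euclidean_space \<Rightarrow> real) \<Rightarrow> ('a \<Rightarrow> real) \<Rightarrow> ereal" where
  "lifespan p q r u0 u1 = Sup {T. 0 < T \<and>
    (\<exists>u v. cauchy_solution p q u0 u1 T u v \<and> energy_regular r T u v \<and> supported_in_cone T u v)}"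

definition sobolev_exponent :: "nat \<Rightarrow> ereal" where
  "sobolev_exponent n = (if n = 2 then \<infinity> else ereal (2 * real n / (real n - 2)))"

end

(* Let w > 0 be the radial eigenfunction of the Laplacian with eigenvalue 1. Its decay
   w(x) = O((1 + |x|)^(-(n-1)/2) exp |x|) and the inequality (d/dt) int u_t w >= int u w bound
   int u_t w from below by a multiple of eps exp t, and Hoelder's inequality on the ball
   |x| <= t + 1 turns this into int |u_t|^p >= c eps^p (1 + t)^((n-1)(1 - p/2)).
   The mean U(t) = int u(t, x) dx therefore satisfies
     U'' >= c eps^p (1 + t)^((n-1)(1 - p/2))  and  U'' >= c (1 + t)^(-n(q-1)) |U|^q.
   The first inequality gives the initial growth of U and the second one makes U blow up.
   Both are obtained from the distributional equation by testing with products
   eta(t) Theta(|x|^2), where Theta is cut off outside the cone. *)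

theory Submission
  imports Defs
begin

text \<open>A solution is only a pair of continuous curves with a source that is locally integrable
  in space-time, so the mean U need not be twice differentiable. With V the mean of u_t, both U' = V
  and V' >= Y are therefore used in the distributional form \<open>weak_ge\<close>, and every
  comparison with an explicit function rests on one monotonicity argument. Likewise the L^p and L^q
  norms of slices are used only at almost every time, where Fubini makes the source integrable.

  The constants come from scaling. With alpha = (n-1)(1 - p/2) the first inequality gives U(tau) >=
  M = c eps^p tau^(alpha+2). On [tau, 2 tau] the second one has a coefficient b of order
  tau^(-n(q-1)) and forces blow-up within time tau once b M^(q-1) tau^2 is large. Up to a constant
  this product is eps^(p(q-1)) tau^beta with beta = (alpha+2)(q-1) - n(q-1) + 2 = (2q + 2 -
  (n-1)p(q-1))/2. The condition q < 4/((n-1)p-2) + 1 says that beta > 0, and tau of order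
  eps^(-p(q-1)/beta) is the stated lifespan: living beyond 2 tau is contradictory.\<close>

section \<open>Smooth functions of one variable\<close>

text \<open>A greatest fixed point: a function is smooth as soon as it belongs to some class closed
  under differentiation. Each coinduction below only has to exhibit such a class.\<close>

coinductive smooth1 :: "(real \<Rightarrow> real) \<Rightarrow> bool" where
  "(\<And>x. (f has_real_derivative f' x) (at x)) \<Longrightarrow> smooth1 f' \<Longrightarrow> smooth1 f"

text \<open>The derivative of a product is a sum of products, so coinduction works only after the class
  has been closed under all operations at once.\<close>

inductive smooth1_gen :: "(real \<Rightarrow> real) \<Rightarrow> bool" where
  base: "smooth1 f \<Longrightarrow> smooth1_gen f"
| const: "smooth1_gen (\<lambda>x. c)"
| id: "smooth1_gen (\<lambda>x. x)"
| add: "smooth1_gen f \<Longrightarrow> smooth1_gen g \<Longrightarrow> smooth1_gen (\<lambda>x. f x + g x)"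
| mult: "smooth1_gen f \<Longrightarrow> smooth1_gen g \<Longrightarrow> smooth1_gen (\<lambda>x. f x * g x)"
| inverse: "smooth1_gen f \<Longrightarrow> (\<And>x. f x > 0) \<Longrightarrow> smooth1_gen (\<lambda>x. inverse (f x))"
| comp: "smooth1 f \<Longrightarrow> smooth1_gen g \<Longrightarrow> smooth1_gen (\<lambda>x. f (g x))"

lemma smooth1_ex_deriv:
  assumes "smooth1 f"
  shows "\<exists>f'. (\<forall>x. (f has_real_derivative f' x) (at x)) \<and> smooth1 f'"
  using assms by (cases rule: smooth1.cases) auto

lemma smooth1_gen_deriv:
  assumes "smooth1_gen f"
  shows "\<exists>f'. (\<forall>x. (f has_real_derivative f' x) (at x)) \<and> smooth1_gen f'"
  using assms
proof induction
  case (base f)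
  then obtain f' where "\<And>x. (f has_real_derivative f' x) (at x)" "smooth1 f'"
    using smooth1_ex_deriv by blast
  then show ?case using smooth1_gen.base by blast
next
  case (const c)
  then show ?case by (intro exI[of _ "\<lambda>x. 0"]) (auto intro: smooth1_gen.const)
next
  case id
  then show ?case by (intro exI[of _ "\<lambda>x. 1"]) (auto intro: smooth1_gen.const)
next
  case (add f g)
  then obtain f' g' where "\<And>x. (f has_real_derivative f' x) (at x)" "smooth1_gen f'"
    "\<And>x. (g has_real_derivative g' x) (at x)" "smooth1_gen g'" by blast
  then show ?case
    by (intro exI[of _ "\<lambda>x. f' x + g' x"]) (auto intro!: smooth1_gen.add derivative_intros)
next
  case (mult f g)
  then obtain f' g' where "\<And>x. (f has_real_derivative f' x) (at x)" "smooth1_gen f'"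
    "\<And>x. (g has_real_derivative g' x) (at x)" "smooth1_gen g'" by blast
  with mult.hyps show ?case
    by (intro exI[of _ "\<lambda>x. f' x * g x + g' x * f x"])
      (auto intro!: smooth1_gen.add smooth1_gen.mult derivative_intros)
next
  case (inverse f)
  then obtain f' where f': "\<And>x. (f has_real_derivative f' x) (at x)" "smooth1_gen f'" by blast
  have nz: "f x \<noteq> 0" for x using inverse.hyps(2)[of x] by simp
  \<comment> \<open>The derivative -f'/f^2 is written with a factor -1 and two reciprocals, so that
    it is literally generated by \<open>const\<close>, \<open>mult\<close> and
    \<open>inverse\<close>.\<close>
  have "((\<lambda>x. inverse (f x)) has_real_derivative (-1) * (inverse (f x) * f' x * inverse (f x))) (at x)" for x
    using f'(1) nz by (auto intro!: derivative_eq_intros)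
  moreover have "smooth1_gen (\<lambda>x. (-1) * (inverse (f x) * f' x * inverse (f x)))"
    using inverse.hyps f'(2) by (intro smooth1_gen.mult smooth1_gen.const smooth1_gen.inverse)
  ultimately show ?case by (intro exI[of _ "\<lambda>x. (-1) * (inverse (f x) * f' x * inverse (f x))"]) auto
next
  case (comp f g)
  obtain f' where f': "\<And>x. (f has_real_derivative f' x) (at x)" "smooth1 f'"
    using smooth1_ex_deriv[OF comp.hyps(1)] by blast
  obtain g' where g': "\<And>x. (g has_real_derivative g' x) (at x)" "smooth1_gen g'"
    using comp.IH by blast
  have "((\<lambda>x. f (g x)) has_real_derivative f' (g x) * g' x) (at x)" for x
    using DERIV_chain2[OF f'(1) g'(1)] .
  moreover have "smooth1_gen (\<lambda>x. f' (g x) * g' x)"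
    by (rule smooth1_gen.mult[OF smooth1_gen.comp[OF f'(2) comp.hyps(2)] g'(2)])
  ultimately show ?case by (intro exI[of _ "\<lambda>x. f' (g x) * g' x"]) auto
qed

text \<open>By \<open>smooth1_gen_deriv\<close> the generated class is closed under differentiation,
  which is the invariant that the coinduction asks for.\<close>

lemma smooth1_gen_imp: "smooth1_gen f \<Longrightarrow> smooth1 f"
proof (coinduction arbitrary: f rule: smooth1.coinduct)
  case (smooth1 f)
  then obtain f' where "\<forall>x. (f has_real_derivative f' x) (at x)" "smooth1_gen f'"
    using smooth1_gen_deriv by blast
  then show ?case by (intro exI[of _ f] exI[of _ f']) simp
qed

lemma smooth1_const: "smooth1 (\<lambda>x. c)"
  by (rule smooth1_gen_imp[OF smooth1_gen.const])

lemma smooth1_id: "smooth1 (\<lambda>x. x)"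
  by (rule smooth1_gen_imp[OF smooth1_gen.id])

lemma smooth1_add: "smooth1 f \<Longrightarrow> smooth1 g \<Longrightarrow> smooth1 (\<lambda>x. f x + g x)"
  by (rule smooth1_gen_imp[OF smooth1_gen.add[OF smooth1_gen.base smooth1_gen.base]])

lemma smooth1_mult: "smooth1 f \<Longrightarrow> smooth1 g \<Longrightarrow> smooth1 (\<lambda>x. f x * g x)"
  by (rule smooth1_gen_imp[OF smooth1_gen.mult[OF smooth1_gen.base smooth1_gen.base]])

lemma smooth1_diff:
  assumes "smooth1 f" "smooth1 g"
  shows "smooth1 (\<lambda>x. f x - g x)"
proof -
  have "smooth1 (\<lambda>x. f x + (-1) * g x)"
    using assms by (intro smooth1_add smooth1_mult smooth1_const)
  then show ?thesis by simp
qed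

lemma smooth1_inverse:
  "smooth1 f \<Longrightarrow> (\<And>x. f x > 0) \<Longrightarrow> smooth1 (\<lambda>x. inverse (f x))"
  by (rule smooth1_gen_imp[OF smooth1_gen.inverse[OF smooth1_gen.base]])

lemma smooth1_comp: "smooth1 f \<Longrightarrow> smooth1 g \<Longrightarrow> smooth1 (\<lambda>x. f (g x))"
  by (rule smooth1_gen_imp[OF smooth1_gen.comp[OF _ smooth1_gen.base]])

lemma smooth1_deriv:
  assumes "smooth1 f"
  shows "(f has_real_derivative deriv f x) (at x)" and "smooth1 (deriv f)"
proof -
  obtain f' where f': "\<And>x. (f has_real_derivative f' x) (at x)" "smooth1 f'"
    using smooth1_ex_deriv[OF assms] by blast
  then have "deriv f = f'" by (auto simp: DERIV_imp_deriv)
  with f' show "(f has_real_derivative deriv f x) (at x)" "smooth1 (deriv f)" by auto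
qed

lemma smooth1_continuous:
  assumes "smooth1 f"
  shows "continuous_on S f"
  using smooth1_deriv(1)[OF assms] DERIV_continuous_on has_field_derivative_at_within by blast

lemma smooth1_exp_mult: "smooth1 (\<lambda>x. exp (c * x))"
proof -
  \<comment> \<open>The free scalar \<open>a\<close> makes the class closed under differentiation:
    the derivative carries \<open>a * c\<close> in its place.\<close>
  have main: "smooth1 f" if "\<exists>a. f = (\<lambda>x. a * exp (c * x))" for f
    using that
  proof (coinduction arbitrary: f rule: smooth1.coinduct)
    case (smooth1 f)
    then obtain a where f: "f = (\<lambda>x. a * exp (c * x))" by blast
    have "(f has_real_derivative (a * c) * exp (c * x)) (at x)" for x
      unfolding f by (auto intro!: derivative_eq_intros)
    then show ?case by (intro exI[of _ f] exI[of _ "\<lambda>x. (a * c) * exp (c * x)"]) auto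
  qed
  have "\<exists>a. (\<lambda>x. exp (c * x)) = (\<lambda>x. a * exp (c * x))"
    by (rule exI[of _ 1]) simp
  then show ?thesis by (rule main)
qed

lemma smooth1_power_series:
  fixes c :: "nat \<Rightarrow> real"
  assumes "\<And>x. summable (\<lambda>k. c k * x ^ k)"
  shows "smooth1 (\<lambda>x. \<Sum>k. c k * x ^ k)"
proof -
  have main: "smooth1 f" if "\<exists>c. (\<forall>x. summable (\<lambda>k. c k * x ^ k)) \<and> f = (\<lambda>x. \<Sum>k. c k * x ^ k)" for f
    using that
  proof (coinduction arbitrary: f rule: smooth1.coinduct)
    case (smooth1 f)
    then obtain c where c: "\<And>x. summable (\<lambda>k. c k * x ^ k)" "f = (\<lambda>x. \<Sum>k. c k * x ^ k)" by blast
    have "(f has_real_derivative (\<Sum>k. diffs c k * x ^ k)) (at x)" for x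
      unfolding c(2) by (rule termdiffs_strong_converges_everywhere) (rule c(1))
    moreover have "summable (\<lambda>k. diffs c k * x ^ k)" for x
      by (rule termdiff_converges_all) (rule c(1))
    ultimately show ?case by (intro exI[of _ f] exI[of _ "\<lambda>x. \<Sum>k. diffs c k * x ^ k"]) auto
  qed
  have "\<exists>d. (\<forall>x. summable (\<lambda>k. d k * x ^ k)) \<and> (\<lambda>x. \<Sum>k. c k * x ^ k) = (\<lambda>x. \<Sum>k. d k * x ^ k)"
    using assms by (intro exI[of _ c]) simp
  then show ?thesis by (rule main)
qed

section \<open>A smooth monotone transition from 0 to 1\<close>

lemma tendsto_poly_exp_0:
  fixes P :: "real poly"
  shows "((\<lambda>y. poly P y * exp (- y)) \<longlongrightarrow> 0) at_top"
proof -
  have "((\<lambda>y. \<Sum>i\<le>degree P. coeff P i * (y ^ i / exp y)) \<longlongrightarrow> (\<Sum>i\<le>degree P. coeff P i * 0)) at_top"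
    by (intro tendsto_intros tendsto_power_div_exp_0)
  also have "(\<lambda>y. \<Sum>i\<le>degree P. coeff P i * (y ^ i / exp y)) = (\<lambda>y. poly P y * exp (- y))"
    by (simp add: poly_altdef exp_minus sum_distrib_right divide_inverse mult.assoc)
  finally show ?thesis by simp
qed

text \<open>The classical function exp(-1/x), whose derivatives of every order vanish at 0.\<close>

definition flat :: "real \<Rightarrow> real" where
  "flat x = (if x > 0 then exp (- inverse x) else 0)"

lemma smooth1_flat: "smooth1 flat"
proof -
  define E where "E P x = (if x > 0 then poly P (inverse x) * exp (- inverse x) else 0)"
    for P and x :: real
  have main: "smooth1 f" if "\<exists>P. f = E P" for f
    using that
  proof (coinduction arbitrary: f rule: smooth1.coinduct)
    case (smooth1 f)
    then obtain P where f: "f = E P" by blast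
    \<comment> \<open>With y = 1/x and dy/dx = -y^2, the derivative of P(y) exp(-y) is y^2 (P(y) -
      P'(y)) exp(-y), and \<open>[:0, 0, 1:]\<close> is y^2. Hence the functions \<open>E P\<close>
      form a class closed under differentiation.\<close>
    define Q where "Q = [:0, 0, 1:] * (P - pderiv P)"
    have "(E P has_real_derivative E Q x) (at x)" for x
    proof -
      consider "x > 0" | "x < 0" | "x = 0" by linarith
      then show ?thesis
      proof cases
        case 1
        have i: "((\<lambda>y. inverse y) has_real_derivative - (inverse x * inverse x)) (at x)"
          using DERIV_inverse[of x UNIV] 1 by (simp add: power2_eq_square)
        have "((\<lambda>y. poly P (inverse y) * exp (- inverse y)) has_real_derivative
            poly (pderiv P) (inverse x) * - (inverse x * inverse x) * exp (- inverse x)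
            + exp (- inverse x) * - (- (inverse x * inverse x)) * poly P (inverse x)) (at x)"
          by (intro DERIV_mult DERIV_chain2[OF poly_DERIV i] DERIV_chain2[OF DERIV_exp DERIV_minus[OF i]])
        then have "((\<lambda>y. poly P (inverse y) * exp (- inverse y)) has_real_derivative E Q x) (at x)"
          using 1 by (simp add: E_def Q_def algebra_simps)
        moreover have "eventually (\<lambda>y. y > 0) (nhds x)"
          using 1 eventually_nhds_in_open[of "{0<..}" x] by auto
        then have "eventually (\<lambda>y. poly P (inverse y) * exp (- inverse y) = E P y) (nhds x)"
          by eventually_elim (simp add: E_def)
        ultimately show ?thesis by (rule DERIV_cong_ev[OF refl _ refl, THEN iffD1, rotated])
      next
        case 2
        have "eventually (\<lambda>y. y < 0) (nhds x)"
          using 2 eventually_nhds_in_open[of "{..<0}" x] by auto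
        then have "eventually (\<lambda>y. 0 = E P y) (nhds x)"
          by eventually_elim (simp add: E_def)
        moreover have "((\<lambda>y. 0) has_real_derivative E Q x) (at x)"
          using 2 by (simp add: E_def)
        ultimately show ?thesis by (rule DERIV_cong_ev[OF refl _ refl, THEN iffD1])
      next
        case 3
        \<comment> \<open>Dividing by y in the right-hand difference quotient multiplies the
          polynomial in 1/y by the monomial \<open>[:0,1:]\<close>; the exponential still
          dominates.\<close>
        have "((\<lambda>y. poly ([:0,1:] * P) (inverse y) * exp (- inverse y)) \<longlongrightarrow> 0) (at_right 0)"
          using filterlim_compose[OF tendsto_poly_exp_0 filterlim_inverse_at_top_right] .
        moreover have "eventually (\<lambda>y. poly ([:0,1:] * P) (inverse y) * exp (- inverse y)
             = (E P y - E P 0) / (y - 0)) (at_right 0)"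
          using eventually_at_right_less[of "0::real"]
          by eventually_elim (simp add: E_def divide_inverse mult_ac)
        ultimately have R: "((\<lambda>y. (E P y - E P 0) / (y - 0)) \<longlongrightarrow> 0) (at_right 0)"
          by (rule tendsto_cong[THEN iffD1, rotated])
        have "eventually (\<lambda>y::real. y < 0) (at_left 0)"
          by (simp add: eventually_at_filter)
        then have "eventually (\<lambda>y. 0 = (E P y - E P 0) / (y - 0)) (at_left 0)"
          by eventually_elim (simp add: E_def)
        then have L: "((\<lambda>y. (E P y - E P 0) / (y - 0)) \<longlongrightarrow> 0) (at_left 0)"
          by (rule tendsto_cong[THEN iffD1, OF _ tendsto_const])
        show ?thesis
          unfolding 3 has_field_derivative_iff
          using filterlim_split_at[OF L R] by (simp add: E_def)
      qed
    qed
    with f show ?case by (intro exI[of _ f] exI[of _ "E Q"]) auto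
  qed
  have "flat = E [:1:]" by (auto simp: flat_def E_def)
  then have "\<exists>P. flat = E P" by (rule exI)
  then show ?thesis by (rule main)
qed

text \<open>The denominator is positive because \<open>x\<close> or \<open>1 - x\<close> is. The
  same transition serves for the plateaus in time and for the cutoff in space.\<close>

definition smooth_step :: "real \<Rightarrow> real" where
  "smooth_step x = flat x * inverse (flat x + flat (1 - x))"

lemma flat_nonneg: "flat x \<ge> 0" and flat_pos_sum: "flat x + flat (1 - x) > 0"
  by (auto simp: flat_def add_pos_pos)

lemma flat_mono: "x \<le> y \<Longrightarrow> flat x \<le> flat y"
  by (auto simp: flat_def)

lemma smooth1_smooth_step: "smooth1 smooth_step"
proof -
  have "smooth1 (\<lambda>x. flat (1 - x))"
    by (rule smooth1_comp[OF smooth1_flat]) (intro smooth1_diff smooth1_const smooth1_id)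
  then have "smooth1 (\<lambda>x. flat x * inverse (flat x + flat (1 - x)))"
    using smooth1_flat flat_pos_sum by (intro smooth1_mult smooth1_inverse smooth1_add)
  then show ?thesis by (simp add: smooth_step_def[abs_def])
qed

lemma smooth_step_0: "x \<le> 0 \<Longrightarrow> smooth_step x = 0"
  by (simp add: smooth_step_def flat_def)

lemma smooth_step_1: "x \<ge> 1 \<Longrightarrow> smooth_step x = 1"
  by (simp add: smooth_step_def flat_def)

lemma smooth_step_mono:
  assumes "x \<le> y"
  shows "smooth_step x \<le> smooth_step y"
proof -
  \<comment> \<open>After clearing denominators the products \<open>flat x * flat y\<close> cancel,
    and this is what remains.\<close>
  have "flat x * flat (1 - y) \<le> flat y * flat (1 - x)"
    using assms by (intro mult_mono flat_mono flat_nonneg) auto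
  then show ?thesis
    using flat_pos_sum[of x] flat_pos_sum[of y]
    by (simp add: smooth_step_def field_simps)
qed

section \<open>Smooth functions of several variables\<close>

text \<open>\<open>smooth_fun\<close> speaks about partial derivatives of every order. A class
  generated from linear functionals and closed under partial derivatives settles all orders without
  computing any of them.\<close>

inductive smooth_gen :: "('a::euclidean_space \<Rightarrow> real) \<Rightarrow> bool" where
  const: "smooth_gen (\<lambda>z. c)"
| inner: "smooth_gen (\<lambda>z. z \<bullet> a)"
| add: "smooth_gen f \<Longrightarrow> smooth_gen g \<Longrightarrow> smooth_gen (\<lambda>z. f z + g z)"
| mult: "smooth_gen f \<Longrightarrow> smooth_gen g \<Longrightarrow> smooth_gen (\<lambda>z. f z * g z)"
| comp: "smooth1 f \<Longrightarrow> smooth_gen g \<Longrightarrow> smooth_gen (\<lambda>z. f (g z))"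

lemma has_derivative_imp_partial_deriv:
  "(f has_derivative f') (at z) \<Longrightarrow> partial_deriv b f z = f' b"
  using frechet_derivative_at[of f f' z] by (simp add: partial_deriv_def)

text \<open>The direction is the first argument of \<open>f'\<close>, so that for each fixed
  direction the derivative is again a member of the class.\<close>

lemma smooth_gen_deriv:
  assumes "smooth_gen f"
  shows "\<exists>f'. (\<forall>z. (f has_derivative (\<lambda>b. f' b z)) (at z)) \<and> (\<forall>b. smooth_gen (f' b))"
  using assms
proof induction
  case (const c)
  then show ?case
    by (intro exI[of _ "\<lambda>b z. 0"]) (auto intro: smooth_gen.const)
next
  case (inner a)
  have "((\<lambda>z. z \<bullet> a) has_derivative (\<lambda>b. b \<bullet> a)) (at z)" for z
    by (auto intro!: derivative_eq_intros)
  then show ?case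
    by (intro exI[of _ "\<lambda>b z. b \<bullet> a"]) (auto intro: smooth_gen.const)
next
  case (add f g)
  then obtain f' g' where *: "\<And>z. (f has_derivative (\<lambda>b. f' b z)) (at z)" "\<And>b. smooth_gen (f' b)"
    "\<And>z. (g has_derivative (\<lambda>b. g' b z)) (at z)" "\<And>b. smooth_gen (g' b)" by blast
  show ?case
    by (intro exI[of _ "\<lambda>b z. f' b z + g' b z"]) (auto intro!: smooth_gen.add has_derivative_add *)
next
  case (mult f g)
  then obtain f' g' where *: "\<And>z. (f has_derivative (\<lambda>b. f' b z)) (at z)" "\<And>b. smooth_gen (f' b)"
    "\<And>z. (g has_derivative (\<lambda>b. g' b z)) (at z)" "\<And>b. smooth_gen (g' b)" by blast
  show ?case
    by (intro exI[of _ "\<lambda>b z. f z * g' b z + f' b z * g z"])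
      (auto intro!: smooth_gen.add smooth_gen.mult has_derivative_mult * mult.hyps)
next
  case (comp f g)
  then obtain g' where *: "\<And>z. (g has_derivative (\<lambda>b. g' b z)) (at z)" "\<And>b. smooth_gen (g' b)"
    by blast
  have "((\<lambda>z. f (g z)) has_derivative (\<lambda>b. g' b z * deriv f (g z))) (at z)" for z
    using *(1) has_derivative_compose[OF *(1), of f "\<lambda>h. h * deriv f (g z)"]
      smooth1_deriv(1)[OF comp.hyps(1)]
    by (auto simp: has_field_derivative_def mult_commute_abs)
  moreover have "smooth_gen (\<lambda>z. g' b z * deriv f (g z))" for b
    by (rule smooth_gen.mult[OF *(2) smooth_gen.comp[OF smooth1_deriv(2)[OF comp.hyps(1)] comp.hyps(2)]])
  ultimately show ?case by (intro exI[of _ "\<lambda>b z. g' b z * deriv f (g z)"]) auto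
qed

lemma smooth_gen_partial:
  assumes "smooth_gen f"
  shows "smooth_gen (partial_deriv b f)" and "f differentiable_on S"
proof -
  obtain f' where *: "\<And>z. (f has_derivative (\<lambda>b. f' b z)) (at z)" "\<And>b. smooth_gen (f' b)"
    using smooth_gen_deriv[OF assms] by blast
  have "partial_deriv b f = f' b"
    using has_derivative_imp_partial_deriv[OF *(1)] by auto
  with * show "smooth_gen (partial_deriv b f)" by simp
  show "f differentiable_on S"
    using *(1) differentiable_at_imp_differentiable_on differentiable_def by blast
qed

lemma smooth_gen_imp_smooth_fun:
  assumes "smooth_gen f"
  shows "smooth_fun f"
proof -
  have "smooth_gen (iterated_partial bs f)" for bs
    by (induction bs) (auto intro: assms smooth_gen_partial)
  then show ?thesis
    unfolding smooth_fun_def using smooth_gen_partial(2) by blast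
qed

lemma smooth_gen_sum:
  "finite A \<Longrightarrow> (\<And>i. i \<in> A \<Longrightarrow> smooth_gen (f i)) \<Longrightarrow> smooth_gen (\<lambda>z. \<Sum>i\<in>A. f i z)"
  by (induction A rule: finite_induct) (auto intro: smooth_gen.const smooth_gen.add)

text \<open>Radial profiles are functions of |x|^2 and not of |x|: the square is a polynomial in the
  coordinates, so nothing special happens at the origin.\<close>

lemma smooth_fun_radial:
  assumes "smooth1 \<eta>" "smooth1 \<Theta>"
  shows "smooth_fun (\<lambda>z :: real \<times> 'a::euclidean_space. \<eta> (fst z) * \<Theta> (snd z \<bullet> snd z))"
proof -
  have "smooth_gen (\<lambda>z :: real \<times> 'a. \<Sum>b\<in>Basis. (z \<bullet> (0, b)) * (z \<bullet> (0, b)))"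
    by (intro smooth_gen_sum smooth_gen.mult smooth_gen.inner) simp
  then have "smooth_gen (\<lambda>z :: real \<times> 'a. snd z \<bullet> snd z)"
    by (subst euclidean_inner) (simp add: inner_prod_def)
  moreover have "smooth_gen (\<lambda>z :: real \<times> 'a. fst z)"
    using smooth_gen.inner[of "(1, 0) :: real \<times> 'a"] by (simp add: inner_prod_def)
  ultimately show ?thesis
    by (intro smooth_gen_imp_smooth_fun smooth_gen.mult smooth_gen.comp[OF assms(1)]
        smooth_gen.comp[OF assms(2)])
qed

lemma has_derivative_radial:
  fixes z :: "real \<times> 'a::euclidean_space"
  assumes "smooth1 \<eta>" "smooth1 \<Theta>"
  shows "((\<lambda>z. \<eta> (fst z) * \<Theta> (snd z \<bullet> snd z)) has_derivative
    (\<lambda>h. \<eta> (fst z) * (2 * (snd z \<bullet> snd h) * deriv \<Theta> (snd z \<bullet> snd z))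
        + fst h * deriv \<eta> (fst z) * \<Theta> (snd z \<bullet> snd z))) (at z)"
proof -
  have "((\<lambda>z. \<eta> (fst z)) has_derivative (\<lambda>h. fst h * deriv \<eta> (fst z))) (at z)"
    using has_derivative_compose[OF has_derivative_fst[OF has_derivative_ident], of \<eta> "\<lambda>h. h * deriv \<eta> (fst z)" z]
      smooth1_deriv(1)[OF assms(1), of "fst z"]
    by (auto simp: has_field_derivative_def mult_commute_abs)
  moreover have "((\<lambda>z::real \<times> 'a. snd z \<bullet> snd z) has_derivative (\<lambda>h. 2 * (snd z \<bullet> snd h))) (at z)"
    by (auto intro!: derivative_eq_intros simp: inner_commute)
  from has_derivative_compose[OF this, of \<Theta> "\<lambda>h. h * deriv \<Theta> (snd z \<bullet> snd z)"]
  have "((\<lambda>z. \<Theta> (snd z \<bullet> snd z)) has_derivative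
      (\<lambda>h. 2 * (snd z \<bullet> snd h) * deriv \<Theta> (snd z \<bullet> snd z))) (at z)"
    using smooth1_deriv(1)[OF assms(2), of "snd z \<bullet> snd z"]
    by (auto simp: has_field_derivative_def mult_commute_abs)
  ultimately show ?thesis by (rule has_derivative_mult)
qed

lemma partial_deriv_time_radial:
  assumes "smooth1 \<eta>" "smooth1 \<Theta>"
  shows "partial_deriv (1, 0) (\<lambda>z :: real \<times> 'a::euclidean_space. \<eta> (fst z) * \<Theta> (snd z \<bullet> snd z))
       = (\<lambda>z. deriv \<eta> (fst z) * \<Theta> (snd z \<bullet> snd z))"
  by (rule ext, subst has_derivative_imp_partial_deriv[OF has_derivative_radial[OF assms]]) simp

lemma partial_deriv_space_radial:
  assumes "smooth1 \<eta>" "smooth1 \<Theta>"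
  shows "partial_deriv (0, b) (\<lambda>z :: real \<times> 'a::euclidean_space. \<eta> (fst z) * \<Theta> (snd z \<bullet> snd z))
       = (\<lambda>z. (\<eta> (fst z) * deriv \<Theta> (snd z \<bullet> snd z)) * (2 * (snd z \<bullet> b)))"
  by (rule ext, subst has_derivative_imp_partial_deriv[OF has_derivative_radial[OF assms]]) simp

text \<open>By the chain rule, the Laplacian of \<open>\<Theta> (x \<bullet> x)\<close> in dimension
  \<open>n\<close>, expressed at \<open>s = x \<bullet> x\<close>.\<close>

definition radial_laplacian :: "real \<Rightarrow> (real \<Rightarrow> real) \<Rightarrow> real \<Rightarrow> real" where
  "radial_laplacian n \<Theta> s = 4 * s * deriv (deriv \<Theta>) s + 2 * n * deriv \<Theta> s"

text \<open>The second derivative of \<Theta>(|x|^2) along a basis vector b is 4 (x . b)^2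
  \<Theta>'' + 2 \<Theta>'; summing over the basis turns the squares into |x|^2.\<close>

lemma wave_op_radial:
  fixes z :: "real \<times> 'a::euclidean_space"
  assumes "smooth1 \<eta>" "smooth1 \<Theta>"
  shows "wave_op (\<lambda>z. \<eta> (fst z) * \<Theta> (snd z \<bullet> snd z)) z
    = deriv (deriv \<eta>) (fst z) * \<Theta> (snd z \<bullet> snd z)
      - \<eta> (fst z) * radial_laplacian (DIM('a)) \<Theta> (snd z \<bullet> snd z)"
proof -
  have space: "partial_deriv (0, b) (\<lambda>z. (\<eta> (fst z) * deriv \<Theta> (snd z \<bullet> snd z)) * (2 * (snd z \<bullet> b))) z
     = \<eta> (fst z) * (4 * (snd z \<bullet> b)\<^sup>2 * deriv (deriv \<Theta>) (snd z \<bullet> snd z) + 2 * deriv \<Theta> (snd z \<bullet> snd z))"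
    if "b \<in> Basis" for b
  proof -
    have lin: "((\<lambda>z::real \<times> 'a. 2 * (snd z \<bullet> b)) has_derivative (\<lambda>h. 2 * (snd h \<bullet> b))) (at z)"
      by (auto intro!: derivative_eq_intros)
    show ?thesis
      by (subst has_derivative_imp_partial_deriv[OF has_derivative_mult[OF
            has_derivative_radial[OF assms(1) smooth1_deriv(2)[OF assms(2)]] lin]])
        (use that in \<open>simp add: inner_same_Basis power2_eq_square algebra_simps\<close>)
  qed
  have sq: "(\<Sum>b\<in>Basis. (snd z \<bullet> b)\<^sup>2) = snd z \<bullet> snd z"
    by (simp add: euclidean_inner[of "snd z" "snd z"] power2_eq_square)
  have "(\<Sum>b\<in>Basis. \<eta> (fst z) * (4 * (snd z \<bullet> b)\<^sup>2 * deriv (deriv \<Theta>) (snd z \<bullet> snd z)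
        + 2 * deriv \<Theta> (snd z \<bullet> snd z)))
      = \<eta> (fst z) * (4 * (\<Sum>b\<in>Basis. (snd z \<bullet> b)\<^sup>2) * deriv (deriv \<Theta>) (snd z \<bullet> snd z)
        + 2 * DIM('a) * deriv \<Theta> (snd z \<bullet> snd z))"
    by (simp add: sum.distrib sum_distrib_left sum_distrib_right algebra_simps)
  then have "(\<Sum>b\<in>Basis. partial_deriv (0, b) (partial_deriv (0, b)
        (\<lambda>z. \<eta> (fst z) * \<Theta> (snd z \<bullet> snd z))) z)
      = \<eta> (fst z) * radial_laplacian (DIM('a)) \<Theta> (snd z \<bullet> snd z)"
    by (simp add: partial_deriv_space_radial[OF assms] space sq radial_laplacian_def)
  then show ?thesis
    by (simp add: wave_op_def partial_deriv_time_radial assms smooth1_deriv(2))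
qed

section \<open>Differential inequalities in the sense of distributions\<close>

text \<open>The condition \<open>s \<le> t\<close> keeps the interval nonempty, so both end points
  belong to \<open>I\<close>; this later yields \<open>0 < t1\<close> and
  \<open>t2 < T\<close>.\<close>

definition test_on :: "real set \<Rightarrow> (real \<Rightarrow> real) \<Rightarrow> bool" where
  "test_on I \<eta> \<longleftrightarrow> smooth1 \<eta> \<and> (\<exists>s t. s \<le> t \<and> {s..t} \<subseteq> I \<and> (\<forall>x. x \<notin> {s..t} \<longrightarrow> \<eta> x = 0))"

lemma deriv_zero_outside:
  fixes \<eta> :: "real \<Rightarrow> real"
  assumes "\<And>x. x \<notin> {s..t} \<Longrightarrow> \<eta> x = 0" "x \<notin> {s..t}"
  shows "deriv \<eta> x = 0"
proof -
  have "eventually (\<lambda>y. y \<in> - {s..t}) (nhds x)"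
    using assms(2) by (intro eventually_nhds_in_open) auto
  then have "eventually (\<lambda>y. \<eta> y = 0) (nhds x)"
    by eventually_elim (use assms(1) in auto)
  from deriv_cong_ev[OF this refl] show ?thesis by simp
qed

lemma test_on_deriv:
  assumes "test_on I \<eta>"
  shows "test_on I (deriv \<eta>)"
  using assms deriv_zero_outside[of _ _ \<eta>] smooth1_deriv(2)[of \<eta>] unfolding test_on_def by metis

lemma test_on_mult:
  assumes "test_on I \<eta>" "smooth1 e"
  shows "test_on I (\<lambda>x. e x * \<eta> x)"
proof -
  have "smooth1 (\<lambda>x. e x * \<eta> x)"
    using assms by (intro smooth1_mult) (auto simp: test_on_def)
  moreover obtain s t where "s \<le> t" "{s..t} \<subseteq> I" "\<And>x. x \<notin> {s..t} \<Longrightarrow> \<eta> x = 0"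
    using assms by (auto simp: test_on_def)
  ultimately show ?thesis unfolding test_on_def by (metis mult_zero_right)
qed

lemma integrable_test_on:
  assumes "test_on I \<eta>" "continuous_on I X"
  shows "integrable lborel (\<lambda>x. \<eta> x * X x)"
proof -
  obtain s t where *: "{s..t} \<subseteq> I" "\<And>x. x \<notin> {s..t} \<Longrightarrow> \<eta> x = 0"
    using assms by (auto simp: test_on_def)
  have "continuous_on {s..t} (\<lambda>x. \<eta> x * X x)"
    using assms * by (intro continuous_intros smooth1_continuous continuous_on_subset[OF assms(2)])
      (auto simp: test_on_def)
  then have "integrable lborel (\<lambda>x. indicator {s..t} x *\<^sub>R (\<eta> x * X x))"
    by (intro borel_integrable_compact) auto
  moreover have "(\<lambda>x. indicator {s..t} x *\<^sub>R (\<eta> x * X x)) = (\<lambda>x. \<eta> x * X x)"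
  proof
    fix x show "indicator {s..t} x *\<^sub>R (\<eta> x * X x) = \<eta> x * X x"
      using *(2)[of x] by (cases "x \<in> {s..t}") auto
  qed
  ultimately show ?thesis by simp
qed

text \<open>The distributional inequality \<open>X' \<ge> Y\<close> on \<open>I\<close>.\<close>

definition weak_ge :: "real set \<Rightarrow> (real \<Rightarrow> real) \<Rightarrow> (real \<Rightarrow> real) \<Rightarrow> bool" where
  "weak_ge I X Y \<longleftrightarrow> continuous_on I X \<and> continuous_on I Y \<and>
    (\<forall>\<eta>. test_on I \<eta> \<and> (\<forall>x. 0 \<le> \<eta> x) \<longrightarrow>
      (\<integral>x. deriv \<eta> x * X x \<partial>lborel) \<le> - (\<integral>x. \<eta> x * Y x \<partial>lborel))"

lemma weak_geD:
  assumes "weak_ge I X Y" "test_on I \<eta>" "\<And>x. 0 \<le> \<eta> x"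
  shows "(\<integral>x. deriv \<eta> x * X x \<partial>lborel) \<le> - (\<integral>x. \<eta> x * Y x \<partial>lborel)"
  using assms unfolding weak_ge_def by blast

lemma weak_ge_subset:
  assumes "weak_ge I X Y" "J \<subseteq> I"
  shows "weak_ge J X Y"
proof -
  have "test_on J \<eta> \<Longrightarrow> test_on I \<eta>" for \<eta>
    using assms(2) unfolding test_on_def by blast
  then show ?thesis
    using assms unfolding weak_ge_def by (meson continuous_on_subset)
qed

lemma weak_ge_add:
  assumes "weak_ge I X Y" "weak_ge I X' Y'"
  shows "weak_ge I (\<lambda>x. X x + X' x) (\<lambda>x. Y x + Y' x)"
  unfolding weak_ge_def
proof (intro conjI allI impI)
  note c = assms[unfolded weak_ge_def]
  show "continuous_on I (\<lambda>x. X x + X' x)" "continuous_on I (\<lambda>x. Y x + Y' x)"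
    using c by (auto intro: continuous_intros)
  fix \<eta> assume \<eta>: "test_on I \<eta> \<and> (\<forall>x. 0 \<le> \<eta> x)"
  note i = integrable_test_on[of I \<eta>] integrable_test_on[of I "deriv \<eta>"]
  have *: "(\<integral>x. deriv \<eta> x * X x \<partial>lborel) \<le> - (\<integral>x. \<eta> x * Y x \<partial>lborel)"
    "(\<integral>x. deriv \<eta> x * X' x \<partial>lborel) \<le> - (\<integral>x. \<eta> x * Y' x \<partial>lborel)"
    using c \<eta> by auto
  show "(\<integral>x. deriv \<eta> x * (X x + X' x) \<partial>lborel) \<le> - (\<integral>x. \<eta> x * (Y x + Y' x) \<partial>lborel)"
    using add_mono[OF *] c \<eta> i test_on_deriv by (simp add: distrib_left)
qed

lemma weak_ge_mono:
  assumes "weak_ge I X Y" "continuous_on I Z" "\<And>x. x \<in> I \<Longrightarrow> Z x \<le> Y x"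
  shows "weak_ge I X Z"
  unfolding weak_ge_def
proof (intro conjI allI impI)
  note c = assms(1)[unfolded weak_ge_def]
  show "continuous_on I X" "continuous_on I Z" using c assms(2) by auto
  fix \<eta> assume \<eta>: "test_on I \<eta> \<and> (\<forall>x. 0 \<le> \<eta> x)"
  then obtain s t where st: "{s..t} \<subseteq> I" "\<And>x. x \<notin> {s..t} \<Longrightarrow> \<eta> x = 0"
    by (auto simp: test_on_def)
  have "(\<integral>x. \<eta> x * Z x \<partial>lborel) \<le> (\<integral>x. \<eta> x * Y x \<partial>lborel)"
  proof (intro integral_mono integrable_test_on)
    fix x show "\<eta> x * Z x \<le> \<eta> x * Y x"
      using \<eta> st(1) st(2)[of x] assms(3)[of x]
      by (cases "x \<in> {s..t}") (auto simp: subset_iff intro!: mult_left_mono)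
  qed (use \<eta> c assms(2) in auto)
  moreover have "(\<integral>x. deriv \<eta> x * X x \<partial>lborel) \<le> - (\<integral>x. \<eta> x * Y x \<partial>lborel)"
    using c \<eta> by auto
  ultimately show "(\<integral>x. deriv \<eta> x * X x \<partial>lborel) \<le> - (\<integral>x. \<eta> x * Z x \<partial>lborel)"
    by simp
qed

text \<open>The product rule, obtained by testing the given inequality with
  \<open>e * \<eta>\<close>, which is admissible because \<open>e\<close> is smooth and nonnegative.
  It provides integrating factors.\<close>

lemma weak_ge_mult:
  assumes "weak_ge I X Y" "smooth1 e" "\<And>x. 0 \<le> e x"
  shows "weak_ge I (\<lambda>x. e x * X x) (\<lambda>x. e x * Y x + deriv e x * X x)"
  unfolding weak_ge_def
proof (intro conjI allI impI)
  note c = assms(1)[unfolded weak_ge_def]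
  note se = smooth1_continuous[OF assms(2)] smooth1_continuous[OF smooth1_deriv(2)[OF assms(2)]]
  show c1: "continuous_on I (\<lambda>x. e x * X x)"
    and c2: "continuous_on I (\<lambda>x. e x * Y x + deriv e x * X x)"
    using c by (auto intro!: continuous_intros se)
  fix \<eta> assume \<eta>: "test_on I \<eta> \<and> (\<forall>x. 0 \<le> \<eta> x)"
  then have s\<eta>: "smooth1 \<eta>" by (simp add: test_on_def)
  have d: "deriv (\<lambda>x. e x * \<eta> x) x = deriv e x * \<eta> x + deriv \<eta> x * e x" for x
    by (intro DERIV_imp_deriv DERIV_mult smooth1_deriv s\<eta> assms)
  have 0: "(\<integral>x. deriv (\<lambda>x. e x * \<eta> x) x * X x \<partial>lborel) \<le> - (\<integral>x. e x * \<eta> x * Y x \<partial>lborel)"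
    using c \<eta> test_on_mult[of I \<eta> e] assms by auto
  have 1: "(\<integral>x. deriv (\<lambda>x. e x * \<eta> x) x * X x \<partial>lborel)
     = (\<integral>x. deriv \<eta> x * (e x * X x) + \<eta> x * (deriv e x * X x) \<partial>lborel)"
    unfolding d by (simp add: algebra_simps)
  have 2: "\<dots> = (\<integral>x. deriv \<eta> x * (e x * X x) \<partial>lborel) + (\<integral>x. \<eta> x * (deriv e x * X x) \<partial>lborel)"
    using \<eta> c by (intro Bochner_Integration.integral_add integrable_test_on test_on_deriv)
      (auto intro!: continuous_intros se)
  have 3: "(\<integral>x. \<eta> x * (e x * Y x + deriv e x * X x) \<partial>lborel)
     = (\<integral>x. e x * \<eta> x * Y x + \<eta> x * (deriv e x * X x) \<partial>lborel)"
    by (simp add: algebra_simps)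
  have 4: "\<dots> = (\<integral>x. e x * \<eta> x * Y x \<partial>lborel) + (\<integral>x. \<eta> x * (deriv e x * X x) \<partial>lborel)"
    using \<eta> c assms(2) by (intro Bochner_Integration.integral_add integrable_test_on[of I] test_on_mult)
      (auto intro!: continuous_intros se)
  show "(\<integral>x. deriv \<eta> x * (e x * X x) \<partial>lborel)
      \<le> - (\<integral>x. \<eta> x * (e x * Y x + deriv e x * X x) \<partial>lborel)"
    using 0 unfolding 1 2 3 4 by simp
qed

lemma weak_ge_classical:
  assumes "\<And>x. x \<in> I \<Longrightarrow> (X has_real_derivative Y x) (at x)" "continuous_on I Y"
  shows "weak_ge I X Y"
  unfolding weak_ge_def
proof (intro conjI allI impI)
  show c: "continuous_on I X"
    by (rule DERIV_continuous_on[OF has_field_derivative_at_within[OF assms(1)]])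
  show "continuous_on I Y" by fact
  fix \<eta> assume \<eta>: "test_on I \<eta> \<and> (\<forall>x. 0 \<le> \<eta> x)"
  then obtain s t where st: "s \<le> t" "{s..t} \<subseteq> I" "\<And>x. x \<notin> {s..t} \<Longrightarrow> \<eta> x = 0"
    by (auto simp: test_on_def)
  have s\<eta>: "smooth1 \<eta>" using \<eta> by (simp add: test_on_def)
  have co: "continuous_on S \<eta>" for S by (rule smooth1_continuous[OF s\<eta>])
  \<comment> \<open>\<open>test_on\<close> gives zeros only outside the closed interval; continuity
    adds the end points, where the boundary terms of the integration by parts arise.\<close>
  have "\<eta> s = 0"
    by (rule continuous_constant_on_closure[OF co, of "{..<s}"]) (auto intro: st(3))
  moreover have "\<eta> t = 0"
    by (rule continuous_constant_on_closure[OF co, of "{t<..}"]) (auto intro: st(3))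
  ultimately have ends: "\<eta> s = 0" "\<eta> t = 0" by auto
  define h where "h x = deriv \<eta> x * X x + \<eta> x * Y x" for x
  have "continuous_on {s..t} h"
    unfolding h_def using st(2) c assms(2)
    by (intro continuous_intros smooth1_continuous[OF s\<eta>]
        smooth1_continuous[OF smooth1_deriv(2)[OF s\<eta>]])
      (auto intro: continuous_on_subset)
  moreover have "((\<lambda>x. \<eta> x * X x) has_vector_derivative h x) (at x within {s..t})"
    if "s \<le> x" "x \<le> t" for x
  proof -
    have "((\<lambda>x. \<eta> x * X x) has_real_derivative h x) (at x)"
      unfolding h_def using DERIV_mult[OF smooth1_deriv(1)[OF s\<eta>] assms(1)] st(2) that
      by (auto simp: algebra_simps)
    then show ?thesis
      by (rule has_real_derivative_iff_has_vector_derivative[THEN iffD1, OF has_field_derivative_at_within])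
  qed
  ultimately have "(\<integral>x. indicator {s..t} x *\<^sub>R h x \<partial>lborel) = \<eta> t * X t - \<eta> s * X s"
    using st(1) by (intro integral_FTC_Icc)
  moreover have "(\<lambda>x. indicator {s..t} x *\<^sub>R h x) = (\<lambda>x. deriv \<eta> x * X x + \<eta> x * Y x)"
  proof
    fix x show "indicator {s..t} x *\<^sub>R h x = deriv \<eta> x * X x + \<eta> x * Y x"
      using st(3) deriv_zero_outside[of s t \<eta> x] by (cases "x \<in> {s..t}") (auto simp: h_def)
  qed
  ultimately have "(\<integral>x. deriv \<eta> x * X x + \<eta> x * Y x \<partial>lborel) = 0"
    using ends by simp
  then have "(\<integral>x. deriv \<eta> x * X x \<partial>lborel) + (\<integral>x. \<eta> x * Y x \<partial>lborel) = 0"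
    using \<eta> c assms(2) by (subst (asm) Bochner_Integration.integral_add)
      (auto intro!: integrable_test_on test_on_deriv)
  then show "(\<integral>x. deriv \<eta> x * X x \<partial>lborel) \<le> - (\<integral>x. \<eta> x * Y x \<partial>lborel)"
    by simp
qed

text \<open>If \<open>X s > X t\<close>, test with a plateau function rising just after \<open>s\<close> and falling just
  after \<open>t\<close>: its derivative weighs only values of \<open>X\<close> above the midpoint \<open>\<mu>\<close> positively and
  only values below \<open>\<mu>\<close> negatively.\<close>

lemma weak_ge_0_mono:
  assumes "weak_ge I X (\<lambda>x. 0)" "open I" "{s..t} \<subseteq> I" "s \<le> t"
  shows "X s \<le> X t"
proof (rule ccontr)
  assume "\<not> X s \<le> X t"
  then have less: "X t < X s" by simp
  with assms(4) have st: "s < t" by (cases "s = t") auto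
  define \<mu> where "\<mu> = (X s + X t) / 2"
  define \<delta> where "\<delta> = (X s - X t) / 4"
  have \<delta>: "\<delta> > 0" using less by (simp add: \<delta>_def)
  have mem: "s \<in> I" "t \<in> I" using assms(3) st by auto
  have co: "continuous_on I X" using assms(1) by (simp add: weak_ge_def)
  then have ct: "isCont X s" "isCont X t"
    using mem assms(2) continuous_on_eq_continuous_at by blast+
  have nb: "\<exists>d>0. \<forall>x. \<bar>x - y\<bar> < d \<longrightarrow> \<bar>X x - X y\<bar> < \<delta>" if "isCont X y" for y
    using that \<delta> unfolding continuous_at_eps_delta dist_real_def by blast
  obtain d1 where d1: "d1 > 0" "\<And>x. \<bar>x - s\<bar> < d1 \<Longrightarrow> \<bar>X x - X s\<bar> < \<delta>"
    using nb[OF ct(1)] by blast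
  obtain d2 where d2: "d2 > 0" "\<And>x. \<bar>x - t\<bar> < d2 \<Longrightarrow> \<bar>X x - X t\<bar> < \<delta>"
    using nb[OF ct(2)] by blast
  obtain d3 where d3: "d3 > 0" "\<And>x. \<bar>x - t\<bar> < d3 \<Longrightarrow> x \<in> I"
    using mem(2) assms(2) unfolding open_dist dist_real_def by blast
  \<comment> \<open>Below \<open>t - s\<close>, so that the ramps on [s, s+h] and [t, t+h] are
    disjoint; below \<open>d3\<close>, so that the falling ramp stays in \<open>I\<close>; below
    \<open>d1\<close> and \<open>d2\<close>, so that \<open>X\<close> varies by less than \<delta>
    on each ramp.\<close>
  define h where "h = Min {d1, d2, d3, t - s} / 2"
  have h: "h > 0" "h < d1" "h < d2" "h < d3" "h < t - s"
    using d1(1) d2(1) d3(1) st by (auto simp: h_def)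
  define \<eta> where "\<eta> x = smooth_step ((x - s) / h) - smooth_step ((x - t) / h)" for x
  have sm: "smooth1 (\<lambda>x. smooth_step ((x - y) / h))" for y
  proof -
    have "smooth1 (\<lambda>x. (x - y) * (1 / h))"
      by (intro smooth1_mult smooth1_diff smooth1_const smooth1_id)
    from smooth1_comp[OF smooth1_smooth_step this] show ?thesis by simp
  qed
  have s\<eta>: "smooth1 \<eta>"
    unfolding \<eta>_def[abs_def] by (intro smooth1_diff sm)
  have z: "\<eta> x = 0" if "x \<notin> {s..t+h}" for x
  proof (cases "x < s")
    case True
    then show ?thesis using h st by (auto simp: \<eta>_def smooth_step_0 field_simps)
  next
    case False
    with that have "x > t + h" by auto
    then have "(x - s) / h \<ge> 1" "(x - t) / h \<ge> 1"
      using h st by (auto simp: field_simps)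
    then show ?thesis by (simp add: \<eta>_def smooth_step_1)
  qed
  have sub: "{s..t+h} \<subseteq> I"
  proof
    fix x assume "x \<in> {s..t+h}"
    then show "x \<in> I" using assms(3) d3(2)[of x] h by (cases "x \<le> t") auto
  qed
  have test: "test_on I \<eta>"
    unfolding test_on_def using s\<eta> z sub st h(1) by (intro conjI exI[of _ s] exI[of _ "t + h"]) auto
  have pos: "0 \<le> \<eta> x" for x
    using st h(1) by (auto simp: \<eta>_def intro!: smooth_step_mono divide_right_mono)
  have D: "deriv \<eta> x = deriv (\<lambda>x. smooth_step ((x - s) / h)) x - deriv (\<lambda>x. smooth_step ((x - t) / h)) x" for x
    unfolding \<eta>_def[abs_def] by (intro DERIV_imp_deriv DERIV_diff smooth1_deriv sm)
  have Dpos: "0 \<le> deriv (\<lambda>x. smooth_step ((x - y) / h)) x" for x y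
  proof (rule mono_on_imp_deriv_nonneg[OF _ smooth1_deriv(1)[OF sm], of UNIV])
    show "mono_on UNIV (\<lambda>x. smooth_step ((x - y) / h))"
      using h(1) by (auto intro!: mono_onI smooth_step_mono divide_right_mono)
  qed simp
  have Dz: "deriv (\<lambda>x. smooth_step ((x - y) / h)) x = 0" if "x \<notin> {y..y+h}" for x y
  proof -
    have "\<exists>c. eventually (\<lambda>x. smooth_step ((x - y) / h) = c) (nhds x)"
    proof (cases "x < y")
      case True
      then have "eventually (\<lambda>x. x \<in> {..<y}) (nhds x)" by (intro eventually_nhds_in_open) auto
      then have "eventually (\<lambda>x. smooth_step ((x - y) / h) = 0) (nhds x)"
        by eventually_elim (use h in \<open>auto intro!: smooth_step_0 simp: field_simps\<close>)
      then show ?thesis by blast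
    next
      case False
      with that have "x > y + h" by auto
      then have "eventually (\<lambda>x. x \<in> {y+h<..}) (nhds x)" by (intro eventually_nhds_in_open) auto
      then have "eventually (\<lambda>x. smooth_step ((x - y) / h) = 1) (nhds x)"
        by eventually_elim (use h in \<open>auto intro!: smooth_step_1 simp: field_simps\<close>)
      then show ?thesis by blast
    qed
    then obtain c where "eventually (\<lambda>x. smooth_step ((x - y) / h) = c) (nhds x)" by blast
    from deriv_cong_ev[OF this refl] show ?thesis by simp
  qed
  \<comment> \<open>Integrated, the left side is \<delta> times the total rise 1, while the right
    side is the integral of \<eta>' X because \<eta>' has mean zero. The weak inequality makes the
    latter at most 0.\<close>
  have low: "\<delta> * (indicator {s..s+h} x *\<^sub>R deriv \<eta> x) \<le> deriv \<eta> x * X x + deriv \<eta> x * (- \<mu>)" for x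
  proof -
    consider "x \<in> {s..s+h}" | "x \<in> {t..t+h}" | "x \<notin> {s..s+h}" "x \<notin> {t..t+h}" by blast
    then show ?thesis
    proof cases
      case 1
      then have nt: "x \<notin> {t..t+h}" and "\<bar>X x - X s\<bar> < \<delta>" using h d1(2)[of x] by auto
      then have "X s - X x < \<delta>" by linarith
      then have "\<delta> \<le> X x - \<mu>" by (simp add: \<mu>_def \<delta>_def field_simps)
      moreover have "0 \<le> deriv \<eta> x" using Dpos Dz[OF nt] by (simp add: D)
      ultimately have "deriv \<eta> x * \<delta> \<le> deriv \<eta> x * (X x - \<mu>)" by (rule mult_left_mono)
      with 1 show ?thesis by (simp add: algebra_simps)
    next
      case 2
      then have nt: "x \<notin> {s..s+h}" and "\<bar>X x - X t\<bar> < \<delta>" using h d2(2)[of x] by auto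
      then have "X x - X t < \<delta>" by linarith
      then have "X x - \<mu> \<le> 0" using \<delta> by (simp add: \<mu>_def \<delta>_def field_simps)
      moreover have "deriv \<eta> x \<le> 0" using Dpos Dz[OF nt] by (simp add: D)
      ultimately have "0 \<le> deriv \<eta> x * (X x - \<mu>)" by (rule mult_nonpos_nonpos[rotated])
      with nt show ?thesis by (simp add: algebra_simps)
    next
      case 3
      then show ?thesis using Dz by (simp add: D)
    qed
  qed
  have cd: "continuous_on S (deriv \<eta>)" for S
    by (rule smooth1_continuous[OF smooth1_deriv(2)[OF s\<eta>]])
  have vd: "(\<eta> has_vector_derivative deriv \<eta> x) (at x within S)" for x S
    by (rule has_real_derivative_iff_has_vector_derivative[THEN iffD1,
          OF has_field_derivative_at_within[OF smooth1_deriv(1)[OF s\<eta>]]])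
  have "\<eta> s = 0" "\<eta> (s + h) = 1"
    using h st by (auto simp: \<eta>_def smooth_step_0 smooth_step_1 field_simps)
  then have one: "(\<integral>x. indicator {s..s+h} x *\<^sub>R deriv \<eta> x \<partial>lborel) = 1"
    using integral_FTC_Icc[of s "s + h" \<eta> "deriv \<eta>"] vd cd h(1) by simp
  \<comment> \<open>A constant and its negative both have weak derivative >= 0; the two inequalities
    together say that the integral of \<eta>' vanishes.\<close>
  have "weak_ge I (\<lambda>x. c) (\<lambda>x. 0)" for c
    by (intro weak_ge_classical) auto
  from weak_geD[OF this test pos, of \<mu>] weak_geD[OF this test pos, of "- \<mu>"]
  have zero: "(\<integral>x. deriv \<eta> x * - \<mu> \<partial>lborel) = 0" by simp
  have "\<delta> * (\<integral>x. indicator {s..s+h} x *\<^sub>R deriv \<eta> x \<partial>lborel)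
      \<le> (\<integral>x. deriv \<eta> x * X x + deriv \<eta> x * (- \<mu>) \<partial>lborel)"
    unfolding integral_mult_right_zero[symmetric]
    using test co
    by (intro integral_mono low Bochner_Integration.integrable_add integrable_test_on[of I] test_on_deriv
        integrable_mult_right borel_integrable_compact cd) auto
  also have "\<dots> = (\<integral>x. deriv \<eta> x * X x \<partial>lborel) + (\<integral>x. deriv \<eta> x * (- \<mu>) \<partial>lborel)"
    using test co by (intro Bochner_Integration.integral_add integrable_test_on[of I] test_on_deriv) auto
  also have "\<dots> \<le> 0"
    unfolding zero using weak_geD[OF assms(1) test pos] by simp
  finally show False using one \<delta> by simp
qed

text \<open>Test functions stay away from the end points, and the initial data sit at the end point
  0. Comparing both ends with the midpoint and passing to one-sided limits closes the gap.\<close>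

lemma weak_ge_Icc:
  assumes "s \<le> t" "continuous_on {s..t} X" "weak_ge {s<..<t} X (\<lambda>x. 0)"
  shows "X s \<le> X t"
proof (cases "s = t")
  case False
  with assms(1) have st: "s < t" by simp
  have mono: "X a \<le> X b" if "s < a" "a \<le> b" "b < t" for a b
    using that by (intro weak_ge_0_mono[OF assms(3)]) auto
  define c where "c = (s + t) / 2"
  have c: "s < c" "c < t" using st by (auto simp: c_def)
  have "(X \<longlongrightarrow> X s) (at_right s)" "(X \<longlongrightarrow> X t) (at_left t)"
    using assms(2) st continuous_on_Icc_at_rightD continuous_on_Icc_at_leftD by blast+
  moreover have "eventually (\<lambda>x. X x \<le> X c) (at_right s)"
    using eventually_at_right_real[OF c(1)] by eventually_elim (use mono c in auto)
  moreover have "eventually (\<lambda>x. X c \<le> X x) (at_left t)"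
    using eventually_at_left_real[OF c(2)] by eventually_elim (use mono c in auto)
  ultimately have "X s \<le> X c \<and> X c \<le> X t"
    using tendsto_upperbound[of X "X s" "at_right s" "X c"] tendsto_lowerbound[of X "X t" "at_left t" "X c"]
    by (simp add: trivial_limit_at_left_real trivial_limit_at_right_real)
  then show ?thesis by simp
qed simp

text \<open>The difference \<open>X - Z\<close> has weak derivative at least \<open>Y - Z'\<close>,
  hence at least 0. All explicit lower bounds come from here by choosing \<open>Z\<close>.\<close>

lemma weak_ge_compare:
  assumes "s \<le> t" "continuous_on {s..t} X" "weak_ge {s<..<t} X Y"
    and "continuous_on {s..t} Z" "\<And>x. x \<in> {s<..<t} \<Longrightarrow> (Z has_real_derivative Z' x) (at x)"
    and "continuous_on {s<..<t} Z'" "\<And>x. x \<in> {s<..<t} \<Longrightarrow> Z' x \<le> Y x"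
  shows "X s - Z s \<le> X t - Z t"
proof -
  have "weak_ge {s<..<t} (\<lambda>x. - Z x) (\<lambda>x. - Z' x)"
    using assms by (intro weak_ge_classical) (auto intro!: derivative_intros continuous_intros)
  from weak_ge_add[OF assms(3) this]
  have "weak_ge {s<..<t} (\<lambda>x. X x + - Z x) (\<lambda>x. 0)"
    by (rule weak_ge_mono) (use assms(7) in auto)
  then have "X s + - Z s \<le> X t + - Z t"
    by (rule weak_ge_Icc[OF assms(1), rotated]) (auto intro!: continuous_intros assms)
  then show ?thesis by simp
qed

section \<open>Blow-up for the ordinary differential inequality\<close>

text \<open>\<open>U\<close> doubles on each of a sequence of intervals of geometrically decreasing length, hence
  would be unbounded on a compact interval.\<close>

lemma doubling_blow_up:
  fixes U :: "real \<Rightarrow> real"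
  assumes q: "1 < q" and b: "0 < b" and M: "0 < M" "M \<le> U \<tau>" and \<tau>: "0 < \<tau>"
    and mono: "\<And>s t. \<tau> \<le> s \<Longrightarrow> s \<le> t \<Longrightarrow> t \<le> 2 * \<tau> \<Longrightarrow> U s \<le> U t"
    and conv: "\<And>s t m. \<tau> \<le> s \<Longrightarrow> s < t \<Longrightarrow> t \<le> 2 * \<tau> \<Longrightarrow> 0 \<le> m \<Longrightarrow>
       (\<And>x. x \<in> {s<..<t} \<Longrightarrow> m \<le> b * \<bar>U x\<bar> powr q) \<Longrightarrow> U s + m * (t - s)\<^sup>2 / 2 \<le> U t"
    and large: "2 \<le> b * M powr (q - 1) * \<tau>\<^sup>2 * (1 - 2 powr (- (q - 1) / 2))\<^sup>2"
  shows False
proof -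
  \<comment> \<open>A gain of 2^k M at the rate b (2^k M)^q needs a time whose square is 2^(1 -
    k(q-1)) / (b M^(q-1)). The lengths therefore form a geometric sequence with ratio \<rho>,
    starting at \<open>\<delta>\<close>.\<close>
  define \<rho> where "\<rho> = 2 powr (- (q - 1) / 2 :: real)"
  have "\<rho> < 2 powr 0" unfolding \<rho>_def using q by (intro powr_less_mono) auto
  then have \<rho>: "0 < \<rho>" "\<rho> < 1" by (auto simp: \<rho>_def)
  define D where "D = b * M powr (q - 1)"
  have D: "D > 0" using b M by (simp add: D_def)
  define \<delta> where "\<delta> = sqrt (2 / D)"
  have \<delta>: "\<delta> > 0" "\<delta>\<^sup>2 = 2 / D" using D by (auto simp: \<delta>_def)
  \<comment> \<open>The assumption \<open>large\<close> says that the total length \<delta>/(1 -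
    \<rho>) of all doubling intervals is at most \<tau>.\<close>
  have "\<delta>\<^sup>2 \<le> (\<tau> * (1 - \<rho>))\<^sup>2"
    using large D unfolding \<delta>(2) D_def[symmetric] \<rho>_def[symmetric]
    by (simp add: pos_divide_le_eq power_mult_distrib mult_ac)
  then have \<delta>\<tau>: "\<delta> \<le> \<tau> * (1 - \<rho>)"
    using \<tau> \<rho> by (intro power2_le_imp_le[of \<delta>]) auto
  define t where "t k = \<tau> + \<delta> * (\<Sum>j<k. \<rho> ^ j)" for k :: nat
  have t2: "t k \<le> 2 * \<tau>" for k
  proof -
    have "(\<Sum>j<k. \<rho> ^ j) = (1 - \<rho> ^ k) / (1 - \<rho>)"
      using \<rho> by (simp add: sum_gp_strict)
    also have "\<dots> \<le> 1 / (1 - \<rho>)"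
      using \<rho> by (intro divide_right_mono) auto
    finally have "\<delta> * (\<Sum>j<k. \<rho> ^ j) \<le> \<delta> * (1 / (1 - \<rho>))"
      using \<delta> by (intro mult_left_mono) auto
    also have "\<dots> \<le> \<tau>" using \<delta>\<tau> \<rho> by (simp add: field_simps)
    finally show ?thesis by (simp add: t_def)
  qed
  have t1: "\<tau> \<le> t k" for k
    using \<delta> \<rho> by (auto simp: t_def intro!: mult_nonneg_nonneg sum_nonneg)
  have ts: "t (Suc k) - t k = \<delta> * \<rho> ^ k" for k
    by (simp add: t_def algebra_simps)
  have grow: "2 ^ k * M \<le> U (t k)" for k
  proof (induction k)
    case 0
    then show ?case using M by (simp add: t_def)
  next
    case (Suc k)
    have "0 < \<delta> * \<rho> ^ k" using \<delta> \<rho> by simp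
    then have st: "t k < t (Suc k)" using ts[of k] by simp
    define m where "m = b * (2 ^ k * M) powr q"
    have "U (t k) + m * (t (Suc k) - t k)\<^sup>2 / 2 \<le> U (t (Suc k))"
    proof (rule conv[OF t1 st t2])
      show "0 \<le> m" using b by (simp add: m_def)
      fix x assume x: "x \<in> {t k<..<t (Suc k)}"
      have "2 ^ k * M \<le> U x"
        using Suc.IH mono[OF t1, of k x] x t2[of "Suc k"] by auto
      then have "(2 ^ k * M) powr q \<le> \<bar>U x\<bar> powr q"
        using M q by (intro powr_mono2) auto
      then show "m \<le> b * \<bar>U x\<bar> powr q" using b by (simp add: m_def)
    qed
    moreover have "m * (t (Suc k) - t k)\<^sup>2 / 2 = 2 ^ k * M"
    proof -
      have "(\<rho> ^ k)\<^sup>2 = \<rho> powr real (k * 2)"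
        using powr_realpow[OF \<rho>(1), of "k * 2"] by (simp add: power_mult)
      also have "\<dots> = 2 powr (real k * (1 - q))"
        unfolding \<rho>_def powr_powr by (rule arg_cong[where f = "\<lambda>z. 2 powr z"]) (simp add: field_simps)
      finally have 1: "(\<rho> ^ k)\<^sup>2 = 2 powr (real k * (1 - q))" .
      have "(2 ^ k * M) powr q = (2 ^ k) powr q * M powr q"
        using M by (simp add: powr_mult)
      also have "(2 ^ k) powr q = 2 powr (real k * q)"
        by (simp add: powr_powr flip: powr_realpow)
      also have "M powr q = M powr (q - 1) * M"
        using M by (simp add: powr_diff)
      finally have 2: "(2 ^ k * M) powr q = 2 powr (real k * q) * (M powr (q - 1) * M)" .
      have "2 powr (real k * q) * 2 powr (real k * (1 - q)) = (2::real) powr (real k)"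
        by (simp add: algebra_simps flip: powr_add)
      then have 3: "2 powr (real k * q) * 2 powr (real k * (1 - q)) = (2::real) ^ k"
        by (simp add: powr_realpow)
      have "(2 ^ k * M) powr q * (\<rho> ^ k)\<^sup>2
          = (2 powr (real k * q) * 2 powr (real k * (1 - q))) * (M powr (q - 1) * M)"
        unfolding 1 2 by (simp only: mult_ac)
      then have 4: "(2 ^ k * M) powr q * (\<rho> ^ k)\<^sup>2 = 2 ^ k * M powr (q - 1) * M"
        unfolding 3 by (simp only: mult_ac)
      have "m * (t (Suc k) - t k)\<^sup>2 / 2 = b * \<delta>\<^sup>2 * ((2 ^ k * M) powr q * (\<rho> ^ k)\<^sup>2) / 2"
        unfolding m_def ts power_mult_distrib by (simp only: mult_ac)
      also have "\<dots> = b * \<delta>\<^sup>2 * (2 ^ k * M powr (q - 1) * M) / 2"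
        unfolding 4 ..
      also have "\<dots> = 2 ^ k * M"
        unfolding \<delta>(2) using b M by (simp add: D_def)
      finally show ?thesis .
    qed
    ultimately show ?case using Suc.IH by simp
  qed
  obtain k where "U (2 * \<tau>) / M < 2 ^ k"
    using real_arch_pow[of 2] by auto
  then have "U (2 * \<tau>) < 2 ^ k * M" using M by (simp add: field_simps)
  also have "\<dots> \<le> U (t k)" by (rule grow)
  also have "\<dots> \<le> U (2 * \<tau>)" by (rule mono[OF t1 t2]) simp
  finally show False by simp
qed

text \<open>Two comparisons replace a Taylor expansion: \<open>V\<close> with the line of slope
  \<open>m\<close> through 0 at \<open>s\<close>, and then \<open>U\<close> with the parabola that
  this line integrates to.\<close>

lemma weak_ge_convex:
  assumes "s < t" "continuous_on {s..t} U" "continuous_on {s..t} V"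
    and "weak_ge {s<..<t} U V" "weak_ge {s<..<t} V Y"
    and "\<And>x. x \<in> {s<..<t} \<Longrightarrow> m \<le> Y x" "0 \<le> V s"
  shows "U s + m * (t - s)\<^sup>2 / 2 \<le> U t"
proof -
  have V: "m * (x - s) \<le> V x" if "x \<in> {s<..<t}" for x
  proof -
    have "V s - m * s \<le> V x - m * x"
    proof (rule weak_ge_compare[of s x V Y "\<lambda>x. m * x" "\<lambda>_. m"])
      show "weak_ge {s<..<x} V Y" using that by (intro weak_ge_subset[OF assms(5)]) auto
      show "continuous_on {s..x} V" using that by (intro continuous_on_subset[OF assms(3)]) auto
    qed (use that assms(6) in \<open>auto intro!: continuous_intros derivative_eq_intros\<close>)
    with assms(7) show ?thesis by (simp add: algebra_simps)
  qed
  have "U s - m * (s - s)\<^sup>2 / 2 \<le> U t - m * (t - s)\<^sup>2 / 2"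
    by (rule weak_ge_compare[of s t U V "\<lambda>x. m * (x - s)\<^sup>2 / 2" "\<lambda>x. m * (x - s)"])
      (use assms V in \<open>auto intro!: continuous_intros derivative_eq_intros\<close>)
  then show ?thesis by simp
qed

text \<open>One constant for both signs of the exponent; in the application the exponent m(1 - p/2)
  is negative when p > 2.\<close>

lemma powr_comparable:
  fixes x y a :: real
  assumes "0 < x" "x / 2 \<le> y" "y \<le> 2 * x"
  shows "2 powr (- \<bar>a\<bar>) * x powr a \<le> y powr a"
proof (cases "a \<ge> 0")
  case True
  have "2 powr (- \<bar>a\<bar>) * x powr a = (x / 2) powr a"
    using True assms(1) powr_divide[of x 2 a] by (simp add: powr_minus field_simps)
  also have "\<dots> \<le> y powr a" using assms True by (intro powr_mono2) auto
  finally show ?thesis .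
next
  case False
  then have "2 powr (- \<bar>a\<bar>) * x powr a = (2 * x) powr a"
    using assms(1) powr_mult[of 2 x a] by simp
  also have "\<dots> \<le> y powr a" using assms False by (intro powr_mono2') auto
  finally show ?thesis .
qed

text \<open>Here \<delta> stands for eps^p. The first lower bound makes \<open>U \<tau>\<close> at
  least of order \<delta> \<tau>^(\<alpha>+2), and \<open>doubling_blow_up\<close> takes over on
  [\<tau>, 2\<tau>]. For \<tau> = K \<delta>^(-(q-1)/\<beta>) the powers of \<delta> cancel in its
  largeness condition, which then only asks for a large \<open>K\<close>.\<close>

lemma differential_inequality_lifespan:
  fixes A1 B \<alpha> \<nu> q :: real
  assumes A1: "0 < A1" and B: "0 < B" and q: "1 < q" and \<nu>: "0 \<le> \<nu>"
    and \<beta>: "0 < (\<alpha> + 2) * (q - 1) - \<nu> + 2"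
  shows "\<exists>A>0. \<forall>\<delta> T U V. 0 < \<delta> \<and> \<delta> \<le> 1 \<and>
      continuous_on (time_interval T) U \<and> continuous_on (time_interval T) V \<and> 0 \<le> U 0 \<and> 0 \<le> V 0 \<and>
      weak_ge {t. 0 < t \<and> ereal t < T} U V \<and>
      weak_ge {t. 0 < t \<and> ereal t < T} V (\<lambda>t. A1 * \<delta> * (1 + t) powr \<alpha>) \<and>
      weak_ge {t. 0 < t \<and> ereal t < T} V (\<lambda>t. B * (1 + t) powr (- \<nu>) * \<bar>U t\<bar> powr q)
      \<longrightarrow> T \<le> ereal (A * \<delta> powr (- ((q - 1) / ((\<alpha> + 2) * (q - 1) - \<nu> + 2))))"
proof -
  define \<beta> where "\<beta> = (\<alpha> + 2) * (q - 1) - \<nu> + 2"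
  have \<beta>0: "\<beta> > 0" using \<beta> by (simp add: \<beta>_def)
  define \<rho> where "\<rho> = 2 powr (- (q - 1) / 2 :: real)"
  have "\<rho> < 2 powr 0" unfolding \<rho>_def using q by (intro powr_less_mono) auto
  then have \<rho>: "0 < \<rho>" "\<rho> < 1" by (auto simp: \<rho>_def)
  \<comment> \<open>The 8 comes from (\<tau>/2)^2 / 2, the gain over [\<tau>/2, \<tau>]; the power
    of 2 is the loss in \<open>powr_comparable\<close>.\<close>
  define c1 where "c1 = A1 * 2 powr (- \<bar>\<alpha>\<bar>) / 8"
  have c1: "c1 > 0" using A1 by (simp add: c1_def)
  \<comment> \<open>The 3 comes from 1 + t <= 3 \<tau> for t in [\<tau>, 2\<tau>] and \<tau> >= 1;
    the power of \<open>c1\<close> is its contribution to \<open>M powr (q - 1)\<close>.\<close>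
  define c2 where "c2 = B * 3 powr (- \<nu>) * c1 powr (q - 1)"
  have c2: "c2 > 0" using B c1 by (simp add: c2_def)
  define K0 where "K0 = 2 / (c2 * (1 - \<rho>)\<^sup>2)"
  have K0: "K0 > 0" using c2 \<rho> by (simp add: K0_def)
  \<comment> \<open>\<open>K powr \<beta> \<ge> K0\<close> will be the largeness condition of the
    doubling argument; \<open>K \<ge> 1\<close> together with \<delta> <= 1 ensures \<tau> >=
    1.\<close>
  define K where "K = max 1 (K0 powr (1 / \<beta>))"
  have K1: "K \<ge> 1" by (simp add: K_def)
  have "K0 = (K0 powr (1 / \<beta>)) powr \<beta>" using \<beta>0 K0 by (simp add: powr_powr)
  also have "\<dots> \<le> K powr \<beta>" using \<beta>0 by (intro powr_mono2) (auto simp: K_def)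
  finally have K2: "K0 \<le> K powr \<beta>" .
  define I :: "ereal \<Rightarrow> real set" where "I T = {t. 0 < t \<and> ereal t < T}" for T
  have "T \<le> ereal (2 * K * \<delta> powr (- ((q - 1) / \<beta>)))"
    if \<delta>: "0 < \<delta>" "\<delta> \<le> 1"
      and cU: "continuous_on (time_interval T) U" and cV: "continuous_on (time_interval T) V"
      and U0: "0 \<le> U 0" and V0: "0 \<le> V 0"
      and UV: "weak_ge (I T) U V" and V1: "weak_ge (I T) V (\<lambda>t. A1 * \<delta> * (1 + t) powr \<alpha>)"
      and V2: "weak_ge (I T) V (\<lambda>t. B * (1 + t) powr (- \<nu>) * \<bar>U t\<bar> powr q)"
    for \<delta> T U V
  proof (rule ccontr)
    \<comment> \<open>Half of the claimed bound: if the bound fails, the whole interval [0, 2\<tau>]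
      lies inside the time of existence.\<close>
    define \<tau> where "\<tau> = K * \<delta> powr (- ((q - 1) / \<beta>))"
    assume "\<not> ?thesis"
    then have T: "ereal (2 * \<tau>) < T" by (simp add: \<tau>_def mult.assoc)
    have "\<delta> powr 0 \<le> \<delta> powr (- ((q - 1) / \<beta>))"
      using \<delta> q \<beta>0 by (intro powr_mono') auto
    then have "1 * 1 \<le> \<tau>"
      unfolding \<tau>_def using K1 \<delta> by (intro mult_mono) auto
    then have \<tau>: "1 \<le> \<tau>" by simp
    have sub: "{s..t} \<subseteq> time_interval T" "{s<..<t} \<subseteq> I T" if "0 \<le> s" "t \<le> 2 * \<tau>" for s t
    proof -
      have "ereal x < T" if "x \<le> t" for x
      proof -
        have "ereal x \<le> ereal (2 * \<tau>)" using that \<open>t \<le> 2 * \<tau>\<close> by simp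
        then show ?thesis using T by (rule le_less_trans)
      qed
      with that show "{s..t} \<subseteq> time_interval T" "{s<..<t} \<subseteq> I T"
        by (auto simp: time_interval_def I_def)
    qed
    note subs = continuous_on_subset[OF cU sub(1)] continuous_on_subset[OF cV sub(1)]
      weak_ge_subset[OF UV sub(2)] weak_ge_subset[OF _ sub(2)]
    have Vpos: "0 \<le> V t" if "0 \<le> t" "t \<le> 2 * \<tau>" for t
    proof -
      have "V 0 - 0 \<le> V t - 0"
        by (rule weak_ge_compare[OF _ subs(2) subs(4)[OF V1], where Z = "\<lambda>_. 0" and Z' = "\<lambda>_. 0"])
          (use that A1 \<delta> in auto)
      with V0 show ?thesis by simp
    qed
    have Umono: "U s \<le> U t" if "0 \<le> s" "s \<le> t" "t \<le> 2 * \<tau>" for s t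
    proof -
      have "U s - 0 \<le> U t - 0"
        by (rule weak_ge_compare[OF _ subs(1) subs(3), where Z = "\<lambda>_. 0" and Z' = "\<lambda>_. 0"])
          (use that Vpos in auto)
      then show ?thesis by simp
    qed
    have conv: "U s + m * (t - s)\<^sup>2 / 2 \<le> U t"
      if "0 \<le> s" "s < t" "t \<le> 2 * \<tau>" "weak_ge (I T) V Y" "\<And>x. x \<in> {s<..<t} \<Longrightarrow> m \<le> Y x" for s t m Y
      by (rule weak_ge_convex[OF _ subs(1) subs(2) subs(3) subs(4)[OF that(4)]])
        (use that Vpos in auto)
    define M where "M = c1 * \<delta> * \<tau> powr (\<alpha> + 2)"
    have M: "M > 0" using c1 \<delta> \<tau> by (simp add: M_def)
    \<comment> \<open>Only the second half of [0, \<tau>] is used, because there 1 + x lies between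
      \<tau>/2 and 2\<tau>.\<close>
    have "U (\<tau> / 2) + A1 * \<delta> * (2 powr (- \<bar>\<alpha>\<bar>) * \<tau> powr \<alpha>) * (\<tau> - \<tau> / 2)\<^sup>2 / 2 \<le> U \<tau>"
    proof (rule conv[OF _ _ _ V1])
      fix x assume x: "x \<in> {\<tau> / 2<..<\<tau>}"
      have "2 powr (- \<bar>\<alpha>\<bar>) * \<tau> powr \<alpha> \<le> (1 + x) powr \<alpha>"
        using x \<tau> by (intro powr_comparable) auto
      then show "A1 * \<delta> * (2 powr (- \<bar>\<alpha>\<bar>) * \<tau> powr \<alpha>) \<le> A1 * \<delta> * (1 + x) powr \<alpha>"
        using A1 \<delta> by (intro mult_left_mono) auto
    qed (use \<tau> in auto)
    moreover have "0 \<le> U (\<tau> / 2)"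
      using Umono[of 0 "\<tau> / 2"] U0 \<tau> by auto
    moreover have "A1 * \<delta> * (2 powr (- \<bar>\<alpha>\<bar>) * \<tau> powr \<alpha>) * (\<tau> - \<tau> / 2)\<^sup>2 / 2 = M"
      using \<tau> by (simp add: M_def c1_def powr_add power2_eq_square field_simps)
    ultimately have MU: "M \<le> U \<tau>" by simp
    define b where "b = B * (3 * \<tau>) powr (- \<nu>)"
    have b: "b > 0" using B \<tau> by (simp add: b_def)
    show False
    proof (rule doubling_blow_up[of q b M U \<tau>])
      show "U s \<le> U t" if "\<tau> \<le> s" "s \<le> t" "t \<le> 2 * \<tau>" for s t
        using that \<tau> by (intro Umono) auto
      show "U s + m * (t - s)\<^sup>2 / 2 \<le> U t"
        if "\<tau> \<le> s" "s < t" "t \<le> 2 * \<tau>" "0 \<le> m" "\<And>x. x \<in> {s<..<t} \<Longrightarrow> m \<le> b * \<bar>U x\<bar> powr q" for s t m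
      proof (rule conv[OF _ _ _ V2])
        fix x assume x: "x \<in> {s<..<t}"
        have "(3 * \<tau>) powr (- \<nu>) \<le> (1 + x) powr (- \<nu>)"
          using x that \<tau> \<nu> by (intro powr_mono2') auto
        then have "b * \<bar>U x\<bar> powr q \<le> B * (1 + x) powr (- \<nu>) * \<bar>U x\<bar> powr q"
          unfolding b_def using B by (intro mult_right_mono mult_left_mono) auto
        with that(5)[OF x] show "m \<le> B * (1 + x) powr (- \<nu>) * \<bar>U x\<bar> powr q" by simp
      qed (use that \<tau> in auto)
      have "\<tau> powr \<beta> = K powr \<beta> * \<delta> powr (- (q - 1))"
        unfolding \<tau>_def using K1 \<delta> \<beta>0 by (simp add: powr_mult powr_powr)
      then have t\<beta>: "\<tau> powr \<beta> * \<delta> powr (q - 1) = K powr \<beta>"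
        using \<delta> by (simp add: mult.assoc flip: powr_add)
      have "b * M powr (q - 1) * \<tau>\<^sup>2 = c2 * (\<tau> powr \<beta> * \<delta> powr (q - 1))"
      proof -
        have e: "\<beta> = - \<nu> + (\<alpha> + 2) * (q - 1) + 2" by (simp add: \<beta>_def)
        have t: "\<tau> powr \<beta> = \<tau> powr (- \<nu>) * \<tau> powr ((\<alpha> + 2) * (q - 1)) * \<tau>\<^sup>2"
          using \<tau> unfolding e powr_add by simp
        have m: "M powr (q - 1) = c1 powr (q - 1) * \<delta> powr (q - 1) * \<tau> powr ((\<alpha> + 2) * (q - 1))"
          using \<tau> \<delta> c1 by (simp add: M_def powr_mult powr_powr)
        have b': "b = B * (3 powr (- \<nu>) * \<tau> powr (- \<nu>))"
          using \<tau> by (simp add: b_def powr_mult)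
        show ?thesis unfolding m b' t c2_def by (simp only: mult_ac)
      qed
      also have "\<dots> = c2 * K powr \<beta>" by (simp only: t\<beta>)
      finally have "b * M powr (q - 1) * \<tau>\<^sup>2 = c2 * K powr \<beta>" .
      moreover have "2 \<le> c2 * K powr \<beta> * (1 - \<rho>)\<^sup>2"
        using K2 c2 \<rho> by (simp add: K0_def field_simps)
      ultimately show "2 \<le> b * M powr (q - 1) * \<tau>\<^sup>2 * (1 - 2 powr (- (q - 1) / 2))\<^sup>2"
        by (simp add: \<rho>_def)
    qed (use q b M MU \<tau> in auto)
  qed
  then show ?thesis
    using K1 unfolding \<beta>_def I_def by (intro exI[of _ "2 * K"]) auto
qed

section \<open>Hoelder's inequality\<close>

text \<open>Young's inequality is applied pointwise to \<open>f\<close> and \<open>g\<close> divided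
  by their norms and then integrated; if one norm is zero, the product vanishes almost
  everywhere.\<close>

lemma Holder_inequality:
  fixes f g :: "'a::euclidean_space \<Rightarrow> real"
  assumes pq: "1 < p" "1 / p + 1 / p' = 1"
    and f: "f \<in> borel_measurable lborel" "integrable lborel (\<lambda>x. \<bar>f x\<bar> powr p)"
    and g: "g \<in> borel_measurable lborel" "integrable lborel (\<lambda>x. \<bar>g x\<bar> powr p')"
  shows "integrable lborel (\<lambda>x. f x * g x)"
    and "\<bar>\<integral>x. f x * g x \<partial>lborel\<bar> \<le> Lp_norm p f * Lp_norm p' g"
proof -
  have p': "p' > 0" "1 < p'"
  proof -
    have "0 < 1 / p" "1 / p < 1" using pq(1) by auto
    then have "0 < 1 / p'" "1 / p' < 1" using pq(2) by linarith+
    then show "p' > 0" "1 < p'" by (auto simp: field_simps split: if_splits)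
  qed
  have young: "\<bar>a * b\<bar> \<le> \<bar>a\<bar> powr p / p + \<bar>b\<bar> powr p' / p'" for a b :: real
    using Youngs_inequality[of p p' "\<bar>a\<bar>" "\<bar>b\<bar>"] pq p' by (simp add: abs_mult)
  show int: "integrable lborel (\<lambda>x. f x * g x)"
  proof (rule Bochner_Integration.integrable_bound)
    show "integrable lborel (\<lambda>x. \<bar>f x\<bar> powr p / p + \<bar>g x\<bar> powr p' / p')"
      using f g by auto
    show "AE x in lborel. norm (f x * g x) \<le> norm (\<bar>f x\<bar> powr p / p + \<bar>g x\<bar> powr p' / p')"
      using young pq p' by (intro AE_I2) (simp add: order_trans[OF young abs_ge_self])
  qed (use f g in measurable)
  define F where "F = (\<integral>x. \<bar>f x\<bar> powr p \<partial>lborel)"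
  define G where "G = (\<integral>x. \<bar>g x\<bar> powr p' \<partial>lborel)"
  have FG: "0 \<le> F" "0 \<le> G" by (auto simp: F_def G_def)
  show "\<bar>\<integral>x. f x * g x \<partial>lborel\<bar> \<le> Lp_norm p f * Lp_norm p' g"
  proof (cases "F = 0 \<or> G = 0")
    case True
    have "AE x in lborel. f x * g x = 0"
    proof (cases "F = 0")
      case True
      then have "AE x in lborel. \<bar>f x\<bar> powr p = 0"
        using integral_nonneg_eq_0_iff_AE[OF f(2)] by (simp add: F_def)
      then show ?thesis by eventually_elim simp
    next
      case False
      with \<open>F = 0 \<or> G = 0\<close> have "AE x in lborel. \<bar>g x\<bar> powr p' = 0"
        using integral_nonneg_eq_0_iff_AE[OF g(2)] by (simp add: G_def)
      then show ?thesis by eventually_elim simp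
    qed
    then have "(\<integral>x. f x * g x \<partial>lborel) = 0"
      by (rule integral_eq_zero_AE)
    then show ?thesis by (simp add: Lp_norm_def)
  next
    case False
    with FG have pos: "0 < F" "0 < G" by auto
    define a where "a = F powr (1 / p)"
    define b where "b = G powr (1 / p')"
    have ab: "0 < a" "0 < b" "a powr p = F" "b powr p' = G"
      using pos pq p' by (auto simp: a_def b_def powr_powr)
    have "\<bar>\<integral>x. f x * g x \<partial>lborel\<bar> \<le> (\<integral>x. \<bar>f x * g x\<bar> \<partial>lborel)"
      by (rule integral_abs_bound)
    also have "\<dots> \<le> (\<integral>x. (a * b) * (\<bar>f x\<bar> powr p / F / p + \<bar>g x\<bar> powr p' / G / p') \<partial>lborel)"
    proof (intro integral_mono)
      fix x
      have "\<bar>(f x / a) * (g x / b)\<bar> \<le> \<bar>f x\<bar> powr p / F / p + \<bar>g x\<bar> powr p' / G / p'"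
        using young[of "f x / a" "g x / b"] ab by (simp add: powr_divide)
      then have "(a * b) * \<bar>(f x / a) * (g x / b)\<bar>
          \<le> (a * b) * (\<bar>f x\<bar> powr p / F / p + \<bar>g x\<bar> powr p' / G / p')"
        using ab by (intro mult_left_mono) auto
      moreover have "(a * b) * \<bar>(f x / a) * (g x / b)\<bar> = \<bar>f x * g x\<bar>"
        using ab by (simp add: abs_mult)
      ultimately show "\<bar>f x * g x\<bar> \<le> (a * b) * (\<bar>f x\<bar> powr p / F / p + \<bar>g x\<bar> powr p' / G / p')"
        by simp
    qed (use int f g in auto)
    also have "\<dots> = (a * b) * (F / F / p + G / G / p')"
      using f g by (simp add: F_def G_def)
    also have "\<dots> = a * b" using pos pq by simp
    finally show ?thesis by (simp add: a_def b_def F_def G_def Lp_norm_def)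
  qed
qed

lemma Lp_norm_nonneg: "0 \<le> Lp_norm r f"
  by (simp add: Lp_norm_def)

section \<open>The radial eigenfunction of the Laplacian\<close>

text \<open>\<open>radial_weight m (norm x ^ 2)\<close> is, up to a factor, the spherical mean of
  \<open>exp (x \<bullet> \<omega>)\<close> over the unit sphere in dimension \<open>m + 1\<close>.\<close>

fun weight_coeff :: "nat \<Rightarrow> nat \<Rightarrow> real" where
  "weight_coeff m 0 = 1"
| "weight_coeff m (Suc k) = weight_coeff m k / (2 * (real k + 1) * (2 * real k + real m + 1))"

definition radial_weight :: "nat \<Rightarrow> real \<Rightarrow> real" where
  "radial_weight m s = (\<Sum>k. weight_coeff m k * s ^ k)"

lemma weight_coeff_pos: "weight_coeff m k > 0"
  by (induction k) (auto intro!: divide_pos_pos mult_pos_pos)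

text \<open>For \<open>m = 0\<close> these are the coefficients of cosh r as a series in r^2, and a
  larger \<open>m\<close> only enlarges the denominators.\<close>

lemma weight_coeff_le: "weight_coeff m k * fact (2 * k) \<le> 1"
proof (induction k)
  case (Suc k)
  define D where "D = 2 * (real k + 1) * (2 * real k + real m + 1)"
  have D: "D > 0" unfolding D_def by (intro mult_pos_pos) auto
  have 1: "(fact (2 * Suc k) :: real) = (2 * real k + 1) * (2 * real k + 2) * fact (2 * k)"
    by (simp add: algebra_simps)
  have 2: "weight_coeff m (Suc k) = weight_coeff m k / D" by (simp add: D_def)
  have "weight_coeff m (Suc k) * fact (2 * Suc k)
      = (weight_coeff m k * fact (2 * k)) * ((2 * real k + 1) * (2 * real k + 2) / D)"
    unfolding 1 2 by simp
  also have "\<dots> \<le> 1 * 1"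
  proof (intro mult_mono Suc.IH)
    have "(2 * real k + 1) * (2 * real k + 2) \<le> D"
      by (simp add: D_def algebra_simps)
    then show "(2 * real k + 1) * (2 * real k + 2) / D \<le> 1" using D by simp
  qed (use D in auto)
  finally show ?case by simp
qed simp

text \<open>The source of the decay: it bounds the k-th term times r^(m/2) by sqrt(m!) times the
  geometric mean of r^(2k)/(2k)! and r^(2k+m)/(2k+m)!, two terms of the series of exp r.\<close>

lemma weight_coeff_sq_le: "(weight_coeff m k)\<^sup>2 * fact (2 * k) * fact (2 * k + m) \<le> fact m"
proof (induction k)
  case (Suc k)
  define D where "D = 2 * (real k + 1) * (2 * real k + real m + 1)"
  have D: "D > 0" unfolding D_def by (intro mult_pos_pos) auto
  define N where "N = (2 * real k + 1) * (2 * real k + 2) * (2 * real k + real m + 1) * (2 * real k + real m + 2)"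
  have 1: "(fact (2 * Suc k) :: real) = (2 * real k + 1) * (2 * real k + 2) * fact (2 * k)"
    by (simp add: algebra_simps)
  have "2 * Suc k + m = Suc (Suc (2 * k + m))" by simp
  then have 2: "(fact (2 * Suc k + m) :: real)
      = (2 * real k + real m + 1) * (2 * real k + real m + 2) * fact (2 * k + m)"
    by (simp only: fact_Suc of_nat_Suc of_nat_add of_nat_mult) (simp add: algebra_simps)
  have "(weight_coeff m (Suc k))\<^sup>2 * fact (2 * Suc k) * fact (2 * Suc k + m)
      = ((weight_coeff m k)\<^sup>2 * fact (2 * k) * fact (2 * k + m)) * (N / D\<^sup>2)"
    unfolding 1 2 N_def by (simp add: D_def power_divide)
  also have "\<dots> \<le> fact m * 1"
  proof (intro mult_mono Suc.IH)
    have "(2 * real k + 1) * (2 * real k + real m + 2) \<le> (2 * real k + 2) * (2 * real k + real m + 1)"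
      by (simp add: algebra_simps)
    then have "((2 * real k + 2) * (2 * real k + real m + 1)) *
        ((2 * real k + 1) * (2 * real k + real m + 2))
      \<le> ((2 * real k + 2) * (2 * real k + real m + 1)) *
        ((2 * real k + 2) * (2 * real k + real m + 1))"
      by (intro mult_left_mono) auto
    also have "((2 * real k + 2) * (2 * real k + real m + 1)) *
        ((2 * real k + 1) * (2 * real k + real m + 2)) = N" by (simp add: N_def)
    also have "((2 * real k + 2) * (2 * real k + real m + 1)) *
        ((2 * real k + 2) * (2 * real k + real m + 1)) = D\<^sup>2"
      by (simp add: D_def power2_eq_square algebra_simps)
    finally show "N / D\<^sup>2 \<le> 1" using D by simp
  qed (auto simp: N_def)
  finally show ?case by simp
qed simp

lemma weight_coeff_le_inverse_fact: "weight_coeff m k \<le> inverse (fact (2 * k))"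
  using weight_coeff_le[of m k] by (simp add: field_simps)

lemma summable_weight: "summable (\<lambda>k. weight_coeff m k * s ^ k)"
proof (rule summable_comparison_test')
  show "summable (\<lambda>k. inverse (fact k) * \<bar>s\<bar> ^ k)" by (rule summable_exp)
  fix k :: nat
  have "weight_coeff m k \<le> inverse (fact (2 * k))" by (rule weight_coeff_le_inverse_fact)
  also have "\<dots> \<le> inverse (fact k)" by (intro le_imp_inverse_le fact_mono) auto
  finally show "norm (weight_coeff m k * s ^ k) \<le> inverse (fact k) * \<bar>s\<bar> ^ k"
    using weight_coeff_pos[of m k] by (simp add: abs_mult power_abs mult_right_mono)
qed

lemma smooth1_radial_weight: "smooth1 (radial_weight m)"
  unfolding radial_weight_def[abs_def] by (rule smooth1_power_series) (rule summable_weight)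

lemma radial_weight_ge_1:
  assumes "0 \<le> s"
  shows "1 \<le> radial_weight m s"
proof -
  have "(\<Sum>k<1. weight_coeff m k * s ^ k) \<le> radial_weight m s"
    unfolding radial_weight_def
    using assms by (intro sum_le_suminf summable_weight)
      (auto intro!: mult_nonneg_nonneg less_imp_le[OF weight_coeff_pos])
  then show ?thesis by simp
qed

text \<open>The recursion for \<open>weight_coeff\<close> is this equation read off coefficientwise:
  in dimension m + 1, 4k(k+1) + 2(m+1)(k+1) = 2(k+1)(2k+m+1).\<close>

lemma radial_laplacian_weight: "radial_laplacian (real (Suc m)) (radial_weight m) s = radial_weight m s"
proof -
  let ?c = "weight_coeff m"
  have S: "summable (\<lambda>k. ?c k * x ^ k)" "summable (\<lambda>k. diffs ?c k * x ^ k)"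
    "summable (\<lambda>k. diffs (diffs ?c) k * x ^ k)" for x :: real
    by (intro termdiff_converges_all summable_weight)+
  have 1: "deriv (radial_weight m) = (\<lambda>x. \<Sum>k. diffs ?c k * x ^ k)"
    unfolding radial_weight_def[abs_def]
    by (intro ext DERIV_imp_deriv termdiffs_strong_converges_everywhere S)
  have 2: "deriv (deriv (radial_weight m)) = (\<lambda>x. \<Sum>k. diffs (diffs ?c) k * x ^ k)"
    unfolding 1 by (intro ext DERIV_imp_deriv termdiffs_strong_converges_everywhere S)
  \<comment> \<open>The coefficients of s \<Theta>''. The extra factor s shifts the index by one,
    and \<open>d 0 = 0\<close> supplies the missing term.\<close>
  define d where "d k = real k * (real k + 1) * ?c (Suc k)" for k
  have "(\<lambda>k. s * (diffs (diffs ?c) k * s ^ k)) sums (s * deriv (deriv (radial_weight m)) s)"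
    unfolding 2 by (intro sums_mult summable_sums S)
  also have "(\<lambda>k. s * (diffs (diffs ?c) k * s ^ k)) = (\<lambda>k. d (Suc k) * s ^ Suc k)"
    by (simp add: d_def diffs_def algebra_simps fun_eq_iff del: weight_coeff.simps)
  finally have d: "(\<lambda>k. d k * s ^ k) sums (s * deriv (deriv (radial_weight m)) s)"
    by (subst (asm) sums_Suc_iff) (simp add: d_def)
  have "(\<lambda>k. diffs ?c k * s ^ k) sums deriv (radial_weight m) s"
    unfolding 1 by (intro summable_sums S)
  from sums_add[OF sums_mult[OF d, of 4] sums_mult[OF this, of "2 * real (Suc m)"]]
  have "(\<lambda>k. 4 * (d k * s ^ k) + 2 * real (Suc m) * (diffs ?c k * s ^ k)) sums
      radial_laplacian (real (Suc m)) (radial_weight m) s"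
    by (simp add: radial_laplacian_def mult.assoc)
  moreover have "4 * (d k * s ^ k) + 2 * real (Suc m) * (diffs ?c k * s ^ k) = ?c k * s ^ k" for k
  proof -
    have "?c k = 2 * (real k + 1) * (2 * real k + real m + 1) * ?c (Suc k)"
    proof -
      have "2 * (real k + 1) * (2 * real k + real m + 1) \<noteq> 0"
        by (metis add_pos_nonneg less_numeral_extra(3) mult_pos_pos of_nat_0_le_iff
            zero_less_numeral zero_less_one add_nonneg_pos mult_nonneg_nonneg zero_le_numeral add_nonneg_nonneg)
      then show ?thesis by simp
    qed
    then show ?thesis by (simp add: d_def diffs_def algebra_simps del: weight_coeff.simps)
  qed
  ultimately have "(\<lambda>k. ?c k * s ^ k) sums radial_laplacian (real (Suc m)) (radial_weight m) s"
    by simp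
  moreover have "(\<lambda>k. ?c k * s ^ k) sums radial_weight m s"
    unfolding radial_weight_def by (intro summable_sums S)
  ultimately show ?thesis by (rule sums_unique2)
qed

lemma suminf_exp_subseq:
  fixes r :: real
  assumes "0 \<le> r"
  shows "summable (\<lambda>k. r ^ (2 * k + m) / fact (2 * k + m))"
    and "(\<Sum>k. r ^ (2 * k + m) / fact (2 * k + m)) \<le> exp r"
proof -
  define e where "e j = r ^ j / fact j" for j :: nat
  have e: "e sums exp r"
    using exp_converges[of r] by (simp add: e_def[abs_def] divide_inverse mult.commute)
  then have s: "summable e" "suminf e = exp r" by (auto simp: sums_iff)
  have inj: "inj (\<lambda>k::nat. 2 * k + m)" by (auto simp: inj_def)
  have pos: "0 \<le> e j" for j using assms by (simp add: e_def)
  have eq: "(\<lambda>k. r ^ (2 * k + m) / fact (2 * k + m)) = e \<circ> (\<lambda>k. 2 * k + m)"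
    by (auto simp: e_def)
  show "summable (\<lambda>k. r ^ (2 * k + m) / fact (2 * k + m))"
    unfolding eq using summable_reindex[OF s(1) inj pos] .
  show "(\<Sum>k. r ^ (2 * k + m) / fact (2 * k + m)) \<le> exp r"
    unfolding eq using suminf_reindex_mono[OF s(1) inj pos] s(2) by simp
qed

lemma radial_weight_le_exp:
  assumes "0 \<le> r"
  shows "radial_weight m (r\<^sup>2) \<le> exp r"
proof -
  have "weight_coeff m k * (r\<^sup>2) ^ k \<le> r ^ (2 * k + 0) / fact (2 * k + 0)" for k
    using mult_right_mono[OF weight_coeff_le_inverse_fact[of m k], of "r ^ (2 * k)"] assms
    unfolding add_0_right power_mult[of r 2 k] by (simp only: divide_inverse mult.commute zero_le_power zero_le_power2)
  then have "radial_weight m (r\<^sup>2) \<le> (\<Sum>k. r ^ (2 * k + 0) / fact (2 * k + 0))"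
    unfolding radial_weight_def
    by (intro suminf_le summable_weight suminf_exp_subseq assms)
  also have "\<dots> \<le> exp r" by (rule suminf_exp_subseq(2)[OF assms])
  finally show ?thesis .
qed

text \<open>Termwise, \<open>weight_coeff_sq_le\<close> and the inequality between geometric and
  arithmetic mean leave two subseries of the exponential series, each at most exp r.\<close>

lemma radial_weight_decay:
  assumes "0 \<le> r"
  shows "radial_weight m (r\<^sup>2) * sqrt (r ^ m) \<le> sqrt (fact m) * exp r"
proof -
  define X where "X j = r ^ j / fact j" for j :: nat
  have Xpos: "0 \<le> X j" for j using assms by (simp add: X_def)
  have le: "weight_coeff m k * (r\<^sup>2) ^ k * sqrt (r ^ m)
      \<le> sqrt (fact m) / 2 * (X (2 * k + 0) + X (2 * k + m))" for k
  proof (rule power2_le_imp_le)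
    have "(weight_coeff m k * (r\<^sup>2) ^ k * sqrt (r ^ m))\<^sup>2
        = (weight_coeff m k)\<^sup>2 * fact (2 * k) * fact (2 * k + m) * (X (2 * k) * X (2 * k + m))"
    proof -
      have "(sqrt (r ^ m))\<^sup>2 = r ^ m" using assms by simp
      moreover have "((r\<^sup>2) ^ k)\<^sup>2 * r ^ m = r ^ (2 * k) * r ^ (2 * k + m)"
        by (simp add: power_mult power_add power2_eq_square)
      ultimately show ?thesis
        by (simp add: X_def power_mult_distrib mult.assoc)
    qed
    also have "\<dots> \<le> fact m * (X (2 * k) * X (2 * k + m))"
      using Xpos by (intro mult_right_mono weight_coeff_sq_le) auto
    also have "\<dots> \<le> fact m * ((X (2 * k) + X (2 * k + m)) / 2)\<^sup>2"
      using sum_squares_ge_zero[of "X (2 * k) - X (2 * k + m)" 0]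
      by (intro mult_left_mono) (auto simp: power2_eq_square field_simps)
    also have "\<dots> = (sqrt (fact m) / 2 * (X (2 * k + 0) + X (2 * k + m)))\<^sup>2"
      by (simp add: power_mult_distrib power_divide)
    finally show "(weight_coeff m k * (r\<^sup>2) ^ k * sqrt (r ^ m))\<^sup>2
        \<le> (sqrt (fact m) / 2 * (X (2 * k + 0) + X (2 * k + m)))\<^sup>2" .
    show "0 \<le> sqrt (fact m) / 2 * (X (2 * k + 0) + X (2 * k + m))"
      using Xpos by (intro mult_nonneg_nonneg add_nonneg_nonneg) auto
  qed
  note E = suminf_exp_subseq[OF assms, folded X_def]
  have "radial_weight m (r\<^sup>2) * sqrt (r ^ m) = (\<Sum>k. weight_coeff m k * (r\<^sup>2) ^ k * sqrt (r ^ m))"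
    unfolding radial_weight_def by (rule suminf_mult2[OF summable_weight])
  also have "\<dots> \<le> (\<Sum>k. sqrt (fact m) / 2 * (X (2 * k + 0) + X (2 * k + m)))"
    by (intro suminf_le le summable_mult summable_mult2 summable_add summable_weight E)
  also have "\<dots> = sqrt (fact m) / 2 * ((\<Sum>k. X (2 * k + 0)) + (\<Sum>k. X (2 * k + m)))"
    by (simp only: suminf_mult[OF summable_add[OF E(1) E(1)]] suminf_add[OF E(1) E(1)])
  also have "\<dots> \<le> sqrt (fact m) / 2 * (exp r + exp r)"
    by (intro mult_left_mono add_mono E) auto
  finally show ?thesis by simp
qed


text \<open>Replaces r by 1 + r in the power. For r > 1 they are comparable; near the origin
  \<open>radial_weight_decay\<close> degenerates and \<open>radial_weight_le_exp\<close> is used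
  instead.\<close>

lemma radial_weight_decay_powr:
  obtains C where "C > 0" "\<And>r. 0 \<le> r \<Longrightarrow> radial_weight m (r\<^sup>2) \<le> C * (1 + r) powr (- real m / 2) * exp r"
proof
  define C where "C = sqrt (fact m) * 2 powr (real m / 2)"
  show "C > 0" by (simp add: C_def)
  fix r :: real assume r: "0 \<le> r"
  have f1: "1 \<le> sqrt (fact m)" by (simp add: fact_ge_1)
  have inv: "2 powr (real m / 2) * (1 + r) powr (- real m / 2) = ((1 + r) / 2) powr (- real m / 2)"
    using r powr_divide[of "1 + r" 2 "- real m / 2"] by (simp add: powr_minus field_simps)
  show "radial_weight m (r\<^sup>2) \<le> C * (1 + r) powr (- real m / 2) * exp r"
  proof (cases "r \<le> 1")
    case True
    have "1 \<le> ((1 + r) / 2) powr (- real m / 2)"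
      using r True powr_mono'[of "- real m / 2" 0 "(1 + r) / 2"] by simp
    then have "1 * 1 \<le> sqrt (fact m) * ((1 + r) / 2) powr (- real m / 2)"
      using f1 by (intro mult_mono) auto
    then have "1 \<le> C * (1 + r) powr (- real m / 2)"
      unfolding C_def mult.assoc inv by simp
    then have "1 * exp r \<le> C * (1 + r) powr (- real m / 2) * exp r"
      by (intro mult_right_mono) auto
    with radial_weight_le_exp[OF r, of m] show ?thesis by linarith
  next
    case False
    have "sqrt (r ^ m) = r powr (real m / 2)"
      using False by (simp add: powr_half_sqrt[symmetric] powr_powr flip: powr_realpow)
    then have "radial_weight m (r\<^sup>2) * r powr (real m / 2) \<le> sqrt (fact m) * exp r"
      using radial_weight_decay[OF r, of m] by simp
    then have "radial_weight m (r\<^sup>2) \<le> sqrt (fact m) * exp r * r powr (- real m / 2)"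
      using False by (simp add: powr_minus field_simps)
    also have "\<dots> \<le> sqrt (fact m) * exp r * ((1 + r) / 2) powr (- real m / 2)"
      using False by (intro mult_left_mono powr_mono2') auto
    also have "\<dots> = C * (1 + r) powr (- real m / 2) * exp r"
      unfolding inv[symmetric] C_def by (simp only: mult_ac)
    finally show ?thesis .
  qed
qed

text \<open>In terms of the distance \<open>d = t + 1 - r\<close> to the boundary of the cone,
  \<open>1 + t \<le> (1 + r) (1 + d)\<close>, and a fraction of \<open>exp d\<close> absorbs the power of \<open>1 + d\<close>.\<close>

lemma radial_weight_cone:
  assumes "1 \<le> m"
  obtains C where "C > 0" "\<And>r t. 0 \<le> r \<Longrightarrow> 0 \<le> t \<Longrightarrow> r \<le> t + 1 \<Longrightarrow>
    radial_weight m (r\<^sup>2) \<le> C * (1 + t) powr (- real m / 2) * exp ((r + t) / 2)"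
proof -
  obtain C where C: "C > 0" "\<And>r. 0 \<le> r \<Longrightarrow>
      radial_weight m (r\<^sup>2) \<le> C * (1 + r) powr (- real m / 2) * exp r"
    using radial_weight_decay_powr by blast
  define C' where "C' = C * real m powr (real m / 2) * exp (1 / 2)"
  have "C' > 0" using C assms by (simp add: C'_def)
  moreover have "radial_weight m (r\<^sup>2) \<le> C' * (1 + t) powr (- real m / 2) * exp ((r + t) / 2)"
    if r: "0 \<le> r" "0 \<le> t" "r \<le> t + 1" for r t
  proof -
    define d where "d = t + 1 - r"
    have d: "0 \<le> d" using r by (simp add: d_def)
    have "1 + t \<le> 1 + r + d" using r by (simp add: d_def)
    also have "\<dots> \<le> (1 + r) * (1 + d)" using r d by (simp add: algebra_simps)
    finally have t: "1 + t \<le> (1 + r) * (1 + d)" .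
    have "1 + d \<le> real m * (1 + d / real m)" using assms by (simp add: field_simps)
    also have "\<dots> \<le> real m * exp (d / real m)" by (intro mult_left_mono exp_ge_add_one_self) auto
    finally have "(1 + d) powr (real m / 2) \<le> (real m * exp (d / real m)) powr (real m / 2)"
      using d by (intro powr_mono2) auto
    also have "\<dots> = real m powr (real m / 2) * exp (d / 2)"
      using assms by (simp add: powr_mult exp_powr_real)
    finally have p: "(1 + d) powr (real m / 2) \<le> real m powr (real m / 2) * exp (d / 2)" .
    have "(1 + r) powr (- real m / 2) = ((1 + r) * (1 + d)) powr (- real m / 2) * (1 + d) powr (real m / 2)"
      using r d by (simp add: powr_mult powr_minus)
    also have "\<dots> \<le> (1 + t) powr (- real m / 2) * (real m powr (real m / 2) * exp (d / 2))"
      using r t p by (intro mult_mono powr_mono2') auto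
    finally have "C * (1 + r) powr (- real m / 2) * exp r
      \<le> C * ((1 + t) powr (- real m / 2) * (real m powr (real m / 2) * exp (d / 2))) * exp r"
      using C(1) by (intro mult_right_mono mult_left_mono) auto
    also have "\<dots> = C * real m powr (real m / 2) * (1 + t) powr (- real m / 2) * (exp (d / 2) * exp r)"
      by (simp only: mult_ac)
    also have "exp (d / 2) * exp r = exp (1 / 2) * exp ((r + t) / 2)"
      unfolding exp_add[symmetric] by (simp add: d_def field_simps)
    finally have "C * (1 + r) powr (- real m / 2) * exp r \<le> C' * (1 + t) powr (- real m / 2) * exp ((r + t) / 2)"
      unfolding C'_def by (simp only: mult_ac)
    with C(2)[OF r(1)] show ?thesis by linarith
  qed
  ultimately show ?thesis using that by blast
qed

section \<open>Integrals over balls\<close>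

lemma integrable_on_cball:
  fixes h :: "'a::euclidean_space \<Rightarrow> real"
  assumes "continuous_on UNIV h"
  shows "integrable lborel (\<lambda>x. indicator (cball 0 R) x * h x)"
  using borel_integrable_compact[of "cball 0 R" h] continuous_on_subset[OF assms] by simp

text \<open>Up to the volume of the unit ball, the volume of a shell of thickness 1.\<close>

lemma power_diff_pred_le:
  fixes R :: real
  assumes "1 \<le> R"
  shows "R ^ Suc m - (R - 1) ^ Suc m \<le> real (Suc m) * R ^ m"
proof (induction m)
  case (Suc m)
  have "R ^ Suc (Suc m) - (R - 1) ^ Suc (Suc m)
      = R * (R ^ Suc m - (R - 1) ^ Suc m) + (R - 1) ^ Suc m"
    by (simp add: algebra_simps)
  also have "\<dots> \<le> R * (real (Suc m) * R ^ m) + R ^ Suc m"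
    using assms Suc.IH by (intro add_mono mult_left_mono power_mono) auto
  also have "\<dots> = real (Suc (Suc m)) * R ^ Suc m"
    by (simp add: algebra_simps)
  finally show ?case .
qed simp

text \<open>The exponential concentrates the integral near the boundary, so the polynomial factor
  has one power less than the volume. Instead of polar coordinates, shells of thickness 1 are peeled
  off and the resulting recursion in \<open>R\<close> is solved by induction.\<close>

lemma integral_exp_norm_cball:
  assumes "0 < \<sigma>" "DIM('a::euclidean_space) = Suc m"
  obtains C where "C > 0" "\<And>R. 0 \<le> R \<Longrightarrow>
    (\<integral>(x::'a). indicator (cball 0 R) x * exp (\<sigma> * norm x) \<partial>lborel) \<le> C * exp (\<sigma> * R) * (1 + R) ^ m"
proof -
  define J where "J R = (\<integral>(x::'a). indicator (cball 0 R) x * exp (\<sigma> * norm x) \<partial>lborel)" for R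
  define \<omega> where "\<omega> = unit_ball_vol (real (Suc m))"
  have \<omega>: "\<omega> > 0" by (simp add: \<omega>_def)
  have vol: "(\<integral>(x::'a). indicator (cball 0 R) x \<partial>lborel) = \<omega> * R ^ Suc m" if "0 \<le> R" for R
    using content_cball[of R "0::'a"] that by (simp add: assms(2) \<omega>_def)
  have iI: "integrable lborel (indicator (cball 0 R) :: 'a \<Rightarrow> real)" for R
    using integrable_on_cball[of "\<lambda>_. 1" R] by simp
  have iE: "integrable lborel (\<lambda>x::'a. indicator (cball 0 R) x * exp (\<sigma> * norm x))" for R
    by (intro integrable_on_cball continuous_intros)
  have e: "exp (- \<sigma>) < 1" using assms by simp
  \<comment> \<open>The fixed point of the recursion: \<open>C * exp (- \<sigma>)\<close> from the
    smaller ball plus \<open>\<omega> * Suc m\<close> from the shell gives \<open>C\<close>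
    again.\<close>
  define C where "C = \<omega> * real (Suc m) / (1 - exp (- \<sigma>))"
  have C: "C > 0" using \<omega> e by (simp add: C_def)
  have C\<omega>: "\<omega> * real (Suc m) = C - C * exp (- \<sigma>)"
  proof -
    have "C * (1 - exp (- \<sigma>)) = \<omega> * real (Suc m)" using e by (simp add: C_def)
    then show ?thesis by (simp only: right_diff_distrib mult_1_right)
  qed
  have "\<omega> * 1 \<le> \<omega> * real (Suc m)" using \<omega> by (intro mult_left_mono) auto
  also have "\<dots> \<le> C" unfolding C\<omega> using C by simp
  finally have \<omega>C: "\<omega> \<le> C" by simp
  have small: "J R \<le> C * exp (\<sigma> * R) * (1 + R) ^ m" if R: "0 \<le> R" "R \<le> 1" for R
  proof -
    have "J R \<le> (\<integral>(x::'a). indicator (cball 0 R) x * exp (\<sigma> * R) \<partial>lborel)"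
      unfolding J_def using assms(1)
      by (intro integral_mono iE integrable_mult_left iI) (auto simp: indicator_def)
    also have "\<dots> = \<omega> * R ^ Suc m * exp (\<sigma> * R)" using vol[OF R(1)] by simp
    also have "\<dots> \<le> C * 1 * exp (\<sigma> * R)"
      using \<omega> \<omega>C R C power_le_one[of R "Suc m"] by (intro mult_right_mono mult_mono) auto
    also have "\<dots> \<le> C * exp (\<sigma> * R) * (1 + R) ^ m"
      using C R one_le_power[of "1 + R" m] by simp
    finally show ?thesis .
  qed
  have step: "J R \<le> J (R - 1) + exp (\<sigma> * R) * (\<omega> * R ^ Suc m - \<omega> * (R - 1) ^ Suc m)" if "1 \<le> R" for R
  proof -
    have "J R \<le> (\<integral>(x::'a). indicator (cball 0 (R - 1)) x * exp (\<sigma> * norm x)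
        + exp (\<sigma> * R) * (indicator (cball 0 R) x - indicator (cball 0 (R - 1)) x) \<partial>lborel)"
      unfolding J_def using assms(1)
      by (intro integral_mono iE Bochner_Integration.integrable_add integrable_mult_right
          Bochner_Integration.integrable_diff iI) (auto simp: indicator_def)
    also have "\<dots> = J (R - 1) + exp (\<sigma> * R) * (\<omega> * R ^ Suc m - \<omega> * (R - 1) ^ Suc m)"
      using that iE iI vol[of R] vol[of "R - 1"] by (simp add: J_def)
    finally show ?thesis .
  qed
  have bound: "\<forall>R. 0 \<le> R \<and> R \<le> real k \<longrightarrow> J R \<le> C * exp (\<sigma> * R) * (1 + R) ^ m" for k
  proof (induction k)
    case 0
    then show ?case using small by auto
  next
    case (Suc k)
    show ?case
    proof (intro allI impI)
      fix R assume R: "0 \<le> R \<and> R \<le> real (Suc k)"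
      show "J R \<le> C * exp (\<sigma> * R) * (1 + R) ^ m"
      proof (cases "R \<le> 1")
        case False
        then have "J R \<le> J (R - 1) + exp (\<sigma> * R) * (\<omega> * R ^ Suc m - \<omega> * (R - 1) ^ Suc m)"
          using step[of R] by simp
        also have "\<dots> \<le> C * exp (\<sigma> * (R - 1)) * (1 + (R - 1)) ^ m + exp (\<sigma> * R) * (\<omega> * (real (Suc m) * R ^ m))"
          using False R Suc.IH[rule_format, of "R - 1"] power_diff_pred_le[of R m] \<omega>
          by (intro add_mono mult_left_mono) (auto simp flip: right_diff_distrib simp del: power_Suc)
        also have "\<dots> = exp (\<sigma> * R) * R ^ m * (C * exp (- \<sigma>) + \<omega> * real (Suc m))"
          by (simp add: algebra_simps flip: exp_add)
        also have "\<dots> = C * exp (\<sigma> * R) * R ^ m" unfolding C\<omega> by simp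
        also have "\<dots> \<le> C * exp (\<sigma> * R) * (1 + R) ^ m"
          using C R by (intro mult_left_mono power_mono) auto
        finally show ?thesis .
      qed (use small R in auto)
    qed
  qed
  have "J R \<le> C * exp (\<sigma> * R) * (1 + R) ^ m" if "0 \<le> R" for R
    using bound[of "nat \<lceil>R\<rceil>"] that by (simp add: real_nat_ceiling_ge)
  with C that show ?thesis by (simp add: J_def)
qed

section \<open>Pairing a curve with a radial function\<close>

definition pairing :: "(real \<Rightarrow> real) \<Rightarrow> (real \<Rightarrow> 'a::euclidean_space \<Rightarrow> real) \<Rightarrow> real \<Rightarrow> real" where
  "pairing \<Theta> w t = (\<integral>x. w t x * \<Theta> (x \<bullet> x) \<partial>lborel)"

lemma continuous_on_radial:
  fixes S :: "'a::euclidean_space set"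
  assumes "continuous_on UNIV \<Theta>"
  shows "continuous_on S (\<lambda>x. \<Theta> (x \<bullet> x))"
  by (intro continuous_on_compose2[OF assms] continuous_intros) auto

lemma Lp_space_diff:
  assumes "0 < r" "f \<in> Lp_space r" "g \<in> Lp_space r"
  shows "(\<lambda>x. f x - g x) \<in> Lp_space r"
proof -
  have m: "f \<in> borel_measurable lborel" "g \<in> borel_measurable lborel"
    and i: "integrable lborel (\<lambda>x. \<bar>f x\<bar> powr r)" "integrable lborel (\<lambda>x. \<bar>g x\<bar> powr r)"
    using assms by (auto simp: Lp_space_def)
  have bd: "\<bar>a - b\<bar> powr r \<le> 2 powr r * (\<bar>a\<bar> powr r + \<bar>b\<bar> powr r)" for a b :: real
  proof -
    have "\<bar>a - b\<bar> powr r \<le> (2 * max \<bar>a\<bar> \<bar>b\<bar>) powr r"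
      using assms(1) by (intro powr_mono2) auto
    also have "\<dots> = 2 powr r * max \<bar>a\<bar> \<bar>b\<bar> powr r" by (simp add: powr_mult)
    also have "\<dots> \<le> 2 powr r * (\<bar>a\<bar> powr r + \<bar>b\<bar> powr r)"
      by (intro mult_left_mono) (auto simp: max_def)
    finally show ?thesis .
  qed
  have "integrable lborel (\<lambda>x. \<bar>f x - g x\<bar> powr r)"
  proof (rule Bochner_Integration.integrable_bound)
    show "integrable lborel (\<lambda>x. 2 powr r * (\<bar>f x\<bar> powr r + \<bar>g x\<bar> powr r))"
      using i by auto
    show "AE x in lborel. norm (\<bar>f x - g x\<bar> powr r) \<le> norm (2 powr r * (\<bar>f x\<bar> powr r + \<bar>g x\<bar> powr r))"
      using bd by (intro AE_I2) simp
  qed (use m in measurable)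
  with m show ?thesis by (auto simp: Lp_space_def)
qed

lemma conjugate_exponent:
  fixes r :: real
  assumes "1 < r"
  shows "1 < r / (r - 1)" "1 / r + 1 / (r / (r - 1)) = 1"
  using assms by (auto simp: field_simps)

lemma integrable_powr_on_cball:
  fixes h :: "'a::euclidean_space \<Rightarrow> real"
  assumes "continuous_on UNIV h" "0 < s"
  shows "(\<lambda>x. indicator (cball 0 R) x * h x) \<in> borel_measurable lborel"
    and "integrable lborel (\<lambda>x. \<bar>indicator (cball 0 R) x * h x\<bar> powr s)"
proof -
  show "(\<lambda>x. indicator (cball 0 R) x * h x) \<in> borel_measurable lborel"
    using integrable_on_cball[OF assms(1)] by (rule borel_measurable_integrable)
  have "integrable lborel (\<lambda>x. indicator (cball 0 R) x * \<bar>h x\<bar> powr s)"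
    using assms(2) by (intro integrable_on_cball continuous_on_powr' continuous_intros assms(1)) auto
  moreover have "\<bar>indicator (cball 0 R) x * h x\<bar> powr s = indicator (cball 0 R) x * \<bar>h x\<bar> powr s" for x
    by (auto simp: indicator_def)
  ultimately show "integrable lborel (\<lambda>x. \<bar>indicator (cball 0 R) x * h x\<bar> powr s)" by simp
qed

text \<open>As \<open>w\<close> vanishes almost everywhere off the ball, the weight may be truncated
  to the ball before applying Hoelder, so its growth at infinity does no harm.\<close>

lemma pairing_Lp_bound:
  fixes w :: "'a::euclidean_space \<Rightarrow> real"
  assumes r: "1 < r" and w: "w \<in> Lp_space r" and s: "AE x in lborel. norm x > R \<longrightarrow> w x = 0"
    and h: "continuous_on UNIV h"
  shows "integrable lborel (\<lambda>x. w x * h x)"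
    and "\<bar>\<integral>x. w x * h x \<partial>lborel\<bar>
        \<le> Lp_norm r w * Lp_norm (r / (r - 1)) (\<lambda>x. indicator (cball 0 R) x * h x)"
proof -
  have wm: "w \<in> borel_measurable lborel" "integrable lborel (\<lambda>x. \<bar>w x\<bar> powr r)"
    using w by (auto simp: Lp_space_def)
  have hm: "h \<in> borel_measurable lborel"
    using borel_measurable_continuous_onI[OF h] by simp
  note ex = conjugate_exponent[OF r]
  have "0 < r / (r - 1)" using ex by simp
  note H = Holder_inequality[OF r ex(2) wm integrable_powr_on_cball[OF h this, of R]]
  have ae: "AE x in lborel. w x * (indicator (cball 0 R) x * h x) = w x * h x"
    using s by eventually_elim (auto simp: indicator_def)
  show "integrable lborel (\<lambda>x. w x * h x)"
    by (rule integrable_cong_AE_imp[OF H(1) _ ae]) (use wm hm in measurable)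
  have "(\<integral>x. w x * h x \<partial>lborel) = (\<integral>x. w x * (indicator (cball 0 R) x * h x) \<partial>lborel)"
    by (intro integral_cong_AE borel_measurable_integrable[OF H(1)] AE_symmetric[OF ae])
      (use wm hm in measurable)
  with H(2) show "\<bar>\<integral>x. w x * h x \<partial>lborel\<bar>
        \<le> Lp_norm r w * Lp_norm (r / (r - 1)) (\<lambda>x. indicator (cball 0 R) x * h x)"
    by simp
qed

lemma continuous_on_pairing:
  fixes w :: "real \<Rightarrow> 'a::euclidean_space \<Rightarrow> real"
  assumes r: "1 < r" and w: "\<And>t. t \<in> J \<Longrightarrow> w t \<in> Lp_space r"
    and lim: "\<And>t. t \<in> J \<Longrightarrow> ((\<lambda>s. Lp_norm r (\<lambda>x. w s x - w t x)) \<longlongrightarrow> 0) (at t within J)"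
    and supp: "\<And>t. t \<in> J \<Longrightarrow> AE x in lborel. norm x > t + 1 \<longrightarrow> w t x = 0"
    and \<Theta>: "continuous_on UNIV \<Theta>"
  shows "continuous_on J (pairing \<Theta> w)"
  unfolding continuous_on_def
proof
  fix t assume t: "t \<in> J"
  define h where "h x = \<Theta> (x \<bullet> x)" for x :: 'a
  have h: "continuous_on UNIV h" unfolding h_def by (rule continuous_on_radial[OF \<Theta>])
  \<comment> \<open>For s < t + 1 the slice at time s lives in the ball of radius t + 2, so one
    constant serves all times near t, including later ones.\<close>
  define C where "C = Lp_norm (r / (r - 1)) (\<lambda>x. indicator (cball 0 (t + 2)) x * h x)"
  have "((\<lambda>s. pairing \<Theta> w s - pairing \<Theta> w t) \<longlongrightarrow> 0) (at t within J)"
  proof (rule Lim_null_comparison)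
    show "((\<lambda>s. Lp_norm r (\<lambda>x. w s x - w t x) * C) \<longlongrightarrow> 0) (at t within J)"
      using tendsto_mult_right[OF lim[OF t], of C] by simp
    have "eventually (\<lambda>s. s \<in> J \<and> s < t + 1) (at t within J)"
      unfolding eventually_at by (intro exI[of _ 1]) (auto simp: dist_real_def)
    then show "eventually (\<lambda>s. norm (pairing \<Theta> w s - pairing \<Theta> w t)
        \<le> Lp_norm r (\<lambda>x. w s x - w t x) * C) (at t within J)"
    proof eventually_elim
      case (elim s)
      have "AE x in lborel. norm x > t + 2 \<longrightarrow> w s x - w t x = 0"
        using supp[of s] supp[OF t] elim by (auto elim!: eventually_elim2)
      moreover have "(\<lambda>x. w s x - w t x) \<in> Lp_space r"
        using elim t r by (intro Lp_space_diff w) auto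
      ultimately have "\<bar>\<integral>x. (w s x - w t x) * h x \<partial>lborel\<bar> \<le> Lp_norm r (\<lambda>x. w s x - w t x) * C"
        unfolding C_def using pairing_Lp_bound(2)[OF r _ _ h] by blast
      moreover have "(\<integral>x. (w s x - w t x) * h x \<partial>lborel) = pairing \<Theta> w s - pairing \<Theta> w t"
        unfolding pairing_def h_def[symmetric] left_diff_distrib
        using elim t by (intro Bochner_Integration.integral_diff pairing_Lp_bound(1)[OF r w supp h]) auto
      ultimately show ?case by simp
    qed
  qed
  then show "(pairing \<Theta> w \<longlongrightarrow> pairing \<Theta> w t) (at t within J)"
    by (rule LIM_zero_cancel)
qed

lemma Lp_norm_le_H1_norm: "Lp_norm 2 f \<le> H1_norm f"
  unfolding H1_norm_def by (rule real_le_rsqrt) (simp add: sum_nonneg)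

section \<open>Product test functions\<close>

lemma slab_subset_strip:
  assumes "0 < t1" "ereal t2 < T"
  shows "{t1..t2} \<times> C \<subseteq> open_strip T"
proof -
  have "ereal t < T" if "t \<le> t2" for t
    using that by (intro le_less_trans[OF _ assms(2)]) simp
  with assms(1) show ?thesis by (auto simp: open_strip_def)
qed

text \<open>Fubini. As \<open>h\<close> is controlled only on compact subsets of the strip, it is
  first multiplied by the indicator of a compact slab outside which the test function
  vanishes.\<close>

lemma integral_product_test:
  fixes h :: "real \<times> 'a::euclidean_space \<Rightarrow> real"
  assumes loc: "locally_integrable_on (open_strip T) h" and t: "0 < t1" "ereal t2 < T"
    and \<eta>: "continuous_on UNIV \<eta>" "\<And>t. t \<notin> {t1..t2} \<Longrightarrow> \<eta> t = 0"
    and \<omega>: "continuous_on UNIV \<omega>" "\<And>x. x \<notin> cball 0 R \<Longrightarrow> \<omega> x = 0"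
  shows "integrable lborel (\<lambda>t. \<eta> t * (\<integral>x. h (t, x) * \<omega> x \<partial>lborel))"
    and "(\<integral>z. h z * (\<eta> (fst z) * \<omega> (snd z)) \<partial>lborel) = (\<integral>t. \<eta> t * (\<integral>x. h (t, x) * \<omega> x \<partial>lborel) \<partial>lborel)"
    and "integrable lborel (\<lambda>z. h z * (\<eta> (fst z) * \<omega> (snd z)))"
proof -
  define K where "K = {t1..t2} \<times> cball (0::'a) R"
  define \<phi> where "\<phi> z = \<eta> (fst z) * \<omega> (snd z)" for z :: "real \<times> 'a"
  have K: "compact K" unfolding K_def by (intro compact_Times) auto
  have "K \<subseteq> open_strip T" unfolding K_def by (rule slab_subset_strip[OF t])
  with loc K have iK: "integrable lborel (\<lambda>z. indicator K z *\<^sub>R h z)"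
    by (auto simp: locally_integrable_on_def set_integrable_def)
  have c\<phi>: "continuous_on S \<phi>" for S
    unfolding \<phi>_def
    by (intro continuous_intros continuous_on_compose2[OF \<eta>(1)] continuous_on_compose2[OF \<omega>(1)]) auto
  have z\<phi>: "\<phi> z = 0" if "z \<notin> K" for z
    using that \<eta>(2)[of "fst z"] \<omega>(2)[of "snd z"] by (cases z) (auto simp: K_def \<phi>_def)
  obtain B where B: "\<And>z. z \<in> K \<Longrightarrow> \<bar>\<phi> z\<bar> \<le> B"
    using compact_imp_bounded[OF compact_continuous_image[OF c\<phi> K]]
    by (auto simp: bounded_iff)
  have m\<phi>: "\<phi> \<in> borel_measurable lborel"
    using borel_measurable_continuous_onI[OF c\<phi>] by simp
  have int: "integrable lborel (\<lambda>z. h z * \<phi> z)"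
  proof -
    have "integrable lborel (\<lambda>z. (indicator K z *\<^sub>R h z) * \<phi> z)"
    proof (rule Bochner_Integration.integrable_bound)
      show "integrable lborel (\<lambda>z. B * norm (indicator K z *\<^sub>R h z))"
        by (intro integrable_mult_right integrable_norm iK)
      show "(\<lambda>z. (indicator K z *\<^sub>R h z) * \<phi> z) \<in> borel_measurable lborel"
        by (intro borel_measurable_times borel_measurable_integrable[OF iK] m\<phi>)
      show "AE z in lborel. norm ((indicator K z *\<^sub>R h z) * \<phi> z) \<le> norm (B * norm (indicator K z *\<^sub>R h z))"
      proof (intro AE_I2)
        fix z
        show "norm ((indicator K z *\<^sub>R h z) * \<phi> z) \<le> norm (B * norm (indicator K z *\<^sub>R h z))"
        proof (cases "z \<in> K")
          case True
          then have "\<bar>\<phi> z\<bar> \<le> \<bar>B\<bar>" using B[of z] by linarith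
          then show ?thesis
            using True mult_right_mono[of "\<bar>\<phi> z\<bar>" "\<bar>B\<bar>" "\<bar>h z\<bar>"] by (simp add: abs_mult mult.commute)
        qed simp
      qed
    qed
    moreover have "(\<lambda>z. (indicator K z *\<^sub>R h z) * \<phi> z) = (\<lambda>z. h z * \<phi> z)"
      using z\<phi> by (auto simp: fun_eq_iff indicator_def)
    ultimately show ?thesis by simp
  qed
  then show "integrable lborel (\<lambda>z. h z * (\<eta> (fst z) * \<omega> (snd z)))" by (simp add: \<phi>_def)
  from int have int': "integrable (lborel \<Otimes>\<^sub>M lborel) (\<lambda>z. h z * \<phi> z)"
    by (simp add: lborel_prod)
  have inner: "(\<integral>x. h (t, x) * \<phi> (t, x) \<partial>lborel) = \<eta> t * (\<integral>x. h (t, x) * \<omega> x \<partial>lborel)" for t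
  proof -
    have "(\<integral>x. h (t, x) * \<phi> (t, x) \<partial>lborel) = (\<integral>x. \<eta> t * (h (t, x) * \<omega> x) \<partial>lborel)"
      by (simp add: \<phi>_def mult_ac)
    then show ?thesis by simp
  qed
  show "integrable lborel (\<lambda>t. \<eta> t * (\<integral>x. h (t, x) * \<omega> x \<partial>lborel))"
    using lborel_pair.integrable_fst'[OF int'] by (simp add: inner)
  show "(\<integral>z. h z * (\<eta> (fst z) * \<omega> (snd z)) \<partial>lborel) = (\<integral>t. \<eta> t * (\<integral>x. h (t, x) * \<omega> x \<partial>lborel) \<partial>lborel)"
    using lborel_pair.integral_fst'[OF int', unfolded inner lborel_prod] by (simp add: \<phi>_def)
qed

text \<open>Space-time integrability gives no information about one prescribed time; Fubini gives it
  for almost every time, which is enough under a time integral.\<close>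

lemma AE_slice_integrable:
  fixes h :: "real \<times> 'a::euclidean_space \<Rightarrow> real"
  assumes loc: "locally_integrable_on (open_strip T) h" and t: "0 < t1" "ereal t2 < T"
  shows "AE t in lborel. t \<in> {t1..t2} \<longrightarrow> integrable lborel (\<lambda>x. indicator (cball 0 R) x * h (t, x))"
proof -
  define K where "K = {t1..t2} \<times> cball (0::'a) R"
  have K: "compact K" unfolding K_def by (intro compact_Times) auto
  have "K \<subseteq> open_strip T" unfolding K_def by (rule slab_subset_strip[OF t])
  with loc K have "integrable (lborel \<Otimes>\<^sub>M lborel) (\<lambda>z. indicator K z *\<^sub>R h z)"
    by (auto simp: locally_integrable_on_def set_integrable_def lborel_prod)
  from lborel_pair.AE_integrable_fst'[OF this]
  show ?thesis
  proof eventually_elim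
    case (elim t)
    show ?case
    proof
      assume "t \<in> {t1..t2}"
      then have "(\<lambda>x. indicator K (t, x) *\<^sub>R h (t, x)) = (\<lambda>x. indicator (cball 0 R) x * h (t, x))"
        by (auto simp: K_def indicator_def fun_eq_iff)
      with elim show "integrable lborel (\<lambda>x. indicator (cball 0 R) x * h (t, x))" by simp
    qed
  qed
qed


section \<open>Cutoff in the variable |x|^2\<close>

definition cutoff :: "real \<Rightarrow> real \<Rightarrow> real" where
  "cutoff \<rho> s = 1 - smooth_step (s - \<rho>)"

lemma smooth1_cutoff: "smooth1 (cutoff \<rho>)"
proof -
  have "smooth1 (\<lambda>s. smooth_step (s - \<rho>))"
    by (rule smooth1_comp[OF smooth1_smooth_step smooth1_diff[OF smooth1_id smooth1_const]])
  from smooth1_diff[OF smooth1_const this, of 1] show ?thesis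
    by (simp add: cutoff_def[abs_def])
qed

lemma cutoff_1: "s \<le> \<rho> \<Longrightarrow> cutoff \<rho> s = 1"
  by (simp add: cutoff_def smooth_step_0)

lemma cutoff_0: "\<rho> + 1 \<le> s \<Longrightarrow> cutoff \<rho> s = 0"
  by (simp add: cutoff_def smooth_step_1)

text \<open>The inequality is strict because the two functions must agree in a neighbourhood of
  \<open>s\<close> for their derivatives to agree at \<open>s\<close>.\<close>

lemma radial_laplacian_cutoff:
  assumes "s < \<rho>"
  shows "radial_laplacian n (\<lambda>s. cutoff \<rho> s * \<Theta> s) s = radial_laplacian n \<Theta> s"
proof -
  have ev: "eventually (\<lambda>x. x < \<rho>) (nhds s)"
    using assms eventually_nhds_in_open[of "{..<\<rho>}" s] by simp
  have 1: "deriv (\<lambda>s. cutoff \<rho> s * \<Theta> s) x = deriv \<Theta> x" if "x < \<rho>" for x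
  proof (rule deriv_cong_ev)
    have "eventually (\<lambda>y. y < \<rho>) (nhds x)"
      using that eventually_nhds_in_open[of "{..<\<rho>}" x] by simp
    then show "eventually (\<lambda>y. cutoff \<rho> y * \<Theta> y = \<Theta> y) (nhds x)"
      by eventually_elim (simp add: cutoff_1)
  qed simp
  have "deriv (deriv (\<lambda>s. cutoff \<rho> s * \<Theta> s)) s = deriv (deriv \<Theta>) s"
  proof (rule deriv_cong_ev)
    show "eventually (\<lambda>x. deriv (\<lambda>s. cutoff \<rho> s * \<Theta> s) x = deriv \<Theta> x) (nhds s)"
      using ev by eventually_elim (rule 1)
  qed simp
  with 1[OF assms] show ?thesis by (simp add: radial_laplacian_def)
qed

lemma test_functions_product:
  assumes t: "0 < t1" "ereal t2 < T"
    and \<eta>: "smooth1 \<eta>" "\<And>t. t \<notin> {t1..t2} \<Longrightarrow> \<eta> t = 0"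
    and \<Theta>: "smooth1 \<Theta>" "\<And>x::'a. x \<notin> cball 0 R \<Longrightarrow> \<Theta> (x \<bullet> x) = 0"
  shows "(\<lambda>z :: real \<times> 'a::euclidean_space. \<eta> (fst z) * \<Theta> (snd z \<bullet> snd z)) \<in> test_functions (open_strip T)"
proof -
  define K where "K = {t1..t2} \<times> cball (0::'a) R"
  have K: "compact K" unfolding K_def by (intro compact_Times) auto
  define S where "S = {z :: real \<times> 'a. \<eta> (fst z) * \<Theta> (snd z \<bullet> snd z) \<noteq> 0}"
  have sub: "S \<subseteq> K"
    using \<eta>(2) \<Theta>(2) by (force simp: K_def S_def)
  then have cl: "closure S \<subseteq> K"
    using compact_imp_closed[OF K] by (rule closure_minimal)
  have "compact (closure S)"
    using bounded_subset[OF compact_imp_bounded[OF K] sub] by (simp add: compact_eq_bounded_closed bounded_closure)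
  moreover have "K \<subseteq> open_strip T" unfolding K_def by (rule slab_subset_strip[OF t])
  ultimately show ?thesis
    using cl smooth_fun_radial[OF \<eta>(1) \<Theta>(1)] by (auto simp: test_functions_def S_def)
qed

section \<open>Solutions supported in the cone\<close>

locale cone_solution =
  fixes p q r :: real and u0 u1 :: "'a::euclidean_space \<Rightarrow> real"
    and T :: ereal and u v :: "real \<Rightarrow> 'a \<Rightarrow> real"
  assumes p: "1 < p" and q: "1 < q" and r: "1 < r" and T: "0 < T"
    and solution: "cauchy_solution p q u0 u1 T u v"
    and regular: "energy_regular r T u v"
    and support: "supported_in_cone T u v"
begin

definition I :: "real set" where "I = {t. 0 < t \<and> ereal t < T}"

definition source :: "real \<Rightarrow> 'a \<Rightarrow> real" where
  "source t x = \<bar>v t x\<bar> powr p + \<bar>u t x\<bar> powr q"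

lemma I_subset: "I \<subseteq> time_interval T"
  by (auto simp: I_def time_interval_def)

lemma Lp: "t \<in> time_interval T \<Longrightarrow> u t \<in> Lp_space 2" "t \<in> time_interval T \<Longrightarrow> v t \<in> Lp_space r"
  using regular by (auto simp: energy_regular_def continuous_curve_def H1_space_def)

lemma measurable_uv:
  assumes "t \<in> time_interval T"
  shows "u t \<in> borel_measurable lborel" "v t \<in> borel_measurable lborel"
    "source t \<in> borel_measurable lborel"
proof -
  show *: "u t \<in> borel_measurable lborel" "v t \<in> borel_measurable lborel"
    using Lp[OF assms] by (auto simp: Lp_space_def)
  show "source t \<in> borel_measurable lborel"
    unfolding source_def[abs_def] using * by measurable
qed

lemma AE_support:
  assumes "t \<in> time_interval T"
  shows "AE x in lborel. norm x > t + 1 \<longrightarrow> u t x = 0"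
    "AE x in lborel. norm x > t + 1 \<longrightarrow> v t x = 0"
    "AE x in lborel. norm x > t + 1 \<longrightarrow> source t x = 0"
proof -
  have "AE x in lborel. norm x > t + 1 \<longrightarrow> u t x = 0 \<and> v t x = 0"
    using support assms by (simp add: supported_in_cone_def)
  then show "AE x in lborel. norm x > t + 1 \<longrightarrow> u t x = 0"
    "AE x in lborel. norm x > t + 1 \<longrightarrow> v t x = 0"
    "AE x in lborel. norm x > t + 1 \<longrightarrow> source t x = 0"
    by (auto simp: source_def elim!: eventually_mono)
qed

lemma continuous_pairing:
  assumes "continuous_on UNIV \<Theta>"
  shows "continuous_on (time_interval T) (pairing \<Theta> u)" "continuous_on (time_interval T) (pairing \<Theta> v)"
proof -
  show "continuous_on (time_interval T) (pairing \<Theta> v)"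
    using regular
    by (intro continuous_on_pairing[OF r Lp(2) _ AE_support(2) assms])
      (auto simp: energy_regular_def continuous_curve_def)
  have "((\<lambda>s. Lp_norm 2 (\<lambda>x. u s x - u t x)) \<longlongrightarrow> 0) (at t within time_interval T)"
    if "t \<in> time_interval T" for t
  proof (rule tendsto_sandwich[OF _ _ tendsto_const])
    show "((\<lambda>s. H1_norm (\<lambda>x. u s x - u t x)) \<longlongrightarrow> 0) (at t within time_interval T)"
      using regular that by (auto simp: energy_regular_def continuous_curve_def)
  qed (auto simp: Lp_norm_le_H1_norm Lp_norm_nonneg)
  then show "continuous_on (time_interval T) (pairing \<Theta> u)"
    by (intro continuous_on_pairing[OF _ Lp(1) _ AE_support(1) assms]) auto
qed

text \<open>Up to time \<open>t2\<close> the support satisfies |x|^2 <= (t2 + 1)^2, so a change of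
  the profile beyond that value is invisible. This admits profiles without compact support, such as
  1 and the eigenfunction.\<close>

lemma pairing_cutoff:
  fixes w :: "'a \<Rightarrow> real" and \<Theta> \<Theta>' :: "real \<Rightarrow> real"
  assumes t: "t \<in> time_interval T" "t \<le> t2" and m: "w \<in> borel_measurable lborel"
    and s: "AE x in lborel. norm x > t + 1 \<longrightarrow> w x = 0"
    and c: "continuous_on UNIV \<Theta>" "continuous_on UNIV \<Theta>'"
    and eq: "\<And>s. s \<le> (t2 + 1)\<^sup>2 \<Longrightarrow> \<Theta> s = \<Theta>' s"
  shows "(\<integral>(x::'a). w x * \<Theta> (x \<bullet> x) \<partial>lborel) = (\<integral>x. w x * \<Theta>' (x \<bullet> x) \<partial>lborel)"
proof (rule integral_cong_AE)
  have r: "(\<lambda>x::'a. \<Phi> (x \<bullet> x)) \<in> borel_measurable lborel" if "continuous_on UNIV \<Phi>" for \<Phi> :: "real \<Rightarrow> real"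
    using borel_measurable_continuous_onI[OF continuous_on_radial[OF that]] by simp
  show "(\<lambda>x. w x * \<Theta> (x \<bullet> x)) \<in> borel_measurable lborel" "(\<lambda>x. w x * \<Theta>' (x \<bullet> x)) \<in> borel_measurable lborel"
    using borel_measurable_times[OF m r[OF c(1)]] borel_measurable_times[OF m r[OF c(2)]] by auto
  show "AE x in lborel. w x * \<Theta> (x \<bullet> x) = w x * \<Theta>' (x \<bullet> x)"
    using s
  proof eventually_elim
    case (elim x)
    show ?case
    proof (cases "norm x > t + 1")
      case False
      then have "(norm x)\<^sup>2 \<le> (t2 + 1)\<^sup>2" using t by (intro power_mono) auto
      then show ?thesis using eq by (simp add: power2_norm_eq_inner)
    qed (use elim in simp)
  qed
qed

text \<open>The cutoff radius depends on the support of \<eta>, but after Fubini the cutoff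
  disappears slice by slice. The integrability in time must be recorded separately, because the
  pairing with the source is not known to be continuous.\<close>

lemma weak_equations:
  assumes \<Theta>: "smooth1 \<Theta>" and \<eta>: "test_on I \<eta>"
  shows "integrable lborel (\<lambda>t. \<eta> t * pairing \<Theta> source t)"
    and "(\<integral>t. deriv \<eta> t * pairing \<Theta> u t \<partial>lborel) = - (\<integral>t. \<eta> t * pairing \<Theta> v t \<partial>lborel)"
    and "(\<integral>t. deriv (deriv \<eta>) t * pairing \<Theta> u t \<partial>lborel)
          - (\<integral>t. \<eta> t * pairing (radial_laplacian (DIM('a)) \<Theta>) u t \<partial>lborel)
        = (\<integral>t. \<eta> t * pairing \<Theta> source t \<partial>lborel)"
proof -
  let ?n = "real DIM('a)"
  obtain t1 t2 where t12: "t1 \<le> t2" "{t1..t2} \<subseteq> I" "\<And>t. t \<notin> {t1..t2} \<Longrightarrow> \<eta> t = 0"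
    using \<eta> by (auto simp: test_on_def)
  have t: "0 < t1" "ereal t2 < T" using t12 by (auto simp: I_def)
  have s\<eta>: "smooth1 \<eta>" "smooth1 (deriv \<eta>)" "smooth1 (deriv (deriv \<eta>))"
    using \<eta> smooth1_deriv(2) by (auto simp: test_on_def)
  have z\<eta>: "deriv \<eta> t = 0" "deriv (deriv \<eta>) t = 0" if "t \<notin> {t1..t2}" for t
  proof -
    have *: "deriv \<eta> s = 0" if "s \<notin> {t1..t2}" for s
      by (rule deriv_zero_outside[of t1 t2 \<eta>, OF t12(3) that])
    show "deriv \<eta> t = 0" "deriv (deriv \<eta>) t = 0"
      using *[OF that] deriv_zero_outside[of t1 t2 "deriv \<eta>", OF * that] by auto
  qed
  \<comment> \<open>The additional 1 leaves room for the strict inequality in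
    \<open>radial_laplacian_cutoff\<close> on the whole support.\<close>
  define \<rho> where "\<rho> = (t2 + 1)\<^sup>2 + 1"
  define \<Phi> where "\<Phi> s = cutoff \<rho> s * \<Theta> s" for s
  have s\<Phi>: "smooth1 \<Phi>" unfolding \<Phi>_def[abs_def] by (rule smooth1_mult[OF smooth1_cutoff \<Theta>])
  have eq\<Phi>: "\<Phi> s = \<Theta> s" "radial_laplacian ?n \<Phi> s = radial_laplacian ?n \<Theta> s" if "s \<le> (t2 + 1)\<^sup>2" for s
    using that radial_laplacian_cutoff[of s \<rho> ?n \<Theta>] by (auto simp: \<Phi>_def[abs_def] \<rho>_def cutoff_1)
  define R where "R = sqrt (\<rho> + 1)"
  have \<rho>: "\<rho> \<ge> 1" by (simp add: \<rho>_def)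
  have far: "\<rho> + 1 < x \<bullet> x" if "x \<notin> cball (0::'a) R" for x
  proof -
    have "R < norm x" using that by simp
    then have "R\<^sup>2 < (norm x)\<^sup>2" using \<rho> by (intro power_strict_mono) (auto simp: R_def)
    then show ?thesis using \<rho> by (simp add: R_def power2_norm_eq_inner)
  qed
  have z\<Phi>: "\<Phi> s = 0" if "\<rho> + 1 \<le> s" for s
    using that by (simp add: \<Phi>_def cutoff_0)
  have zL: "radial_laplacian ?n \<Phi> s = 0" if "\<rho> + 1 < s" for s
  proof -
    have 1: "deriv \<Phi> x = 0" if "\<rho> + 1 < x" for x
    proof -
      have "eventually (\<lambda>y. \<rho> + 1 < y) (nhds x)"
        using that eventually_nhds_in_open[of "{\<rho> + 1<..}" x] by simp
      then have "eventually (\<lambda>y. \<Phi> y = 0) (nhds x)" by eventually_elim (simp add: z\<Phi>)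
      from deriv_cong_ev[OF this refl] show ?thesis by simp
    qed
    have "eventually (\<lambda>y. \<rho> + 1 < y) (nhds s)"
      using that eventually_nhds_in_open[of "{\<rho> + 1<..}" s] by simp
    then have "eventually (\<lambda>y. deriv \<Phi> y = 0) (nhds s)" by eventually_elim (simp add: 1)
    from deriv_cong_ev[OF this refl] 1[OF that] show ?thesis by (simp add: radial_laplacian_def)
  qed
  have cL: "continuous_on UNIV (radial_laplacian ?n \<Psi>)" if "smooth1 \<Psi>" for \<Psi>
    unfolding radial_laplacian_def[abs_def]
    by (intro continuous_intros smooth1_continuous smooth1_deriv(2) that)
  have c\<Theta>: "continuous_on UNIV \<Theta>" and c\<Phi>: "continuous_on UNIV \<Phi>"
    using smooth1_continuous \<Theta> s\<Phi> by auto
  have c\<eta>: "continuous_on UNIV \<eta>" "continuous_on UNIV (deriv \<eta>)" "continuous_on UNIV (deriv (deriv \<eta>))"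
    using s\<eta> smooth1_continuous by auto
  have zr: "\<Phi> (x \<bullet> x) = 0" "radial_laplacian ?n \<Phi> (x \<bullet> x) = 0" if "x \<notin> cball (0::'a) R" for x
    using far[OF that] z\<Phi> zL by auto
  have tI: "t \<in> time_interval T" "t \<le> t2" if "t \<in> {t1..t2}" for t
    using that t12(2) I_subset by auto
  have loc: "locally_integrable_on (open_strip T) (\<lambda>(t, x). u t x)"
    "locally_integrable_on (open_strip T) (\<lambda>(t, x). v t x)"
    "locally_integrable_on (open_strip T) (\<lambda>(t, x). source t x)"
    using solution by (auto simp: cauchy_solution_def weak_partial_on_def distributional_wave_eq_def source_def)
  \<comment> \<open>The factor in time confines t to [t1, t2], where measurability and support of
    the slices are available; elsewhere both sides are 0.\<close>
  have cut_all: "\<eta>' t * (\<integral>x. u t x * \<Phi> (x \<bullet> x) \<partial>lborel) = \<eta>' t * pairing \<Theta> u t \<and>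
      \<eta>' t * (\<integral>x. v t x * \<Phi> (x \<bullet> x) \<partial>lborel) = \<eta>' t * pairing \<Theta> v t \<and>
      \<eta>' t * (\<integral>x. source t x * \<Phi> (x \<bullet> x) \<partial>lborel) = \<eta>' t * pairing \<Theta> source t \<and>
      \<eta>' t * (\<integral>x. u t x * radial_laplacian ?n \<Phi> (x \<bullet> x) \<partial>lborel) = \<eta>' t * pairing (radial_laplacian ?n \<Theta>) u t"
    if "\<And>t. t \<notin> {t1..t2} \<Longrightarrow> \<eta>' t = 0" for \<eta>' t
  proof (cases "t \<in> {t1..t2}")
    case True
    note tt = tI[OF True]
    note m = measurable_uv[OF tt(1)] and s = AE_support[OF tt(1)]
    show ?thesis
      using pairing_cutoff[OF tt m(1) s(1) c\<Phi> c\<Theta> eq\<Phi>(1)]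
        pairing_cutoff[OF tt m(2) s(2) c\<Phi> c\<Theta> eq\<Phi>(1)]
        pairing_cutoff[OF tt m(3) s(3) c\<Phi> c\<Theta> eq\<Phi>(1)]
        pairing_cutoff[OF tt m(1) s(1) cL[OF s\<Phi>] cL[OF \<Theta>] eq\<Phi>(2)]
      by (simp add: pairing_def)
  qed (use that in simp)
  have cut0: "\<eta> t * (\<integral>x. v t x * \<Phi> (x \<bullet> x) \<partial>lborel) = \<eta> t * pairing \<Theta> v t"
    "\<eta> t * (\<integral>x. source t x * \<Phi> (x \<bullet> x) \<partial>lborel) = \<eta> t * pairing \<Theta> source t"
    "\<eta> t * (\<integral>x. u t x * radial_laplacian ?n \<Phi> (x \<bullet> x) \<partial>lborel)
      = \<eta> t * pairing (radial_laplacian ?n \<Theta>) u t" for t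
    using cut_all[of \<eta> t] t12(3) by blast+
  have cut12: "deriv \<eta> t * (\<integral>x. u t x * \<Phi> (x \<bullet> x) \<partial>lborel) = deriv \<eta> t * pairing \<Theta> u t"
    "deriv (deriv \<eta>) t * (\<integral>x. u t x * \<Phi> (x \<bullet> x) \<partial>lborel) = deriv (deriv \<eta>) t * pairing \<Theta> u t" for t
    using cut_all[of "deriv \<eta>" t] cut_all[of "deriv (deriv \<eta>)" t] z\<eta> by blast+
  show "integrable lborel (\<lambda>t. \<eta> t * pairing \<Theta> source t)"
    using integral_product_test(1)[where R = R, OF loc(3) t c\<eta>(1) t12(3) continuous_on_radial[OF c\<Phi>] zr(1)]
    by (simp add: cut0(2))
  define \<phi> where "\<phi> z = \<eta> (fst z) * \<Phi> (snd z \<bullet> snd z)" for z :: "real \<times> 'a"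
  have test: "\<phi> \<in> test_functions (open_strip T)"
    unfolding \<phi>_def[abs_def]
    by (rule test_functions_product[where R = R, OF t s\<eta>(1) t12(3) s\<Phi> zr(1)])
  have "(\<integral>z. (case z of (t, x) \<Rightarrow> u t x) * partial_deriv (1, 0) \<phi> z \<partial>lborel)
      = - (\<integral>z. (case z of (t, x) \<Rightarrow> v t x) * \<phi> z \<partial>lborel)"
    using solution test by (auto simp: cauchy_solution_def weak_partial_on_def)
  then show "(\<integral>t. deriv \<eta> t * pairing \<Theta> u t \<partial>lborel) = - (\<integral>t. \<eta> t * pairing \<Theta> v t \<partial>lborel)"
    using integral_product_test(2)[where R = R, OF loc(1) t c\<eta>(2) z\<eta>(1) continuous_on_radial[OF c\<Phi>] zr(1)]
      integral_product_test(2)[where R = R, OF loc(2) t c\<eta>(1) t12(3) continuous_on_radial[OF c\<Phi>] zr(1)]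
    by (simp add: \<phi>_def[abs_def] partial_deriv_time_radial[OF s\<eta>(1) s\<Phi>] cut12(1) cut0(1))
  have "(\<integral>z. (case z of (t, x) \<Rightarrow> u t x) * wave_op \<phi> z \<partial>lborel)
      = (\<integral>z. (case z of (t, x) \<Rightarrow> source t x) * \<phi> z \<partial>lborel)"
    using solution test by (auto simp: cauchy_solution_def distributional_wave_eq_def source_def)
  also have "\<dots> = (\<integral>t. \<eta> t * pairing \<Theta> source t \<partial>lborel)"
    using integral_product_test(2)[where R = R, OF loc(3) t c\<eta>(1) t12(3) continuous_on_radial[OF c\<Phi>] zr(1)]
    by (simp add: \<phi>_def cut0(2))
  finally have W: "(\<integral>z. (case z of (t, x) \<Rightarrow> u t x) * wave_op \<phi> z \<partial>lborel)
      = (\<integral>t. \<eta> t * pairing \<Theta> source t \<partial>lborel)" .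
  have "(\<integral>z. (case z of (t, x) \<Rightarrow> u t x) * wave_op \<phi> z \<partial>lborel)
      = (\<integral>z. (case z of (t, x) \<Rightarrow> u t x) * (deriv (deriv \<eta>) (fst z) * \<Phi> (snd z \<bullet> snd z)) \<partial>lborel)
        - (\<integral>z. (case z of (t, x) \<Rightarrow> u t x) * (\<eta> (fst z) * radial_laplacian ?n \<Phi> (snd z \<bullet> snd z)) \<partial>lborel)"
    unfolding \<phi>_def wave_op_radial[OF s\<eta>(1) s\<Phi>] right_diff_distrib
    by (intro Bochner_Integration.integral_diff
        integral_product_test(3)[where R = R, OF loc(1) t c\<eta>(3) z\<eta>(2) continuous_on_radial[OF c\<Phi>] zr(1)]
        integral_product_test(3)[where R = R, OF loc(1) t c\<eta>(1) t12(3) continuous_on_radial[OF cL[OF s\<Phi>]] zr(2)])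
  also have "\<dots> = (\<integral>t. deriv (deriv \<eta>) t * pairing \<Theta> u t \<partial>lborel)
          - (\<integral>t. \<eta> t * pairing (radial_laplacian ?n \<Theta>) u t \<partial>lborel)"
    using integral_product_test(2)[where R = R, OF loc(1) t c\<eta>(3) z\<eta>(2) continuous_on_radial[OF c\<Phi>] zr(1)]
        integral_product_test(2)[where R = R, OF loc(1) t c\<eta>(1) t12(3) continuous_on_radial[OF cL[OF s\<Phi>]] zr(2)]
    by (simp add: cut12(2) cut0(3))
  finally show "(\<integral>t. deriv (deriv \<eta>) t * pairing \<Theta> u t \<partial>lborel)
          - (\<integral>t. \<eta> t * pairing (radial_laplacian (DIM('a)) \<Theta>) u t \<partial>lborel)
        = (\<integral>t. \<eta> t * pairing \<Theta> source t \<partial>lborel)"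
    using W by simp
qed

end

section \<open>Estimates for the weight and for balls\<close>

lemma Lp_norm_powr:
  assumes "0 < r"
  shows "Lp_norm r f powr r = (\<integral>x. \<bar>f x\<bar> powr r \<partial>lborel)"
  using assms by (simp add: Lp_norm_def powr_powr)

lemma Lp_norm_le:
  assumes "0 < r" "(\<integral>x. \<bar>f x\<bar> powr r \<partial>lborel) \<le> B powr r" "0 \<le> B"
  shows "Lp_norm r f \<le> B"
proof -
  have "Lp_norm r f \<le> (B powr r) powr (1 / r)"
    unfolding Lp_norm_def using assms by (intro powr_mono2) auto
  then show ?thesis using assms by (simp add: powr_powr)
qed

text \<open>In \<open>radial_weight_cone\<close> half of the exponential stays in the variable |x|.
  Its s-th power still grows in |x|, so \<open>integral_exp_norm_cball\<close> costs only (1+t)^m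
  and the exponent is m/s - m/2.\<close>

lemma Lp_norm_radial_weight:
  assumes s: "0 < s" and m: "1 \<le> m" "DIM('a::euclidean_space) = Suc m"
  obtains C where "C > 0" "\<And>t. 0 \<le> t \<Longrightarrow>
    Lp_norm s (\<lambda>x::'a. indicator (cball 0 (t + 1)) x * radial_weight m (x \<bullet> x))
      \<le> C * exp t * (1 + t) powr (real m / s - real m / 2)"
proof -
  obtain C1 where C1: "C1 > 0" "\<And>r t. 0 \<le> r \<Longrightarrow> 0 \<le> t \<Longrightarrow> r \<le> t + 1 \<Longrightarrow>
    radial_weight m (r\<^sup>2) \<le> C1 * (1 + t) powr (- real m / 2) * exp ((r + t) / 2)"
    using radial_weight_cone[OF m(1)] by blast
  obtain C2 where C2: "C2 > 0" "\<And>R. 0 \<le> R \<Longrightarrow>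
    (\<integral>(x::'a). indicator (cball 0 R) x * exp (s / 2 * norm x) \<partial>lborel) \<le> C2 * exp (s / 2 * R) * (1 + R) ^ m"
    using integral_exp_norm_cball[of "s / 2" m] s m(2) by auto
  define C3 where "C3 = C2 * exp (s / 2) * 2 powr real m"
  define C where "C = C1 * C3 powr (1 / s)"
  have C3: "C3 > 0" using C2 by (simp add: C3_def)
  have C: "C > 0" using C1 C3 by (simp add: C_def)
  have "Lp_norm s (\<lambda>x::'a. indicator (cball 0 (t + 1)) x * radial_weight m (x \<bullet> x))
      \<le> C * exp t * (1 + t) powr (real m / s - real m / 2)" if t: "0 \<le> t" for t
  proof (rule Lp_norm_le[OF s])
    define w where "w x = radial_weight m (x \<bullet> x)" for x :: 'a
    define D where "D = C1 * (1 + t) powr (- real m / 2) * exp (t / 2)"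
    have D: "D \<ge> 0" using C1 by (simp add: D_def)
    have cw: "continuous_on UNIV w"
      unfolding w_def by (rule continuous_on_radial[OF smooth1_continuous[OF smooth1_radial_weight]])
    have "\<bar>indicator (cball 0 (t + 1)) x * w x\<bar> powr s
        \<le> D powr s * (indicator (cball 0 (t + 1)) x * exp (s / 2 * norm x))" for x
    proof (cases "x \<in> cball 0 (t + 1)")
      case True
      have "w x \<le> D * exp (norm x / 2)"
        using C1(2)[of "norm x" t] t True
        by (simp add: w_def D_def power2_norm_eq_inner add_divide_distrib exp_add mult_ac)
      moreover have "1 \<le> w x" by (simp add: w_def radial_weight_ge_1)
      ultimately have "w x powr s \<le> (D * exp (norm x / 2)) powr s"
        using s by (intro powr_mono2) auto
      also have "\<dots> = D powr s * exp (s / 2 * norm x)"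
        using D by (simp add: powr_mult exp_powr_real mult_ac)
      finally show ?thesis using True \<open>1 \<le> w x\<close> by simp
    qed simp
    then have "(\<integral>x. \<bar>indicator (cball 0 (t + 1)) x * w x\<bar> powr s \<partial>lborel)
        \<le> (\<integral>(x::'a). D powr s * (indicator (cball 0 (t + 1)) x * exp (s / 2 * norm x)) \<partial>lborel)"
      using s by (intro Bochner_Integration.integral_mono integrable_powr_on_cball(2)[OF cw] integrable_mult_right
          integrable_on_cball continuous_intros) auto
    also have "\<dots> = D powr s * (\<integral>(x::'a). indicator (cball 0 (t + 1)) x * exp (s / 2 * norm x) \<partial>lborel)"
      by simp
    also have "\<dots> \<le> D powr s * (C2 * exp (s / 2 * (t + 1)) * (1 + (t + 1)) ^ m)"
      using t by (intro mult_left_mono C2) auto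
    also have "\<dots> \<le> D powr s * (C2 * exp (s / 2 * (t + 1)) * (2 * (1 + t)) powr real m)"
      using t C2(1) by (intro mult_left_mono) (auto simp: powr_realpow intro!: power_mono)
    also have "\<dots> = D powr s * (C3 * exp (s * t / 2) * (1 + t) powr real m)"
    proof -
      have e: "exp (s / 2 * (t + 1)) = exp (s * t / 2) * exp (s / 2)"
        unfolding exp_add[symmetric] by (simp add: field_simps)
      show ?thesis unfolding e powr_mult C3_def by (simp only: mult_ac)
    qed
    also have "\<dots> = (C * exp t * (1 + t) powr (real m / s - real m / 2)) powr s"
    proof -
      have 1: "D powr s = C1 powr s * (1 + t) powr (- real m / 2 * s) * exp (s * t / 2)"
        using t C1(1) by (simp add: D_def powr_mult powr_powr exp_powr_real mult.commute)
      have 2: "(C * exp t * (1 + t) powr (real m / s - real m / 2)) powr s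
          = C1 powr s * C3 * exp (s * t) * (1 + t) powr ((real m / s - real m / 2) * s)"
        using t C1(1) C3 s by (simp add: C_def powr_mult powr_powr exp_powr_real mult.commute)
      have 3: "(real m / s - real m / 2) * s = - real m / 2 * s + real m"
        using s by (simp add: field_simps)
      have 4: "exp (s * t) = exp (s * t / 2) * exp (s * t / 2)"
        unfolding exp_add[symmetric] by simp
      show ?thesis unfolding 1 2 3 4 powr_add by (simp only: mult_ac)
    qed
    finally show "(\<integral>(x::'a). \<bar>indicator (cball 0 (t + 1)) x * radial_weight m (x \<bullet> x)\<bar> powr s \<partial>lborel)
      \<le> (C * exp t * (1 + t) powr (real m / s - real m / 2)) powr s"
      by (simp add: w_def)
  qed (use C in auto)
  with C that show ?thesis by blast
qed

lemma Lp_norm_indicator_cball: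
  assumes "0 < s" "0 \<le> R"
  shows "Lp_norm s (indicator (cball (0::'a::euclidean_space) R))
    = (unit_ball_vol (real DIM('a)) * R ^ DIM('a)) powr (1 / s)"
proof -
  have "(\<lambda>x::'a. \<bar>indicator (cball 0 R) x :: real\<bar> powr s) = indicator (cball 0 R)"
    by (auto simp: indicator_def fun_eq_iff)
  then show ?thesis
    using content_cball[of R "0::'a"] assms(2) by (simp add: Lp_norm_def)
qed

section \<open>Lower bounds for the source term\<close>

context cone_solution
begin

lemma weak_ge_pairing_u:
  assumes "smooth1 \<Theta>"
  shows "weak_ge I (pairing \<Theta> u) (pairing \<Theta> v)"
  unfolding weak_ge_def
  using weak_equations(2)[OF assms] continuous_pairing[OF smooth1_continuous[OF assms]]
    continuous_on_subset[OF _ I_subset] by auto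

text \<open>A single ball of radius \<open>t2 + 1\<close> contains the supports of all slices up to
  \<open>t2\<close>.\<close>

lemma AE_source_integrable:
  assumes "0 < t1" "ereal t2 < T" "{t1..t2} \<subseteq> I"
  shows "AE t in lborel. t \<in> {t1..t2} \<longrightarrow> integrable lborel (source t)"
proof -
  have loc: "locally_integrable_on (open_strip T) (\<lambda>(t, x). source t x)"
    using solution by (auto simp: cauchy_solution_def distributional_wave_eq_def source_def)
  from AE_slice_integrable[OF loc assms(1,2), of "t2 + 1"]
  show ?thesis
  proof eventually_elim
    case (elim t)
    show ?case
    proof
      assume t: "t \<in> {t1..t2}"
      then have tI: "t \<in> time_interval T" using assms(3) I_subset by auto
      have i: "integrable lborel (\<lambda>x. indicator (cball 0 (t2 + 1)) x * source t x)"
        using elim t by simp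
      have "AE x in lborel. indicator (cball 0 (t2 + 1)) x * source t x = source t x"
        using AE_support(3)[OF tI] by eventually_elim (use t in \<open>auto simp: indicator_def\<close>)
      then show "integrable lborel (source t)"
        by (rule integrable_cong_AE_imp[OF i measurable_uv(3)[OF tI]])
    qed
  qed
qed

text \<open>The bound is required only where the slice of the source is integrable. At the
  exceptional times the Bochner integral may be the default 0, but these form a null set and do not
  affect the time integral.\<close>

lemma weak_ge_pairing_v:
  assumes \<Theta>: "smooth1 \<Theta>" and Y: "continuous_on I Y"
    and le: "\<And>t. t \<in> I \<Longrightarrow> integrable lborel (source t) \<Longrightarrow>
      Y t \<le> pairing (radial_laplacian (DIM('a)) \<Theta>) u t + pairing \<Theta> source t"
  shows "weak_ge I (pairing \<Theta> v) Y"
  unfolding weak_ge_def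
proof (intro conjI allI impI)
  let ?L = "radial_laplacian (real DIM('a)) \<Theta>"
  show "continuous_on I (pairing \<Theta> v)"
    using continuous_pairing(2)[OF smooth1_continuous[OF \<Theta>]] I_subset by (rule continuous_on_subset)
  show "continuous_on I Y" by fact
  fix \<eta> assume \<eta>: "test_on I \<eta> \<and> (\<forall>x. 0 \<le> \<eta> x)"
  then obtain t1 t2 where t12: "t1 \<le> t2" "{t1..t2} \<subseteq> I" "\<And>t. t \<notin> {t1..t2} \<Longrightarrow> \<eta> t = 0"
    by (auto simp: test_on_def)
  have t: "0 < t1" "ereal t2 < T" using t12 by (auto simp: I_def)
  have "continuous_on UNIV ?L"
    unfolding radial_laplacian_def[abs_def]
    by (intro continuous_intros smooth1_continuous smooth1_deriv(2) \<Theta>)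
  then have cL: "continuous_on I (pairing ?L u)"
    using continuous_on_subset[OF continuous_pairing(1) I_subset] by blast
  have iL: "integrable lborel (\<lambda>t. \<eta> t * pairing ?L u t)"
    using \<eta> cL by (intro integrable_test_on) auto
  have iS: "integrable lborel (\<lambda>t. \<eta> t * pairing \<Theta> source t)"
    using weak_equations(1)[OF \<Theta>] \<eta> by blast
  have "(\<integral>t. \<eta> t * Y t \<partial>lborel) \<le> (\<integral>t. \<eta> t * pairing ?L u t + \<eta> t * pairing \<Theta> source t \<partial>lborel)"
  proof (rule integral_mono_AE)
    show "AE t in lborel. \<eta> t * Y t \<le> \<eta> t * pairing ?L u t + \<eta> t * pairing \<Theta> source t"
      using AE_source_integrable[OF t t12(2)]
    proof eventually_elim
      case (elim t)
      show ?case
      proof (cases "t \<in> {t1..t2}")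
        case True
        with elim t12(2) have "Y t \<le> pairing ?L u t + pairing \<Theta> source t" by (intro le) auto
        then show ?thesis using \<eta> by (simp add: mult_left_mono flip: distrib_left)
      qed (simp add: t12(3))
    qed
  qed (use \<eta> Y iL iS integrable_test_on in auto)
  also have "\<dots> = (\<integral>t. \<eta> t * pairing ?L u t \<partial>lborel) + (\<integral>t. \<eta> t * pairing \<Theta> source t \<partial>lborel)"
    using iL iS by simp
  also have "\<dots> = (\<integral>t. deriv (deriv \<eta>) t * pairing \<Theta> u t \<partial>lborel)"
    using weak_equations(3)[OF \<Theta>] \<eta> by fastforce
  \<comment> \<open>The first equation is an identity, so it may be tested with \<eta>', which has
    no sign.\<close>
  also have "\<dots> = - (\<integral>t. deriv \<eta> t * pairing \<Theta> v t \<partial>lborel)"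
    using weak_equations(2)[OF \<Theta> test_on_deriv] \<eta> by blast
  finally show "(\<integral>t. deriv \<eta> t * pairing \<Theta> v t \<partial>lborel) \<le> - (\<integral>t. \<eta> t * Y t \<partial>lborel)" by simp
qed

lemma source_powr_integrable:
  assumes "t \<in> I" "integrable lborel (source t)"
  shows "integrable lborel (\<lambda>x. \<bar>v t x\<bar> powr p)" "integrable lborel (\<lambda>x. \<bar>u t x\<bar> powr q)"
proof -
  have tI: "t \<in> time_interval T" using assms(1) I_subset by auto
  show "integrable lborel (\<lambda>x. \<bar>v t x\<bar> powr p)"
    by (rule Bochner_Integration.integrable_bound[OF assms(2)])
      (use measurable_uv[OF tI] in \<open>auto simp: source_def\<close>)
  show "integrable lborel (\<lambda>x. \<bar>u t x\<bar> powr q)"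
    by (rule Bochner_Integration.integrable_bound[OF assms(2)])
      (use measurable_uv[OF tI] in \<open>auto simp: source_def\<close>)
qed

text \<open>With \<open>a\<close> and \<open>b\<close> the pairings of \<open>u\<close> and \<open>v\<close> with the weight, \<open>a' = b\<close> and \<open>b' \<ge> a\<close>, so
  \<open>exp (-t) (a + b)\<close> and then \<open>exp t b - c exp (2 t) / 2\<close> with \<open>c = a 0 + b 0\<close> are nondecreasing.\<close>

lemma pairing_weight_lower_bound:
  assumes m: "DIM('a) = Suc m" and init: "0 \<le> pairing (radial_weight m) u 0" "0 \<le> pairing (radial_weight m) v 0"
    and t: "t \<in> I"
  shows "pairing (radial_weight m) v 0 / 2 * exp t \<le> pairing (radial_weight m) v t"
proof -
  define a where "a = pairing (radial_weight m) u"
  define b where "b = pairing (radial_weight m) v"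
  define c where "c = a 0 + b 0"
  have L: "radial_laplacian (real DIM('a)) (radial_weight m) = radial_weight m"
    using radial_laplacian_weight[of m] unfolding m by (intro ext)
  have w0: "0 \<le> radial_weight m (x \<bullet> x)" for x :: 'a
    using radial_weight_ge_1[of "x \<bullet> x" m] by simp
  note cw = smooth1_continuous[OF smooth1_radial_weight]
  have ca: "continuous_on (time_interval T) a" and cb: "continuous_on (time_interval T) b"
    unfolding a_def b_def by (rule continuous_pairing[OF cw])+
  have sub: "{0..s} \<subseteq> time_interval T" "{0<..<s} \<subseteq> I" if "s \<in> I" for s
  proof -
    have "ereal x < T" if "x \<le> s" for x
      using that \<open>s \<in> I\<close> by (intro le_less_trans[of "ereal x" "ereal s"]) (auto simp: I_def)
    then show "{0..s} \<subseteq> time_interval T" "{0<..<s} \<subseteq> I"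
      by (auto simp: I_def time_interval_def)
  qed
  have ab: "weak_ge I a b"
    unfolding a_def b_def by (rule weak_ge_pairing_u[OF smooth1_radial_weight])
  have ba: "weak_ge I b a"
    unfolding b_def
  proof (rule weak_ge_pairing_v[OF smooth1_radial_weight])
    show "continuous_on I a" by (rule continuous_on_subset[OF ca I_subset])
    fix t
    have "0 \<le> pairing (radial_weight m) source t"
      unfolding pairing_def source_def using w0 by (intro Bochner_Integration.integral_nonneg) auto
    then show "a t \<le> pairing (radial_laplacian (real DIM('a)) (radial_weight m)) u t
        + pairing (radial_weight m) source t"
      unfolding L by (simp add: a_def)
  qed
  have de: "deriv (\<lambda>x. exp (k * x)) x = k * exp (k * x)" for k x :: real
    by (rule DERIV_imp_deriv) (auto intro!: derivative_eq_intros)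
  have sum: "c * exp s \<le> a s + b s" if s: "s \<in> I" for s
  proof -
    have "weak_ge I (\<lambda>x. exp (-1 * x) * (a x + b x))
        (\<lambda>x. exp (-1 * x) * (b x + a x) + deriv (\<lambda>x. exp (-1 * x)) x * (a x + b x))"
      by (rule weak_ge_mult[OF weak_ge_add[OF ab ba] smooth1_exp_mult]) simp
    then have "weak_ge I (\<lambda>x. exp (-1 * x) * (a x + b x)) (\<lambda>x. 0)"
      unfolding de by (simp add: algebra_simps)
    from weak_ge_subset[OF this sub(2)[OF s]]
    have g: "weak_ge {0<..<s} (\<lambda>x. exp (-1 * x) * (a x + b x)) (\<lambda>x. 0)" .
    have "continuous_on {0..s} (\<lambda>x. exp (-1 * x) * (a x + b x))"
      by (intro continuous_intros continuous_on_subset[OF ca sub(1)[OF s]]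
          continuous_on_subset[OF cb sub(1)[OF s]])
    from weak_ge_Icc[OF _ this g] s have "exp (-1 * 0) * (a 0 + b 0) \<le> exp (-1 * s) * (a s + b s)"
      by (simp add: I_def)
    then have "c * exp s \<le> exp (- s) * (a s + b s) * exp s"
      by (intro mult_right_mono) (auto simp: c_def)
    also have "\<dots> = a s + b s" by (simp add: exp_minus)
    finally show ?thesis .
  qed
  \<comment> \<open>Inserting a >= c e^x - b into b' >= a eliminates \<open>a\<close>; then b' + b
    >= c e^x is integrated with the factor e^x.\<close>
  have "weak_ge I b (\<lambda>x. c * exp x - b x)"
  proof (rule weak_ge_mono[OF ba])
    show "continuous_on I (\<lambda>x. c * exp x - b x)"
      by (intro continuous_intros continuous_on_subset[OF cb I_subset])
    fix x assume "x \<in> I"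
    from sum[OF this] show "c * exp x - b x \<le> a x" by simp
  qed
  from weak_ge_mult[OF this smooth1_exp_mult, of 1]
  have e: "weak_ge I (\<lambda>x. exp (1 * x) * b x) (\<lambda>x. c * exp (2 * x))"
    unfolding de by (simp add: algebra_simps flip: exp_add)
  have "exp (1 * 0) * b 0 - c * exp (2 * 0) / 2 \<le> exp (1 * t) * b t - c * exp (2 * t) / 2"
  proof (rule weak_ge_compare[OF _ _ weak_ge_subset[OF e sub(2)[OF t]], where Z = "\<lambda>x. c * exp (2 * x) / 2"])
    show "continuous_on {0..t} (\<lambda>x. exp (1 * x) * b x)"
      by (intro continuous_intros continuous_on_subset[OF cb sub(1)[OF t]])
    show "((\<lambda>x. c * exp (2 * x) / 2) has_real_derivative c * exp (2 * x)) (at x)" for x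
      by (auto intro!: derivative_eq_intros)
  qed (use t in \<open>auto simp: I_def intro!: continuous_intros\<close>)
  then have "b 0 + c * ((exp (2 * t) - 1) / 2) \<le> exp t * b t"
    by (simp add: field_simps)
  \<comment> \<open>Here c >= b 0 because a 0 >= 0. The term \<open>b 0\<close> on the left then
    outweighs the loss - b 0 / 2, which leaves b 0 e^(2t) / 2.\<close>
  moreover have "b 0 * ((exp (2 * t) - 1) / 2) \<le> c * ((exp (2 * t) - 1) / 2)"
    using init t by (intro mult_right_mono) (auto simp: c_def a_def b_def I_def)
  ultimately have "b 0 + b 0 * ((exp (2 * t) - 1) / 2) \<le> exp t * b t" by linarith
  then have "b 0 / 2 * exp (2 * t) \<le> exp t * b t"
    using init by (simp add: b_def field_simps)
  moreover have "b 0 / 2 * exp (2 * t) = exp t * (b 0 / 2 * exp t)"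
  proof -
    have "exp (2 * t) = exp t * exp t" by (simp flip: exp_add)
    then show ?thesis by simp
  qed
  ultimately have "exp t * (b 0 / 2 * exp t) \<le> exp t * b t" by (simp only:)
  then have "b 0 / 2 * exp t \<le> b t" by (rule mult_left_le_imp_le) simp
  then show ?thesis by (simp add: b_def)
qed

lemma pairing_one_source:
  assumes "t \<in> I" "integrable lborel (source t)"
  shows "(\<integral>x. \<bar>v t x\<bar> powr p \<partial>lborel) \<le> pairing (\<lambda>_. 1) source t"
    "(\<integral>x. \<bar>u t x\<bar> powr q \<partial>lborel) \<le> pairing (\<lambda>_. 1) source t"
  using source_powr_integrable[OF assms] by (auto simp: pairing_def source_def)

text \<open>Hoelder against the weight, with the factor exp t cancelling on both sides. Raising to
  the power p turns the exponent of the weight norm into -p (m(p-1)/p - m/2) = m(1 - p/2).\<close>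

lemma source_lower_bound_v:
  assumes m: "DIM('a) = Suc m" and t: "t \<in> I" "integrable lborel (source t)" and C: "0 < C"
    and w: "Lp_norm (p / (p - 1)) (\<lambda>x::'a. indicator (cball 0 (t + 1)) x * radial_weight m (x \<bullet> x))
        \<le> C * exp t * (1 + t) powr (real m / (p / (p - 1)) - real m / 2)"
    and b: "0 \<le> B" "B * exp t \<le> pairing (radial_weight m) v t"
  shows "(B / C) powr p * (1 + t) powr (real m * (1 - p / 2)) \<le> pairing (\<lambda>_. 1) source t"
proof -
  define \<gamma> where "\<gamma> = real m / (p / (p - 1)) - real m / 2"
  have tI: "t \<in> time_interval T" using t I_subset by auto
  have t0: "0 < t" using t by (simp add: I_def)
  have "v t \<in> Lp_space p"
    using measurable_uv(2)[OF tI] source_powr_integrable(1)[OF t] by (simp add: Lp_space_def)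
  from pairing_Lp_bound(2)[OF p this AE_support(2)[OF tI]
      continuous_on_radial[OF smooth1_continuous[OF smooth1_radial_weight[of m]]]]
  have "pairing (radial_weight m) v t \<le> Lp_norm p (v t) *
      Lp_norm (p / (p - 1)) (\<lambda>x::'a. indicator (cball 0 (t + 1)) x * radial_weight m (x \<bullet> x))"
    unfolding pairing_def by linarith
  also have "\<dots> \<le> Lp_norm p (v t) * (C * exp t * (1 + t) powr \<gamma>)"
    unfolding \<gamma>_def by (intro mult_left_mono w Lp_norm_nonneg)
  also have "\<dots> = (Lp_norm p (v t) * C * (1 + t) powr \<gamma>) * exp t"
    by (simp only: mult_ac)
  finally have "B * exp t \<le> (Lp_norm p (v t) * C * (1 + t) powr \<gamma>) * exp t"
    using b(2) by linarith
  then have "B \<le> Lp_norm p (v t) * C * (1 + t) powr \<gamma>"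
    by (rule mult_right_le_imp_le) simp
  then have "B / C * (1 + t) powr (- \<gamma>) \<le> Lp_norm p (v t)"
    using C t0 by (simp add: powr_minus field_simps)
  then have "(B / C * (1 + t) powr (- \<gamma>)) powr p \<le> Lp_norm p (v t) powr p"
    using p b(1) C t0 by (intro powr_mono2) auto
  also have "\<dots> \<le> pairing (\<lambda>_. 1) source t"
    using pairing_one_source(1)[OF t] p by (simp add: Lp_norm_powr)
  also have "(B / C * (1 + t) powr (- \<gamma>)) powr p = (B / C) powr p * (1 + t) powr (- \<gamma> * p)"
    by (simp only: powr_mult powr_powr)
  also have "- \<gamma> * p = real m * (1 - p / 2)"
    using p by (simp add: \<gamma>_def field_simps)
  finally show ?thesis .
qed

text \<open>Hoelder against the indicator of the ball of radius t + 1; its volume enters with the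
  power q/q' = q - 1, where q' is the conjugate exponent.\<close>

lemma source_lower_bound_u:
  assumes t: "t \<in> I" "integrable lborel (source t)"
  shows "unit_ball_vol (real DIM('a)) powr (- (q - 1)) * (1 + t) powr (- (real DIM('a) * (q - 1)))
      * \<bar>pairing (\<lambda>_. 1) u t\<bar> powr q \<le> pairing (\<lambda>_. 1) source t"
proof -
  let ?n = "DIM('a)"
  define \<omega> where "\<omega> = unit_ball_vol (real ?n)"
  have \<omega>: "\<omega> > 0" by (simp add: \<omega>_def)
  have tI: "t \<in> time_interval T" using t I_subset by auto
  have t0: "0 < t" using t by (simp add: I_def)
  have "u t \<in> Lp_space q"
    using measurable_uv(1)[OF tI] source_powr_integrable(2)[OF t] by (simp add: Lp_space_def)
  from pairing_Lp_bound(2)[OF q this AE_support(1)[OF tI], of "\<lambda>_. 1"]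
  have "\<bar>pairing (\<lambda>_. 1) u t\<bar> \<le> Lp_norm q (u t) * Lp_norm (q / (q - 1)) (indicator (cball (0::'a) (t + 1)))"
    by (simp add: pairing_def)
  also have "\<dots> = Lp_norm q (u t) * (\<omega> * (1 + t) powr real ?n) powr (1 / (q / (q - 1)))"
    using q t0 by (subst Lp_norm_indicator_cball) (auto simp: \<omega>_def powr_realpow add.commute)
  finally have "\<bar>pairing (\<lambda>_. 1) u t\<bar> powr q
      \<le> (Lp_norm q (u t) * (\<omega> * (1 + t) powr real ?n) powr (1 / (q / (q - 1)))) powr q"
    using q by (intro powr_mono2) auto
  also have "\<dots> = Lp_norm q (u t) powr q * (\<omega> * (1 + t) powr real ?n) powr (q - 1)"
    using q \<omega> by (simp add: powr_mult powr_powr Lp_norm_nonneg)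
  also have "\<dots> = (\<integral>x. \<bar>u t x\<bar> powr q \<partial>lborel) * (\<omega> powr (q - 1) * (1 + t) powr (real ?n * (q - 1)))"
    using q \<omega> by (simp add: powr_mult powr_powr Lp_norm_powr)
  finally have "\<bar>pairing (\<lambda>_. 1) u t\<bar> powr q
      \<le> (\<integral>x. \<bar>u t x\<bar> powr q \<partial>lborel) * (\<omega> powr (q - 1) * (1 + t) powr (real ?n * (q - 1)))" .
  then have "\<omega> powr (- (q - 1)) * (1 + t) powr (- (real ?n * (q - 1))) * \<bar>pairing (\<lambda>_. 1) u t\<bar> powr q
      \<le> (\<integral>x. \<bar>u t x\<bar> powr q \<partial>lborel)"
    using \<omega> t0 unfolding powr_minus by (simp add: field_simps)
  with pairing_one_source(2)[OF t] show ?thesis by (simp add: \<omega>_def)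
qed

end

section \<open>The lifespan estimate\<close>

lemma test_function_continuous:
  assumes "f \<in> test_functions \<Omega>"
  shows "continuous_on UNIV f"
proof -
  have "iterated_partial [] f differentiable_on UNIV"
    using assms unfolding test_functions_def smooth_fun_def by blast
  then show ?thesis using differentiable_imp_continuous_on by auto
qed

lemma integrable_compact_support_mult:
  fixes f w :: "'a::euclidean_space \<Rightarrow> real"
  assumes "continuous_on UNIV f" "continuous_on UNIV w" "\<And>x. norm x > R \<Longrightarrow> f x = 0"
  shows "integrable lborel (\<lambda>x. f x * w x)"
proof -
  have "integrable lborel (\<lambda>x. indicator (cball 0 R) x * (f x * w x))"
    by (intro integrable_on_cball continuous_intros assms)
  moreover have "(\<lambda>x. indicator (cball 0 R) x * (f x * w x)) = (\<lambda>x. f x * w x)"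
  proof
    fix x show "indicator (cball 0 R) x * (f x * w x) = f x * w x"
      using assms(3)[of x] by (cases "norm x > R") (auto simp: indicator_def)
  qed
  ultimately show ?thesis by simp
qed

lemma integral_pos_of_continuous:
  fixes f w :: "'a::euclidean_space \<Rightarrow> real"
  assumes f: "continuous_on UNIV f" "\<And>x. norm x > R \<Longrightarrow> f x = 0" "\<And>x. 0 \<le> f x" "f y \<noteq> 0"
    and w: "continuous_on UNIV w" "\<And>x. 1 \<le> w x"
  shows "0 < (\<integral>x. f x * w x \<partial>lborel)"
proof -
  have fy: "0 < f y" using f(3)[of y] f(4) by simp
  then obtain d where d: "d > 0" "\<And>x. dist x y < d \<Longrightarrow> dist (f x) (f y) < f y / 2"
    using f(1) unfolding continuous_on_iff by (metis UNIV_I half_gt_zero)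
  have "0 < (\<integral>x. indicator (ball y d) x * (f y / 2) \<partial>lborel)"
    using fy d(1) content_ball_pos[of d y] by simp
  also have "\<dots> \<le> (\<integral>x. f x * w x \<partial>lborel)"
  proof (rule Bochner_Integration.integral_mono)
    have "integrable lborel (indicator (ball y d) :: 'a \<Rightarrow> real)"
      by (intro integrable_real_indicator) (auto simp: emeasure_ball d less_imp_le)
    then show "integrable lborel (\<lambda>x. indicator (ball y d) x * (f y / 2))"
      by (rule integrable_mult_left)
    show "integrable lborel (\<lambda>x. f x * w x)"
      by (rule integrable_compact_support_mult[OF f(1) w(1) f(2)])
    fix x
    show "indicator (ball y d) x * (f y / 2) \<le> f x * w x"
    proof (cases "x \<in> ball y d")
      case True
      then have "\<bar>f x - f y\<bar> < f y / 2"
        using d(2)[of x] by (simp add: dist_real_def dist_commute)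
      then have "f y / 2 \<le> f x" by linarith
      also have "\<dots> \<le> f x * w x"
        using mult_left_mono[OF w(2) f(3)] by simp
      finally show ?thesis using True by simp
    next
      case False
      have "0 \<le> f x * w x" using f(3)[of x] w(2)[of x] by (intro mult_nonneg_nonneg) auto
      with False show ?thesis by simp
    qed
  qed
  finally show ?thesis .
qed

lemma (in cone_solution) pairing_initial:
  assumes "continuous_on UNIV u0" "continuous_on UNIV u1" "continuous_on UNIV \<Theta>"
  shows "pairing \<Theta> u 0 = (\<integral>x. u0 x * \<Theta> (x \<bullet> x) \<partial>lborel)" "pairing \<Theta> v 0 = (\<integral>x. u1 x * \<Theta> (x \<bullet> x) \<partial>lborel)"
proof -
  have 0: "0 \<in> time_interval T" using T by (simp add: time_interval_def zero_ereal_def)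
  have ae: "AE x in lborel. u 0 x = u0 x" "AE x in lborel. v 0 x = u1 x"
    using solution by (auto simp: cauchy_solution_def)
  have m: "u0 \<in> borel_measurable lborel" "u1 \<in> borel_measurable lborel"
    "(\<lambda>x::'a. \<Theta> (x \<bullet> x)) \<in> borel_measurable lborel"
    using borel_measurable_continuous_onI[OF assms(1)] borel_measurable_continuous_onI[OF assms(2)]
      borel_measurable_continuous_onI[OF continuous_on_radial[OF assms(3)]] by simp_all
  note mu = measurable_uv[OF 0]
  show "pairing \<Theta> u 0 = (\<integral>x. u0 x * \<Theta> (x \<bullet> x) \<partial>lborel)"
    unfolding pairing_def
  proof (rule integral_cong_AE)
    show "AE x in lborel. u 0 x * \<Theta> (x \<bullet> x) = u0 x * \<Theta> (x \<bullet> x)"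
      using ae(1) by eventually_elim simp
  qed (rule borel_measurable_times m mu)+
  show "pairing \<Theta> v 0 = (\<integral>x. u1 x * \<Theta> (x \<bullet> x) \<partial>lborel)"
    unfolding pairing_def
  proof (rule integral_cong_AE)
    show "AE x in lborel. v 0 x * \<Theta> (x \<bullet> x) = u1 x * \<Theta> (x \<bullet> x)"
      using ae(2) by eventually_elim simp
  qed (rule borel_measurable_times m mu)+
qed

text \<open>All constants are fixed before \<epsilon>: by linearity the data enter only through the
  factor \<epsilon> in front of a weighted integral of \<open>g\<close>, so the differential
  inequality lemma applies with \<delta> = \<epsilon>^p.\<close>

theorem cone_solution_lifespan:
  fixes f g :: "'a::euclidean_space \<Rightarrow> real"
  assumes m: "1 \<le> m" "DIM('a) = Suc m" and p: "1 < p" and q: "1 < q"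
    and f: "continuous_on UNIV f" "\<And>x. 0 \<le> f x"
    and g: "continuous_on UNIV g" "\<And>x. 0 \<le> g x" "\<And>x. norm x > 1 \<Longrightarrow> g x = 0" "g y \<noteq> 0"
    and subcritical: "0 < 2 * q + 2 - real m * p * (q - 1)"
  shows "\<exists>A>0. \<forall>\<epsilon> T u v. 0 < \<epsilon> \<and> \<epsilon> \<le> 1 \<and> cone_solution p q r (\<lambda>x. \<epsilon> * f x) (\<lambda>x. \<epsilon> * g x) T u v \<longrightarrow>
    T \<le> ereal (A * \<epsilon> powr (- (2 * p * (q - 1) / (2 * q + 2 - real m * p * (q - 1)))))"
proof -
  define p' where "p' = p / (p - 1)"
  have p': "0 < p'" using conjugate_exponent(1)[OF p] by (simp add: p'_def)
  obtain C where C: "C > 0" "\<And>t. 0 \<le> t \<Longrightarrow>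
    Lp_norm p' (\<lambda>x::'a. indicator (cball 0 (t + 1)) x * radial_weight m (x \<bullet> x))
      \<le> C * exp t * (1 + t) powr (real m / p' - real m / 2)"
    using Lp_norm_radial_weight[OF p' m] by blast
  define w where "w x = radial_weight m (x \<bullet> x)" for x :: 'a
  note cw = smooth1_continuous[OF smooth1_radial_weight[of m], of UNIV]
  have w: "continuous_on UNIV w" "\<And>x. 1 \<le> w x"
    unfolding w_def by (rule continuous_on_radial[OF cw], rule radial_weight_ge_1, simp)
  define g0 where "g0 = (\<integral>x. g x * w x \<partial>lborel)"
  have g0: "g0 > 0"
    unfolding g0_def by (rule integral_pos_of_continuous[OF g(1,3,2,4) w])
  \<comment> \<open>The 2 comes from \<open>pairing_weight_lower_bound\<close>, the \<open>C\<close>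
    from the norm of the weight, the power p from Hoelder.\<close>
  define A1 where "A1 = (g0 / 2 / C) powr p"
  have A1: "A1 > 0" using g0 C by (simp add: A1_def)
  define B where "B = unit_ball_vol (real (Suc m)) powr (- (q - 1))"
  have "unit_ball_vol (real (Suc m)) > 0" by simp
  then have B: "B > 0" unfolding B_def powr_gt_zero by linarith
  define \<alpha> where "\<alpha> = real m * (1 - p / 2)"
  define \<nu> where "\<nu> = real (Suc m) * (q - 1)"
  have \<nu>: "0 \<le> \<nu>" using q by (simp add: \<nu>_def)
  define \<beta> where "\<beta> = (\<alpha> + 2) * (q - 1) - \<nu> + 2"
  \<comment> \<open>The terms with m p aside, (\<alpha>+2)(q-1) - \<nu> + 2 collapses to q + 1; the
    factor 1/2 explains the 2 in the numerator of the lifespan exponent.\<close>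
  have \<beta>: "\<beta> = (2 * q + 2 - real m * p * (q - 1)) / 2"
    by (simp add: \<beta>_def \<alpha>_def \<nu>_def field_simps)
  with subcritical have \<beta>0: "0 < \<beta>" by simp
  obtain A where A: "A > 0" and life: "\<And>\<delta> T U V. 0 < \<delta> \<and> \<delta> \<le> 1 \<and>
      continuous_on (time_interval T) U \<and> continuous_on (time_interval T) V \<and> 0 \<le> U 0 \<and> 0 \<le> V 0 \<and>
      weak_ge {t. 0 < t \<and> ereal t < T} U V \<and>
      weak_ge {t. 0 < t \<and> ereal t < T} V (\<lambda>t. A1 * \<delta> * (1 + t) powr \<alpha>) \<and>
      weak_ge {t. 0 < t \<and> ereal t < T} V (\<lambda>t. B * (1 + t) powr (- \<nu>) * \<bar>U t\<bar> powr q)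
      \<Longrightarrow> T \<le> ereal (A * \<delta> powr (- ((q - 1) / \<beta>)))"
    using differential_inequality_lifespan[OF A1 B q \<nu> \<beta>0[unfolded \<beta>_def]] unfolding \<beta>_def by blast
  have "T \<le> ereal (A * \<epsilon> powr (- (2 * p * (q - 1) / (2 * q + 2 - real m * p * (q - 1)))))"
    if \<epsilon>: "0 < \<epsilon>" "\<epsilon> \<le> 1" and sol: "cone_solution p q r (\<lambda>x. \<epsilon> * f x) (\<lambda>x. \<epsilon> * g x) T u v"
    for \<epsilon> T u v
  proof -
    interpret cone_solution p q r "\<lambda>x. \<epsilon> * f x" "\<lambda>x. \<epsilon> * g x" T u v by (rule sol)
    have c: "continuous_on UNIV (\<lambda>x. \<epsilon> * f x)" "continuous_on UNIV (\<lambda>x. \<epsilon> * g x)"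
      by (intro continuous_intros f g)+
    have c1: "continuous_on UNIV (\<lambda>_::real. 1::real)" by simp
    define U where "U = pairing (\<lambda>_. 1) u"
    define V where "V = pairing (\<lambda>_. 1) v"
    have w0: "0 \<le> radial_weight m (x \<bullet> x)" for x :: 'a
      using radial_weight_ge_1[of "x \<bullet> x" m] by simp
    have init: "0 \<le> U 0" "0 \<le> V 0" "0 \<le> pairing (radial_weight m) u 0"
      "pairing (radial_weight m) v 0 = \<epsilon> * g0"
      using \<epsilon> f(2) g(2) w0
      by (auto simp: U_def V_def pairing_initial[OF c c1] pairing_initial[OF c cw] g0_def w_def mult.assoc
          intro!: Bochner_Integration.integral_nonneg)
    have contU: "continuous_on (time_interval T) U" and contV: "continuous_on (time_interval T) V"
      unfolding U_def V_def by (rule continuous_pairing[OF c1])+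
    \<comment> \<open>For the profile 1 the Laplacian drops out, so the lower bounds for the source
      are directly lower bounds for V'.\<close>
    have L: "radial_laplacian (real DIM('a)) (\<lambda>_. 1) = (\<lambda>_. 0)"
      by (simp add: radial_laplacian_def fun_eq_iff)
    have L0: "pairing (radial_laplacian (real DIM('a)) (\<lambda>_. 1)) u t = 0" for t
      unfolding L by (simp add: pairing_def)
    have UV: "weak_ge I U V"
      unfolding U_def V_def by (rule weak_ge_pairing_u[OF smooth1_const])
    have V1: "weak_ge I V (\<lambda>t. A1 * \<epsilon> powr p * (1 + t) powr \<alpha>)"
      unfolding V_def
    proof (rule weak_ge_pairing_v[OF smooth1_const])
      show "continuous_on I (\<lambda>t. A1 * \<epsilon> powr p * (1 + t) powr \<alpha>)"
        by (intro continuous_intros) (auto simp: I_def)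
      fix t assume t: "t \<in> I" "integrable lborel (source t)"
      have "\<epsilon> * g0 / 2 * exp t \<le> pairing (radial_weight m) v t"
        using pairing_weight_lower_bound[OF m(2) init(3) _ t(1)] init(4) \<epsilon> g0 by simp
      then have "(\<epsilon> * g0 / 2 / C) powr p * (1 + t) powr \<alpha> \<le> pairing (\<lambda>_. 1) source t"
        unfolding \<alpha>_def using C(2)[of t] t(1) \<epsilon> g0
        by (intro source_lower_bound_v[OF m(2) t C(1)]) (auto simp: p'_def I_def)
      moreover have "(\<epsilon> * g0 / 2 / C) powr p = A1 * \<epsilon> powr p"
        using powr_mult[of \<epsilon> "g0 / 2 / C" p] by (simp add: A1_def mult.commute)
      ultimately show "A1 * \<epsilon> powr p * (1 + t) powr \<alpha>
          \<le> pairing (radial_laplacian (real DIM('a)) (\<lambda>_. 1)) u t + pairing (\<lambda>_. 1) source t"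
        by (simp add: L0)
    qed
    have V2: "weak_ge I V (\<lambda>t. B * (1 + t) powr (- \<nu>) * \<bar>U t\<bar> powr q)"
      unfolding V_def
    proof (rule weak_ge_pairing_v[OF smooth1_const])
      have "continuous_on I U" by (rule continuous_on_subset[OF contU I_subset])
      then have c: "continuous_on I (\<lambda>t. \<bar>U t\<bar> powr q)"
        using q by (intro continuous_on_powr' continuous_intros) auto
      have "continuous_on I (\<lambda>t. B * (1 + t) powr (- \<nu>))"
        by (intro continuous_intros) (auto simp: I_def)
      from continuous_on_mult[OF this c]
      show "continuous_on I (\<lambda>t. B * (1 + t) powr (- \<nu>) * \<bar>U t\<bar> powr q)" .
      fix t assume t: "t \<in> I" "integrable lborel (source t)"
      show "B * (1 + t) powr (- \<nu>) * \<bar>U t\<bar> powr q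
          \<le> pairing (radial_laplacian (real DIM('a)) (\<lambda>_. 1)) u t + pairing (\<lambda>_. 1) source t"
        using source_lower_bound_u[OF t, unfolded m(2)] unfolding L0 B_def \<nu>_def U_def by simp
    qed
    have "\<epsilon> powr p \<le> 1" using \<epsilon> p by (intro powr_le1) auto
    then have "T \<le> ereal (A * (\<epsilon> powr p) powr (- ((q - 1) / \<beta>)))"
      using \<epsilon> contU contV init(1,2) UV V1 V2 unfolding I_def by (intro life[of _ T U V]) auto
    also have "(\<epsilon> powr p) powr (- ((q - 1) / \<beta>)) = \<epsilon> powr (- (2 * p * (q - 1) / (2 * q + 2 - real m * p * (q - 1))))"
      unfolding powr_powr \<beta> by (rule arg_cong[where f = "\<lambda>z. \<epsilon> powr z"]) simp
    finally show ?thesis .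
  qed
  with A show ?thesis by blast
qed

theorem theorem1p2:
  fixes f g :: "real ^ 'n \<Rightarrow> real" and n :: nat and p q r :: real
  assumes "n = CARD('n)" and "n \<ge> 2"
    and "f \<in> test_functions UNIV" and "g \<in> test_functions UNIV"
    and "\<And>x. f x \<ge> 0" and "\<And>x. g x \<ge> 0"
    and "\<And>x. norm x > 1 \<Longrightarrow> f x = 0 \<and> g x = 0"
    and "\<exists>x. g x \<noteq> 0"
    and "max 1 (2 / (real n - 1)) < p" and "p \<le> 2 * real n / (real n - 1)"
    and "1 < q"
    and "ereal q < min (ereal (4 / ((real n - 1) * p - 2) + 1)) (sobolev_exponent n)"
    and "r = max 2 p"
  shows "\<exists>\<epsilon>0>0. \<exists>A>0. \<forall>\<epsilon>. 0 < \<epsilon> \<and> \<epsilon> \<le> \<epsilon>0 \<longrightarrow>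
    (\<forall>T u v. 0 < T \<and> cauchy_solution p q (\<lambda>x. \<epsilon> * f x) (\<lambda>x. \<epsilon> * g x) T u v \<and>
        energy_regular r T u v \<and> supported_in_cone T u v \<longrightarrow> T < \<infinity>) \<and>
    lifespan p q r (\<lambda>x. \<epsilon> * f x) (\<lambda>x. \<epsilon> * g x)
      \<le> ereal (A * \<epsilon> powr (- (2 * p * (q - 1) / (2 * q + 2 - (real n - 1) * p * (q - 1)))))"
proof -
  define m where "m = n - 1"
  have m: "1 \<le> m" "DIM(real ^ 'n) = Suc m" "real m = real n - 1"
    using assms(1,2) by (auto simp: m_def of_nat_diff)
  have p: "1 < p" "2 < (real n - 1) * p"
    using assms(2,9) by (auto simp: field_simps)
  have "q < 4 / ((real n - 1) * p - 2) + 1" using assms(12) by simp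
  then have "(q - 1) * ((real n - 1) * p - 2) < 4"
    using p(2) by (simp add: field_simps)
  \<comment> \<open>The expression equals 4 - (q - 1)((n - 1) p - 2), so the condition on q is
    exactly positivity of the denominator in the exponent.\<close>
  then have sub: "0 < 2 * q + 2 - real m * p * (q - 1)"
    unfolding m(3) by (simp add: algebra_simps)
  obtain y where y: "g y \<noteq> 0" using assms(8) by blast
  have cont: "continuous_on UNIV f" "continuous_on UNIV g"
    using test_function_continuous assms(3,4) by blast+
  have g1: "\<And>x. norm x > 1 \<Longrightarrow> g x = 0" using assms(7) by blast
  define \<kappa> where "\<kappa> = 2 * p * (q - 1) / (2 * q + 2 - real m * p * (q - 1))"
  obtain A where A: "A > 0" and life: "\<And>\<epsilon> T u v. 0 < \<epsilon> \<Longrightarrow> \<epsilon> \<le> 1 \<Longrightarrow>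
      cone_solution p q r (\<lambda>x. \<epsilon> * f x) (\<lambda>x. \<epsilon> * g x) T u v \<Longrightarrow> T \<le> ereal (A * \<epsilon> powr (- \<kappa>))"
    using cone_solution_lifespan[OF m(1,2) p(1) assms(11) cont(1) assms(5) cont(2) assms(6) g1 y sub, of r]
    unfolding \<kappa>_def by blast
  have bound: "T \<le> ereal (A * \<epsilon> powr (- \<kappa>))"
    if "0 < \<epsilon>" "\<epsilon> \<le> 1" "0 < T" "cauchy_solution p q (\<lambda>x. \<epsilon> * f x) (\<lambda>x. \<epsilon> * g x) T u v"
      "energy_regular r T u v" "supported_in_cone T u v" for \<epsilon> T u v
    using that p(1) assms(11,13) by (intro life) (auto intro!: cone_solution.intro)
  show ?thesis
  proof (rule exI[of _ 1], rule conjI, simp, rule exI[of _ A], intro conjI allI impI)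
    fix \<epsilon> :: real assume \<epsilon>: "0 < \<epsilon> \<and> \<epsilon> \<le> 1"
    show "T < \<infinity>" if "0 < T \<and> cauchy_solution p q (\<lambda>x. \<epsilon> * f x) (\<lambda>x. \<epsilon> * g x) T u v \<and>
        energy_regular r T u v \<and> supported_in_cone T u v" for T u v
      using bound[of \<epsilon> T u v] that \<epsilon> by (auto intro: le_less_trans)
    \<comment> \<open>The bound is uniform over all solutions for this \<epsilon>, hence it passes
      to the supremum.\<close>
    show "lifespan p q r (\<lambda>x. \<epsilon> * f x) (\<lambda>x. \<epsilon> * g x)
      \<le> ereal (A * \<epsilon> powr (- (2 * p * (q - 1) / (2 * q + 2 - (real n - 1) * p * (q - 1)))))"
      unfolding lifespan_def m(3)[symmetric] \<kappa>_def[symmetric]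
      using bound \<epsilon> by (intro Sup_least) blast
  qed (use A in auto)
qed

end
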